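(* Let $f(x)\in\mathcal O[x]$, $x=(x_1,\dots,x_n)$, and $g(y)\in\mathcal O[y]$, $y=(y_1,\dots,y_m)$, be nonzero Newton non-critical polynomials with $f(0)=0$ and $g(0)=0$. Let $\mathcal D_f$ (resp. $\mathcal D_g$) be the set of primitive vectors in $\mathbb N^n\setminus\{0\}$ (resp. $\mathbb N^m\setminus\{0\}$) perpendicular to the facets of $\Gamma_f$ (resp. $\Gamma_g$). Then the Igusa local zeta function of $(f\oplus g)(x,y)=f(x)+g(y)$ has the form $$Z(f\oplus g;s)=\int_{\mathcal O^{n+m}}|f(x)+g(y)|^s\,|dx\,dy| = \frac{P(q^{-s})}{(1-q^{-1-s})\prod_{(a,b)\in\mathcal D_f\times\mathcal D_g}\left(1-q^{c_{a,b}(s)}\right)},$$ where $P$ is a polynomial in one variable with rational coefficients.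
   Context: $K$ is a $p$-adic field (finite extension of $\mathbb Q_p$) with ring of integers $\mathcal O$, uniformizer $\pi$, residue field $\mathbb F_q$, valuation $v=\mathrm{ord}_\pi$ ($v(0)=\infty$), absolute value $|\xi|=q^{-v(\xi)}$, and $|dx|$ the Haar measure on $K^n$ normalized so that $\mathcal O^n$ has measure $1$. For $\omega\in\mathbb N^n$, $x^\omega=x_1^{\omega_1}\cdots x_n^{\omega_n}$; for $a\in\mathbb R^n$, $|a|=a_1+\dots+a_n$. For $f=\sum_\omega a_\omega x^\omega$ with $f(0)=0$, $f\neq 0$, the Newton polyhedron $\Gamma_f$ is the convex hull of $\bigcup_{\omega\in\mathrm{supp}(f)}(\omega+(\mathbb R^+)^n)$, $\mathrm{supp}(f)=\{\omega: a_\omega\ne0\}$. Faces are $\Gamma_f$ itself and intersections of $\Gamma_f$ with supporting hyperplanes; facets are proper faces of codimension one; each facet has a unique primitive (gcd of coordinates $=1$) perpendicular vector in $\mathbb N^n\setminus\{0\}$. For $a\in(\mathbb R^+)^n$, $m_f(a)=\inf_{x\in\Gamma_f}a\cdot x$. For a face $\tau$, the face polynomial is $f_\tau=\sum_{\omega\in\tau}a_\omega x^\omega$. $f$ is Newton non-critical if for every face $\tau$ of $\Gamma_f$ the system $\partial f_\tau/\partial x_i=0$ ($1\le i\le n$) has no solution in $(K^\times)^n$. For $a\in\mathbb N^n$, $b\in\mathbb N^m$: if $m_f(a)>0$ and $m_g(b)>0$, put $l=\mathrm{lcm}(m_f(a),m_g(b))$, $e=m_f(a)/\gcd(m_f(a),m_g(b))$,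 $e'=m_g(b)/\gcd(m_f(a),m_g(b))$ and $c_{a,b}(s)=-ls-e|b|-e'|a|$; if $m_f(a)=0$ or $m_g(b)=0$, put $c_{a,b}(s)=-\infty$, with the convention $q^{-\infty}=0$ (so the corresponding factor equals $1$). *)

theory Defs
  imports "HOL-Analysis.Analysis" "HOL-Computational_Algebra.Polynomial"
begin

text \<open>The valuation is a function v on K; its value at 0 is irrelevant and
  "v(xi) >= k" (with v(0) = infinity) is expressed by vge.\<close>

definition vge :: "('k::field \<Rightarrow> int) \<Rightarrow> 'k \<Rightarrow> int \<Rightarrow> bool" where
  "vge v \<xi> k \<longleftrightarrow> \<xi> = 0 \<or> k \<le> v \<xi>"

text \<open>K (the type 'k) together with its normalized valuation v and residue field
  size q: K has characteristic 0, v is a normalized discrete valuation, K is complete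
  with respect to v, and the residue field O/(pi) has exactly q elements.  These are
  exactly the finite extensions of Q_p (p-adic fields).\<close>

definition p_adic_field :: "('k::field_char_0 \<Rightarrow> int) \<Rightarrow> nat \<Rightarrow> bool" where
  "p_adic_field v q \<longleftrightarrow>
     (\<forall>x y. x \<noteq> 0 \<longrightarrow> y \<noteq> 0 \<longrightarrow> v (x * y) = v x + v y) \<and>
     (\<forall>x y. x \<noteq> 0 \<longrightarrow> y \<noteq> 0 \<longrightarrow> x + y \<noteq> 0 \<longrightarrow> min (v x) (v y) \<le> v (x + y)) \<and>
     (\<exists>\<pi>. \<pi> \<noteq> 0 \<and> v \<pi> = 1) \<and>
     (\<forall>X :: nat \<Rightarrow> 'k. (\<forall>k. \<exists>N. \<forall>i\<ge>N. \<forall>j\<ge>N. vge v (X i - X j) k) \<longrightarrow>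
         (\<exists>L. \<forall>k. \<exists>N. \<forall>i\<ge>N. vge v (X i - L) k)) \<and>
     (\<exists>R. finite R \<and> card R = q \<and> R \<subseteq> {x. vge v x 0} \<and>
         (\<forall>x. vge v x 0 \<longrightarrow> (\<exists>!r. r \<in> R \<and> vge v (x - r) 1)))"

definition absv :: "('k::field \<Rightarrow> int) \<Rightarrow> nat \<Rightarrow> 'k \<Rightarrow> real" where
  "absv v q \<xi> = (if \<xi> = 0 then 0 else real q powr (- real_of_int (v \<xi>)))"

definition int_points :: "('k::field \<Rightarrow> int) \<Rightarrow> ('k ^ 'N) set" where
  "int_points v = {z. \<forall>i. vge v (z $ i) 0}"

text \<open>Haar measure on K^N normalized so that O^N has measure 1: a translation-invariant
  measure on the Borel sets (= sigma-algebra generated by the balls) of K^N.\<close>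
definition haar_normalized :: "('k::field \<Rightarrow> int) \<Rightarrow> ('k ^ 'N) measure \<Rightarrow> bool" where
  "haar_normalized v M \<longleftrightarrow>
     space M = UNIV \<and>
     sets M = sigma_sets UNIV {{z. \<forall>i. vge v (z $ i - c $ i) k} | c k. True} \<and>
     (\<forall>A \<in> sets M. \<forall>c. emeasure M ((\<lambda>z. c + z) ` A) = emeasure M A) \<and>
     emeasure M (int_points v) = 1"

definition igusa_zeta ::
  "('k::field \<Rightarrow> int) \<Rightarrow> nat \<Rightarrow> ('k ^ 'N) measure \<Rightarrow> ('k ^ 'N \<Rightarrow> 'k) \<Rightarrow> complex \<Rightarrow> complex" where
  "igusa_zeta v q M h s = (LINT z : int_points v | M. (complex_of_real (absv v q (h z))) powr s)"

text \<open>A polynomial sum_omega a_omega x^omega is represented by its coefficient function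
  A : N^n -> K (with finite support).\<close>

definition supp :: "(nat ^ 'n \<Rightarrow> 'k::zero) \<Rightarrow> (nat ^ 'n) set" where
  "supp A = {\<omega>. A \<omega> \<noteq> 0}"

definition mon :: "'k::comm_ring_1 ^ 'n \<Rightarrow> nat ^ 'n \<Rightarrow> 'k" where
  "mon x \<omega> = (\<Prod>i\<in>UNIV. (x $ i) ^ (\<omega> $ i))"

definition peval :: "(nat ^ 'n \<Rightarrow> 'k::comm_ring_1) \<Rightarrow> 'k ^ 'n \<Rightarrow> 'k" where
  "peval A x = (\<Sum>\<omega>\<in>supp A. A \<omega> * mon x \<omega>)"

definition pdiff :: "(nat ^ 'n \<Rightarrow> 'k::comm_ring_1) \<Rightarrow> 'n \<Rightarrow> 'k ^ 'n \<Rightarrow> 'k" where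
  "pdiff A i x = (\<Sum>\<omega>\<in>supp A. A \<omega> * of_nat (\<omega> $ i) *
       (\<Prod>j\<in>UNIV. (x $ j) ^ (if j = i then \<omega> $ j - 1 else \<omega> $ j)))"

definition rvec :: "nat ^ 'n \<Rightarrow> real ^ 'n" where
  "rvec \<omega> = (\<chi> i. real (\<omega> $ i))"

definition newton_poly :: "(nat ^ 'n \<Rightarrow> 'k::zero) \<Rightarrow> (real ^ 'n) set" where
  "newton_poly A = convex hull (\<Union>\<omega>\<in>supp A. {rvec \<omega> + r | r. \<forall>i. 0 \<le> r $ i})"

definition newton_faces :: "(nat ^ 'n \<Rightarrow> 'k::zero) \<Rightarrow> (real ^ 'n) set set" where
  "newton_faces A = {\<tau>. \<tau> exposed_face_of newton_poly A \<and> \<tau> \<noteq> {}}"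

definition face_poly :: "(nat ^ 'n \<Rightarrow> 'k::zero) \<Rightarrow> (real ^ 'n) set \<Rightarrow> nat ^ 'n \<Rightarrow> 'k" where
  "face_poly A \<tau> = (\<lambda>\<omega>. if rvec \<omega> \<in> \<tau> then A \<omega> else 0)"

definition newton_noncritical :: "(nat ^ 'n \<Rightarrow> 'k::comm_ring_1) \<Rightarrow> bool" where
  "newton_noncritical A \<longleftrightarrow>
     (\<forall>\<tau>\<in>newton_faces A. \<not> (\<exists>x. (\<forall>i. x $ i \<noteq> 0) \<and> (\<forall>i. pdiff (face_poly A \<tau>) i x = 0)))"

definition facet_normals :: "(nat ^ 'n \<Rightarrow> 'k::zero) \<Rightarrow> (nat ^ 'n) set" where
  "facet_normals A = {a. a \<noteq> 0 \<and> Gcd (range (\<lambda>i. a $ i)) = 1 \<and>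
     (\<exists>F. F facet_of newton_poly A \<and> (\<forall>x\<in>F. \<forall>y\<in>F. rvec a \<bullet> (x - y) = 0))}"

text \<open>m_f(a) = inf over Gamma of a.x (a nonnegative integer for a in N^n).\<close>
definition m_newton :: "(nat ^ 'n \<Rightarrow> 'k::zero) \<Rightarrow> nat ^ 'n \<Rightarrow> real" where
  "m_newton A a = Inf ((\<lambda>x. rvec a \<bullet> x) ` newton_poly A)"

definition norm1 :: "nat ^ 'n \<Rightarrow> nat" where
  "norm1 a = (\<Sum>i\<in>UNIV. a $ i)"

text \<open>q^(c_{a,b}(s)), with the convention q^(-infinity) = 0 when m_f(a)=0 or m_g(b)=0.\<close>
definition q_pow_c :: "nat \<Rightarrow> (nat ^ 'n \<Rightarrow> 'k::zero) \<Rightarrow> (nat ^ 'm \<Rightarrow> 'k) \<Rightarrow>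
    nat ^ 'n \<Rightarrow> nat ^ 'm \<Rightarrow> complex \<Rightarrow> complex" where
  "q_pow_c q A B a b s =
     (let mf = nat \<lfloor>m_newton A a\<rfloor>; mg = nat \<lfloor>m_newton B b\<rfloor> in
      if mf = 0 \<or> mg = 0 then 0
      else (of_nat q :: complex) powr
        (- of_nat (lcm mf mg) * s - of_nat (mf div gcd mf mg * norm1 b)
         - of_nat (mg div gcd mf mg * norm1 a)))"

end

theory Submission
  imports Defs "HOL-Library.Diagonal_Subsequence" "HOL-Computational_Algebra.Primes"
begin

text \<open>
  Decompose the integration domain by the valuation vectors \<open>(k, l)\<close> of \<open>(x, y)\<close>. On such a cell,
  \<open>f(x) = \<pi>\<^sup>M F(u)\<close> and \<open>g(y) = \<pi>\<^bsup>M'\<^esup> G(w)\<close> with \<open>u\<close>, \<open>w\<close> unit vectors, \<open>M = m\<^sub>f(k)\<close>, \<open>M' = m\<^sub>g(l)\<close>.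
  A compactness argument turns noncriticality into a bound, uniform in \<open>k\<close> and \<open>u\<close>, on the valuation of
  the gradient of \<open>F\<close> (likewise for \<open>G\<close>). By a Hensel argument the cell then contributes
  \<open>q\<^bsup>-|k|-|l|\<^esup> T\<^bsup>min M M'\<^esup> R(T) / (1 - T / q)\<close>, \<open>T = q\<^bsup>-s\<^esup>\<close>, where the rational polynomial \<open>R\<close> only depends
  on truncations of \<open>M - M'\<close> and of the exponents of \<open>\<pi>\<close> in the coefficients of \<open>F\<close> and \<open>G\<close>.

  Every weight \<open>k\<close> is a bounded weight plus a nonnegative integer combination of facet normals along
  which \<open>m\<^sub>f\<close> is additive. Hence, for a fixed truncated type, the sequence \<open>M \<mapsto> \<Sum> q\<^bsup>-|k|\<^esup>\<close> over the \<open>k\<close> with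
  \<open>m\<^sub>f(k) = M\<close> is killed up to finitely many terms by \<open>\<Prod> (1 - q\<^bsup>-|a|\<^esup> S\<^bsup>m\<^sub>f(a)\<^esup>)\<close>, the product being over the
  facet normals \<open>a\<close> and \<open>S\<close> being the unit delay. Pairing two such sequences against a kernel that
  is homogeneous under simultaneous delay produces exactly the factors \<open>1 - q\<^bsup>c(s)\<^esup>\<close> with \<open>c = c\<^bsub>a,b\<^esub>\<close>.
\<close>

section \<open>Valuations\<close>

text \<open>The sharp denominator is the obstacle. Cutting the product of the two normal fans along
  \<open>m_f(k) = m_g(l)\<close> and refining into unimodular cones creates new rays, and each would
  bring a spurious factor. So no cone is subdivided: the two weights stay in separate one-variable
  sequences, coupled only by the kernel. A weight may have several representations by facet normals;
  one is selected so that the selected exponent vectors are closed under decrease. The indicator of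
  such a set is eventually constant in every coordinate, so one difference per coordinate leaves
  finite support and every normal costs a single factor.

  For normals \<open>a\<close>, \<open>b\<close> the delays \<open>m_f(a)\<close>,
  \<open>m_g(b)\<close> first agree after \<open>e'\<close> and \<open>e\<close> steps, at their lcm
  \<open>l\<close>; the weights \<open>q^(-e'|a|)\<close> and \<open>q^(-e|b|)\<close> collected on
  the way and the homogeneity factor \<open>q^(-ls)\<close> multiply to \<open>q^c\<close>. A zero
  delay makes the operator a nonzero scalar, hence no factor. The remaining factor
  \<open>1 - q^(-1-s)\<close> is the geometric tail of Hensel lifting.\<close>

locale padic =
  fixes v :: "'k::field_char_0 \<Rightarrow> int" and q :: nat
  assumes padic: "p_adic_field v q"
begin

lemma v_mult: "x \<noteq> 0 \<Longrightarrow> y \<noteq> 0 \<Longrightarrow> v (x * y) = v x + v y"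
  using padic unfolding p_adic_field_def by blast

lemma v_add: "x \<noteq> 0 \<Longrightarrow> y \<noteq> 0 \<Longrightarrow> x + y \<noteq> 0 \<Longrightarrow> min (v x) (v y) \<le> v (x + y)"
  using padic unfolding p_adic_field_def by blast

lemma v_one: "v 1 = 0"
  using v_mult[of 1 1] by simp

lemma v_uminus: "v (- x) = v x"
proof (cases "x = 0")
  case False
  have "v (-1) + v (-1) = 0"
    using v_mult[of "-1" "-1"] by (simp add: v_one)
  then show ?thesis
    using v_mult[of "-1" x] False by simp
qed simp

lemma v_power: "x \<noteq> 0 \<Longrightarrow> v (x ^ n) = int n * v x"
  by (induction n) (auto simp: v_one v_mult algebra_simps)

lemma v_inverse: "x \<noteq> 0 \<Longrightarrow> v (inverse x) = - v x"
  using v_mult[of x "inverse x"] by (simp add: v_one)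

lemma vge_zero [simp]: "vge v 0 e"
  by (simp add: vge_def)

lemma vge_nonzero: "x \<noteq> 0 \<Longrightarrow> vge v x e \<longleftrightarrow> e \<le> v x"
  by (simp add: vge_def)

lemma vge_mono: "vge v x e \<Longrightarrow> e' \<le> e \<Longrightarrow> vge v x e'"
  by (auto simp: vge_def)

lemma vge_add: "vge v x e \<Longrightarrow> vge v y e \<Longrightarrow> vge v (x + y) e"
  using v_add[of x y] by (fastforce simp: vge_def)

lemma vge_uminus [simp]: "vge v (- x) e \<longleftrightarrow> vge v x e"
  by (auto simp: vge_def v_uminus)

lemma vge_diff: "vge v x e \<Longrightarrow> vge v y e \<Longrightarrow> vge v (x - y) e"
  using vge_add[of x e "- y"] by simp

lemma vge_sym: "vge v (x - y) e \<longleftrightarrow> vge v (y - x) e"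
  using vge_uminus[of "x - y" e] by simp

lemma vge_trans: "vge v (x - y) e \<Longrightarrow> vge v (y - z) e \<Longrightarrow> vge v (x - z) e"
  using vge_add[of "x - y" e "y - z"] by simp

lemma vge_cong_iff: "vge v (x - y) e \<Longrightarrow> vge v x e \<longleftrightarrow> vge v y e"
  using vge_add[of "x - y" e y] vge_diff[of x e "x - y"] by auto

lemma vge_mult: "vge v x e \<Longrightarrow> vge v y e' \<Longrightarrow> vge v (x * y) (e + e')"
  by (cases "x = 0 \<or> y = 0") (auto simp: vge_def v_mult)

lemma vge_mult_left: "vge v x 0 \<Longrightarrow> vge v y e \<Longrightarrow> vge v (x * y) e"
  using vge_mult[of x 0 y e] by simp

lemma vge_mult_right: "vge v x e \<Longrightarrow> vge v y 0 \<Longrightarrow> vge v (x * y) e"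
  using vge_mult[of x e y 0] by simp

lemma vge_one [simp]: "vge v 1 0"
  by (simp add: vge_def v_one)

lemma vge_power: "vge v x 0 \<Longrightarrow> vge v (x ^ n) 0"
  by (induction n) (auto intro: vge_mult_left)

lemma vge_prod: "(\<And>i. i \<in> I \<Longrightarrow> vge v (f i) 0) \<Longrightarrow> vge v (\<Prod>i\<in>I. f i) 0"
  by (induction I rule: infinite_finite_induct) (auto intro: vge_mult_left)

lemma vge_sum: "(\<And>i. i \<in> I \<Longrightarrow> vge v (f i) e) \<Longrightarrow> vge v (\<Sum>i\<in>I. f i) e"
  by (induction I rule: infinite_finite_induct) (auto intro: vge_add)

lemma vge_of_nat [simp]: "vge v (of_nat n) 0"
  by (induction n) (auto intro: vge_add)

lemma vge_all_imp_zero: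
  assumes "\<And>e::nat. vge v x (int e)"
  shows "x = 0"
  using assms[of "nat (v x + 1)"] by (auto simp: vge_def split: if_splits)

lemma vge_mult_cong:
  assumes "vge v x 0" "vge v y' 0" "vge v (x - x') e" "vge v (y - y') e"
  shows "vge v (x * y - x' * y') e"
proof -
  have "x * y - x' * y' = x * (y - y') + (x - x') * y'"
    by (simp add: algebra_simps)
  then show ?thesis
    using assms by (simp add: vge_add vge_mult_left vge_mult_right)
qed

lemma vge_power_cong:
  assumes "vge v x 0" "vge v x' 0" "vge v (x - x') e"
  shows "vge v (x ^ n - x' ^ n) e"
  by (induction n) (use assms in \<open>auto intro!: vge_mult_cong vge_power\<close>)

lemma vge_prod_cong:
  assumes "\<And>i. i \<in> I \<Longrightarrow> vge v (f i) 0" "\<And>i. i \<in> I \<Longrightarrow> vge v (g i) 0"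
    and "\<And>i. i \<in> I \<Longrightarrow> vge v (f i - g i) e"
  shows "vge v ((\<Prod>i\<in>I. f i) - (\<Prod>i\<in>I. g i)) e"
  using assms
  by (induction I rule: infinite_finite_induct) (auto intro!: vge_mult_cong vge_prod)

section \<open>Uniformizer and residue systems modulo its powers\<close>

definition unif :: 'k where
  "unif = (SOME p. p \<noteq> 0 \<and> v p = 1)"

lemma unif: "unif \<noteq> 0" "v unif = 1"
proof -
  have "\<exists>p. p \<noteq> 0 \<and> v p = 1"
    using padic unfolding p_adic_field_def by blast
  from someI_ex[OF this] show "unif \<noteq> 0" "v unif = 1"
    unfolding unif_def by auto
qed

lemma v_unif_power: "v (unif ^ n) = int n"
  by (simp add: v_power unif)

lemma vge_unif_power: "vge v (unif ^ n) e \<longleftrightarrow> e \<le> int n"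
  by (simp add: vge_nonzero unif v_unif_power)

lemma vge_unif_power_mult: "vge v (unif ^ n * x) e \<longleftrightarrow> vge v x (e - int n)"
  by (cases "x = 0") (auto simp: vge_nonzero unif v_unif_power v_mult)

lemma vge_unif_power_divide: "vge v (x / unif ^ n) e \<longleftrightarrow> vge v x (e + int n)"
  using vge_unif_power_mult[of n "x / unif ^ n" "e + int n"] by (simp add: unif)

text \<open>Source of all truncations of exponents: modulo \<open>unif ^ N\<close> the powers with
  exponent at least \<open>N\<close> are indistinguishable.\<close>

lemma vge_unif_power_min: "vge v (unif ^ n - unif ^ min n N) (int N)"
  by (cases "n \<le> N") (auto simp: min_def vge_unif_power intro!: vge_diff)

definition is_reps :: "nat \<Rightarrow> 'k set \<Rightarrow> bool" where
  "is_reps e R \<longleftrightarrow> finite R \<and> card R = q ^ e \<and> R \<subseteq> {x. vge v x 0} \<and>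
     (\<forall>x. vge v x 0 \<longrightarrow> (\<exists>!r. r \<in> R \<and> vge v (x - r) (int e)))"

text \<open>Digit expansion: a residue modulo \<open>unif ^ Suc e\<close> is a residue
  \<open>r\<close> modulo \<open>unif ^ e\<close> plus \<open>unif ^ e\<close> times one further
  digit from the residue field. Uniqueness of both parts gives injectivity, hence the count
  \<open>q ^ Suc e\<close>.\<close>

lemma ex_reps: "\<exists>R. is_reps e R"
proof (induction e)
  case 0
  have "is_reps 0 {0}"
    by (auto simp: is_reps_def)
  then show ?case ..
next
  case (Suc e)
  then obtain R where R: "is_reps e R" ..
  have "\<exists>R1. finite R1 \<and> card R1 = q \<and> R1 \<subseteq> {x. vge v x 0} \<and>
      (\<forall>x. vge v x 0 \<longrightarrow> (\<exists>!r. r \<in> R1 \<and> vge v (x - r) 1))"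
    using padic unfolding p_adic_field_def by blast
  then obtain R1 where R1: "finite R1" "card R1 = q" "R1 \<subseteq> {x. vge v x 0}"
    "\<And>x. vge v x 0 \<Longrightarrow> (\<exists>!r. r \<in> R1 \<and> vge v (x - r) 1)" by blast
  define g where "g = (\<lambda>(r, s). r + unif ^ e * s)"
  have key: "vge v (x - g (r, s)) (int (Suc e)) \<longleftrightarrow>
      vge v (x - r) (int e) \<and> vge v ((x - r) / unif ^ e - s) 1"
    if "s \<in> R1" for x r s
  proof -
    have "x - g (r, s) = unif ^ e * ((x - r) / unif ^ e - s)"
      by (simp add: g_def unif field_simps)
    then have 1: "vge v (x - g (r, s)) (int (Suc e)) \<longleftrightarrow> vge v ((x - r) / unif ^ e - s) 1"
      by (simp add: vge_unif_power_mult)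
    have "vge v ((x - r) / unif ^ e) 0" if "vge v ((x - r) / unif ^ e - s) 1"
      using vge_mono[OF that, of 0] R1(3) \<open>s \<in> R1\<close> vge_cong_iff by auto
    then show ?thesis
      using 1 by (auto simp: vge_unif_power_divide)
  qed
  have gO: "vge v (g x) 0" if "x \<in> R \<times> R1" for x
    using that R R1(3) unfolding g_def is_reps_def
    by (auto intro!: vge_add vge_mult_left vge_power simp: vge_unif_power vge_nonzero unif)
  have ex: "\<exists>!p. p \<in> R \<times> R1 \<and> vge v (x - g p) (int (Suc e))" if x: "vge v x 0" for x
  proof -
    obtain r where r: "r \<in> R" "vge v (x - r) (int e)"
      and r_un: "\<And>r'. r' \<in> R \<Longrightarrow> vge v (x - r') (int e) \<Longrightarrow> r' = r"
      using R x unfolding is_reps_def by metis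
    have "vge v ((x - r) / unif ^ e) 0"
      using r by (simp add: vge_unif_power_divide)
    then obtain s where s: "s \<in> R1" "vge v ((x - r) / unif ^ e - s) 1"
      and s_un: "\<And>s'. s' \<in> R1 \<Longrightarrow> vge v ((x - r) / unif ^ e - s') 1 \<Longrightarrow> s' = s"
      using R1(4) by metis
    show ?thesis
    proof (rule ex1I[of _ "(r, s)"])
      show "(r, s) \<in> R \<times> R1 \<and> vge v (x - g (r, s)) (int (Suc e))"
        using r s key by auto
      fix p assume p: "p \<in> R \<times> R1 \<and> vge v (x - g p) (int (Suc e))"
      obtain r' s' where [simp]: "p = (r', s')" by force
      have "vge v (x - r') (int e)" "vge v ((x - r') / unif ^ e - s') 1" "r' \<in> R" "s' \<in> R1"
        using p key by auto
      then show "p = (r, s)"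
        using r_un s_un by auto
    qed
  qed
  have inj: "inj_on g (R \<times> R1)"
  proof (rule inj_onI)
    fix p p' assume "p \<in> R \<times> R1" "p' \<in> R \<times> R1" "g p = g p'"
    then show "p = p'"
      using ex[OF gO[of p]] by (metis diff_self vge_zero)
  qed
  have "is_reps (Suc e) (g ` (R \<times> R1))"
    unfolding is_reps_def
  proof (intro conjI allI impI)
    show "finite (g ` (R \<times> R1))"
      using R R1 by (auto simp: is_reps_def)
    show "card (g ` (R \<times> R1)) = q ^ Suc e"
      using R R1 inj by (simp add: card_image is_reps_def card_cartesian_product)
    show "g ` (R \<times> R1) \<subseteq> {x. vge v x 0}"
      using gO by auto
    fix x assume x: "vge v x 0"
    from ex[OF x] obtain p where p: "p \<in> R \<times> R1" "vge v (x - g p) (int (Suc e))"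
      and un: "\<And>p'. p' \<in> R \<times> R1 \<Longrightarrow> vge v (x - g p') (int (Suc e)) \<Longrightarrow> p' = p" by metis
    show "\<exists>!r. r \<in> g ` (R \<times> R1) \<and> vge v (x - r) (int (Suc e))"
      by (rule ex1I[of _ "g p"]) (use p in blast, use un in blast)
  qed
  then show ?case ..
qed

definition reps :: "nat \<Rightarrow> 'k set" where
  "reps e = (SOME R. is_reps e R)"

lemma is_reps: "is_reps e (reps e)"
  unfolding reps_def by (rule someI_ex[OF ex_reps])

lemma finite_reps: "finite (reps e)" and card_reps: "card (reps e) = q ^ e"
  and reps_integral: "r \<in> reps e \<Longrightarrow> vge v r 0"
  using is_reps[of e] by (auto simp: is_reps_def)

lemma ex1_rep: "vge v x 0 \<Longrightarrow> \<exists>!r. r \<in> reps e \<and> vge v (x - r) (int e)"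
  using is_reps[of e] by (auto simp: is_reps_def)

text \<open>The elements 0 and 1 lie in different residue classes.\<close>

lemma q_ge_2: "2 \<le> q"
proof -
  obtain r s where r: "r \<in> reps 1" "vge v (0 - r) 1" and s: "s \<in> reps 1" "vge v (1 - s) 1"
    using ex1_rep[of 0 1] ex1_rep[of 1 1] by auto
  have "r \<noteq> s"
  proof
    assume "r = s"
    then have "vge v (1 - 0) 1"
      using r s vge_trans[of 1 s 1 0] vge_sym by metis
    then show False by (simp add: vge_def v_one)
  qed
  then have "card {r, s} = 2" by simp
  moreover have "card {r, s} \<le> card (reps 1)"
    by (rule card_mono) (use r s finite_reps in auto)
  ultimately show ?thesis by (simp add: card_reps)
qed

lemma complete:
  fixes X :: "nat \<Rightarrow> 'k"
  assumes "\<And>k. \<exists>N. \<forall>i\<ge>N. \<forall>j\<ge>N. vge v (X i - X j) k"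
  shows "\<exists>L. \<forall>k. \<exists>N. \<forall>i\<ge>N. vge v (X i - L) k"
  using padic[unfolded p_adic_field_def, THEN conjunct2, THEN conjunct2, THEN conjunct2, THEN conjunct1,
      THEN spec[of _ X]] assms by simp

section \<open>Congruence of vectors and sequential compactness of the integral points\<close>

definition vcong :: "nat \<Rightarrow> 'k ^ 'N::finite \<Rightarrow> 'k ^ 'N \<Rightarrow> bool" where
  "vcong e z w \<longleftrightarrow> (\<forall>i. vge v (z $ i - w $ i) (int e))"

lemma vcong_refl [simp]: "vcong e z z"
  by (simp add: vcong_def)

lemma vcong_sym: "vcong e z w \<Longrightarrow> vcong e w z"
  unfolding vcong_def by (metis vge_sym)

lemma vcong_trans: "vcong e z w \<Longrightarrow> vcong e w y \<Longrightarrow> vcong e z y"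
  unfolding vcong_def by (metis vge_trans)

lemma vcong_mono: "vcong e z w \<Longrightarrow> e' \<le> e \<Longrightarrow> vcong e' z w"
  unfolding vcong_def by (metis vge_mono of_nat_le_iff)

lemma vcong_int_points: "vcong e z w \<Longrightarrow> z \<in> int_points v \<longleftrightarrow> w \<in> int_points v"
  unfolding vcong_def int_points_def by (simp, metis vge_mono vge_cong_iff of_nat_0_le_iff)

definition vreps :: "nat \<Rightarrow> ('k ^ 'N::finite) set" where
  "vreps e = {z. \<forall>i. z $ i \<in> reps e}"

lemma vreps_eq_image: "vreps e = vec_lambda ` (UNIV \<rightarrow>\<^sub>E reps e)"
proof -
  have "z \<in> vec_lambda ` (UNIV \<rightarrow>\<^sub>E reps e)" if "\<forall>i. z $ i \<in> reps e" for z :: "'k ^ 'N"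
    by (rule image_eqI[of _ _ "vec_nth z"]) (use that in \<open>auto simp: PiE_iff\<close>)
  then show ?thesis
    by (auto simp: vreps_def PiE_iff)
qed

lemma finite_vreps: "finite (vreps e :: ('k ^ 'N::finite) set)"
  unfolding vreps_eq_image by (intro finite_imageI finite_PiE finite_reps) auto

lemma card_vreps: "card (vreps e :: ('k ^ 'N::finite) set) = q ^ (e * CARD('N))"
proof -
  have "card (vec_lambda ` (UNIV \<rightarrow>\<^sub>E reps e) :: ('k ^ 'N) set) = card ((UNIV :: 'N set) \<rightarrow>\<^sub>E reps e)"
    by (rule card_image) (auto intro!: inj_onI simp: vec_lambda_inject)
  then show ?thesis
    by (simp add: vreps_eq_image card_PiE card_reps power_mult)
qed

lemma vreps_int_points: "vreps e \<subseteq> int_points v"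
  using reps_integral by (auto simp: vreps_def int_points_def)

lemma ex1_vrep:
  assumes "z \<in> int_points v"
  shows "\<exists>!r. r \<in> vreps e \<and> vcong e z r"
proof -
  have "\<forall>i. \<exists>!r. r \<in> reps e \<and> vge v (z $ i - r) (int e)"
    using assms by (auto simp: int_points_def intro!: ex1_rep)
  then obtain r where r: "\<And>i. r i \<in> reps e \<and> vge v (z $ i - r i) (int e)"
    and un: "\<And>i r'. r' \<in> reps e \<Longrightarrow> vge v (z $ i - r') (int e) \<Longrightarrow> r' = r i"
    by metis
  show ?thesis
    by (rule ex1I[of _ "vec_lambda r"])
      (use r in \<open>simp add: vreps_def vcong_def\<close>, use un in \<open>simp add: vreps_def vcong_def vec_eq_iff\<close>)
qed

text \<open>There are finitely many classes modulo each \<open>unif ^ e\<close>, so a diagonal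
  subsequence is eventually constant modulo every power; completeness then supplies the limit
  coordinatewise.\<close>

lemma convergent_subseq:
  fixes X :: "nat \<Rightarrow> 'k ^ 'N::finite"
  assumes X: "\<And>j. X j \<in> int_points v"
  shows "\<exists>(r :: nat \<Rightarrow> nat) L. strict_mono r \<and> (\<forall>e. \<exists>J. \<forall>j\<ge>J. vcong e (X (r j)) L)"
proof -
  define P where "P = (\<lambda>e (s :: nat \<Rightarrow> nat). \<forall>i j. vcong e (X (s i)) (X (s j)))"
  interpret subseqs P
  proof
    fix e and s :: "nat \<Rightarrow> nat" assume "strict_mono s"
    define c where "c = (\<lambda>z :: 'k ^ 'N. THE r. r \<in> vreps e \<and> vcong e z r)"
    have c: "c (X j) \<in> vreps e" "vcong e (X j) (c (X j))" for j
      using theI'[OF ex1_vrep[OF X[of j], of e]] by (auto simp: c_def)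
    have "finite ((\<lambda>j. c (X (s j))) ` UNIV)"
      by (rule finite_subset[OF _ finite_vreps]) (use c in auto)
    from pigeonhole_infinite[OF _ this] obtain j0
      where "infinite {j. c (X (s j)) = c (X (s j0))}" by auto
    then obtain r :: "nat \<Rightarrow> nat" where r: "strict_mono r" "\<And>j. c (X (s (r j))) = c (X (s j0))"
      by (metis (mono_tags, lifting) infinite_enumerate mem_Collect_eq)
    have "P e (s \<circ> r)"
      unfolding P_def o_def using r(2) c(2) vcong_sym vcong_trans by metis
    then show "\<exists>r'. strict_mono r' \<and> P e (s \<circ> r')"
      using r(1) by blast
  qed
  have cauchy: "vcong e (X (diagseq i)) (X (diagseq j))" if "Suc e \<le> i" "Suc e \<le> j" for e i j
  proof -
    \<comment> \<open>Only from index \<open>Suc e\<close> on is the diagonal sequence a subsequence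
      of the one refined for \<open>e\<close>.\<close>
    have "P e (diagseq \<circ> (+) (Suc e))"
      by (rule diagseq_holds) (auto simp: P_def)
    then have "vcong e (X (diagseq (Suc e + (i - Suc e)))) (X (diagseq (Suc e + (j - Suc e))))"
      unfolding P_def o_def by blast
    then show ?thesis
      using that by simp
  qed
  have "\<exists>L. \<forall>k. \<exists>N. \<forall>j\<ge>N. vge v (X (diagseq j) $ i - L) k" for i
  proof (rule complete)
    fix k :: int
    have "vge v (X (diagseq a) $ i - X (diagseq b) $ i) k"
      if "Suc (nat k) \<le> a" "Suc (nat k) \<le> b" for a b
      using cauchy[OF that] unfolding vcong_def by (auto intro: vge_mono)
    then show "\<exists>N. \<forall>a\<ge>N. \<forall>b\<ge>N. vge v (X (diagseq a) $ i - X (diagseq b) $ i) k"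
      by blast
  qed
  then obtain L where L: "\<And>i k. \<exists>N. \<forall>j\<ge>N. vge v (X (diagseq j) $ i - L i) k"
    by metis
  have "\<exists>J. \<forall>j\<ge>J. vcong e (X (diagseq j)) (vec_lambda L)" for e
  proof -
    have "\<forall>i. \<exists>N. \<forall>j\<ge>N. vge v (X (diagseq j) $ i - L i) (int e)"
      using L by blast
    from choice[OF this] obtain N
      where N: "\<And>i j. N i \<le> j \<Longrightarrow> vge v (X (diagseq j) $ i - L i) (int e)"
      by blast
    have "vcong e (X (diagseq j)) (vec_lambda L)" if "Max (range N) \<le> j" for j
      using that N by (auto simp: vcong_def)
    then show ?thesis by blast
  qed
  then have "strict_mono diagseq \<and> (\<forall>e. \<exists>J. \<forall>j\<ge>J. vcong e (X (diagseq j)) (vec_lambda L))"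
    using subseq_diagseq by simp
  then show ?thesis by blast
qed

end

section \<open>Haar measure of congruence-invariant sets\<close>

locale haar = padic v q for v :: "'k::field_char_0 \<Rightarrow> int" and q +
  fixes M :: "('k ^ 'N::finite) measure"
  assumes haar: "haar_normalized v M"
begin

text \<open>Unions of residue classes modulo \<open>unif ^ e\<close> inside the integral points:
  open compact sets, whose measure is a matter of counting.\<close>

definition cyl :: "nat \<Rightarrow> ('k ^ 'N) set \<Rightarrow> bool" where
  "cyl e S \<longleftrightarrow> S \<subseteq> int_points v \<and> (\<forall>z\<in>S. \<forall>w. vcong e z w \<longrightarrow> w \<in> S)"

lemma cylI: "S \<subseteq> int_points v \<Longrightarrow> (\<And>z w. z \<in> S \<Longrightarrow> vcong e z w \<Longrightarrow> w \<in> S) \<Longrightarrow> cyl e S"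
  by (auto simp: cyl_def)

lemma cylD: "cyl e S \<Longrightarrow> z \<in> S \<Longrightarrow> vcong e z w \<Longrightarrow> w \<in> S"
  by (auto simp: cyl_def)

lemma cyl_integral: "cyl e S \<Longrightarrow> z \<in> S \<Longrightarrow> z \<in> int_points v"
  by (auto simp: cyl_def)

lemma cyl_int_points: "cyl e (int_points v)"
  using vcong_int_points by (auto intro!: cylI)

lemma space_M: "space M = UNIV"
  using haar by (simp add: haar_normalized_def)

lemma ball_sets: "{z. vcong e z c} \<in> sets M"
proof -
  have "sets M = sigma_sets UNIV {{z. \<forall>i. vge v (z $ i - c $ i) k} | c k. True}"
    using haar by (simp add: haar_normalized_def)
  moreover have "{z. vcong e z c} \<in> {{z. \<forall>i. vge v (z $ i - c $ i) k} | c k. True}"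
    by (auto simp: vcong_def)
  ultimately show ?thesis
    by (auto intro: sigma_sets.Basic)
qed

lemma emeasure_translate: "A \<in> sets M \<Longrightarrow> emeasure M ((\<lambda>z. c + z) ` A) = emeasure M A"
  using haar by (simp add: haar_normalized_def)

lemma emeasure_int_points: "emeasure M (int_points v) = 1"
  using haar by (simp add: haar_normalized_def)

lemma emeasure_ball: "emeasure M {z. vcong e z c} = emeasure M {z. vcong e z 0}"
proof -
  have "w \<in> (\<lambda>z. c + z) ` {z. vcong e z 0}" if "vcong e w c" for w
    by (rule image_eqI[of _ _ "w - c"]) (use that in \<open>auto simp: vcong_def\<close>)
  then have "(\<lambda>z. c + z) ` {z. vcong e z 0} = {z. vcong e z c}"
    by (auto simp: vcong_def)
  then show ?thesis
    using emeasure_translate[OF ball_sets, of c e 0] by simp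
qed

lemma cyl_eq_Union_balls:
  assumes S: "cyl e S"
  shows "S = (\<Union>r\<in>S \<inter> vreps e. {z. vcong e z r})"
proof (intro equalityI subsetI)
  fix z assume z: "z \<in> S"
  obtain r where "r \<in> vreps e" "vcong e z r"
    using ex1_vrep[OF cyl_integral[OF S z], of e] by auto
  then show "z \<in> (\<Union>r\<in>S \<inter> vreps e. {z. vcong e z r})"
    using cylD[OF S z] by auto
next
  fix z assume "z \<in> (\<Union>r\<in>S \<inter> vreps e. {z. vcong e z r})"
  then show "z \<in> S"
    using cylD[OF S] vcong_sym by blast
qed

lemma disjoint_vrep_balls: "disjoint_family_on (\<lambda>r. {z :: 'k ^ 'N. vcong e z r}) (vreps e)"
  unfolding disjoint_family_on_def
proof (intro ballI impI)
  fix r s assume rs: "r \<in> vreps e" "s \<in> vreps e" "r \<noteq> s"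
  have "r \<in> int_points v"
    using rs vreps_int_points by blast
  then have "\<not> vcong e r s"
    using ex1_vrep[of r e] rs vcong_refl by blast
  then show "{z. vcong e z r} \<inter> {z. vcong e z s} = {}"
    using vcong_trans vcong_sym by blast
qed

lemma cyl_sets: "cyl e S \<Longrightarrow> S \<in> sets M"
  by (subst cyl_eq_Union_balls) (auto intro!: sets.finite_UN ball_sets simp: finite_vreps)

lemma emeasure_cyl:
  assumes "cyl e S"
  shows "emeasure M S = of_nat (card (S \<inter> vreps e)) * emeasure M {z. vcong e z 0}"
proof -
  have "emeasure M S = emeasure M (\<Union>r\<in>S \<inter> vreps e. {z. vcong e z r})"
    using cyl_eq_Union_balls[OF assms] by simp
  also have "\<dots> = (\<Sum>r\<in>S \<inter> vreps e. emeasure M {z. vcong e z r})"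
    by (rule sum_emeasure[symmetric])
      (use disjoint_vrep_balls[of e] ball_sets finite_vreps[of e] in \<open>auto simp: disjoint_family_on_def\<close>)
  also have "\<dots> = (\<Sum>r\<in>S \<inter> vreps e. emeasure M {z. vcong e z 0})"
    by (rule sum.cong[OF refl emeasure_ball])
  also have "\<dots> = of_nat (card (S \<inter> vreps e)) * emeasure M {z. vcong e z 0}"
    by simp
  finally show ?thesis .
qed

lemma cyl_finite_emeasure: "cyl e S \<Longrightarrow> emeasure M S \<noteq> \<infinity>"
  using emeasure_mono[of S "int_points v" M] cyl_sets[OF cyl_int_points] emeasure_int_points
  by (auto simp: cyl_def top_unique)

lemma cyl_fmeasurable: "cyl e S \<Longrightarrow> S \<in> fmeasurable M"
  using cyl_finite_emeasure cyl_sets by (auto intro!: fmeasurableI simp: less_top)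

lemma measure_int_points: "measure M (int_points v) = 1"
  by (simp add: measure_def emeasure_int_points)

lemma q_pos: "0 < real q" "1 < real q"
  using q_ge_2 by auto

text \<open>The residue classes are translates of one another and together fill the integral points,
  which have measure 1. Rationality of all volumes, and in the end of the coefficients of the
  numerator, comes from here.\<close>

lemma measure_cyl:
  assumes "cyl e S"
  shows "measure M S = real (card (S \<inter> vreps e)) / real q ^ (e * CARD('N))"
proof -
  have eq: "measure M S = real (card (S \<inter> vreps e)) * measure M {z. vcong e z 0}" if "cyl e S" for S
    using emeasure_cyl[OF that] by (simp add: measure_def enn2real_mult)
  have "int_points v \<inter> vreps e = (vreps e :: ('k ^ 'N) set)"
    using vreps_int_points by blast
  then have "1 = real q ^ (e * CARD('N)) * measure M {z. vcong e z 0}"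
    using eq[OF cyl_int_points] by (simp add: measure_int_points card_vreps)
  then show ?thesis
    using eq[OF assms] q_pos by (simp add: field_simps)
qed

lemma measure_cyl_Rats: "cyl e S \<Longrightarrow> measure M S \<in> \<rat>"
  by (simp add: measure_cyl)

lemma measure_cyl_Union:
  assumes "T = (\<Union>i\<in>I. S i)" "disjoint_family_on S I" "finite I" "\<And>i. i \<in> I \<Longrightarrow> cyl e (S i)"
  shows "measure M T = (\<Sum>i\<in>I. measure M (S i))"
  unfolding assms(1)
proof (rule measure_finite_Union)
  show "S ` I \<subseteq> sets M"
    using assms cyl_sets by blast
  show "emeasure M (S i) \<noteq> \<infinity>" if "i \<in> I" for i
    using assms that cyl_finite_emeasure by blast
qed (use assms in auto)

lemma cyl_translate:
  assumes "cyl e S" "c \<in> int_points v"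
  shows "cyl e {z. z + c \<in> S}" "measure M {z. z + c \<in> S} = measure M S"
proof -
  show "cyl e {z. z + c \<in> S}"
  proof (rule cylI)
    show "{z. z + c \<in> S} \<subseteq> int_points v"
    proof
      fix z assume "z \<in> {z. z + c \<in> S}"
      then have "z + c \<in> int_points v"
        using assms cyl_integral by blast
      then show "z \<in> int_points v"
        using assms(2) vge_diff[of "z $ i + c $ i" 0 "c $ i" for i] by (auto simp: int_points_def)
    qed
    fix z w assume "z \<in> {z. z + c \<in> S}" "vcong e z w"
    then show "w \<in> {z. z + c \<in> S}"
      using cylD[OF assms(1), of "z + c" "w + c"] by (simp add: vcong_def)
  qed
  have "z \<in> (\<lambda>z. - c + z) ` S" if "z + c \<in> S" for z
    by (rule image_eqI[of _ _ "z + c"]) (use that in auto)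
  then have "{z. z + c \<in> S} = (\<lambda>z. - c + z) ` S"
    by auto
  then show "measure M {z. z + c \<in> S} = measure M S"
    using emeasure_translate[OF cyl_sets[OF assms(1)], of "- c"] by (simp add: measure_def)
qed

text \<open>What lifting needs from an integral polynomial \<open>H\<close> with partial derivatives
  \<open>D\<close>: integrality, compatibility with congruences, and a first-order expansion along
  each axis with error quadratic in the step.\<close>

definition smooth :: "('k ^ 'N \<Rightarrow> 'k) \<Rightarrow> ('N \<Rightarrow> 'k ^ 'N \<Rightarrow> 'k) \<Rightarrow> bool" where
  "smooth H D \<longleftrightarrow> (\<forall>z\<in>int_points v. vge v (H z) 0 \<and> (\<forall>i. vge v (D i z) 0) \<and>
     (\<forall>e w. vcong e z w \<longrightarrow> vge v (H z - H w) (int e) \<and> (\<forall>i. vge v (D i z - D i w) (int e))) \<and>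
     (\<forall>i e t. vge v t (int e) \<longrightarrow> vge v (H (z + axis i t) - H z - t * D i z) (2 * int e)))"

lemma axis_int_points: "vge v t 0 \<Longrightarrow> axis i t \<in> int_points v"
  by (auto simp: int_points_def axis_def)

lemma add_int_points: "z \<in> int_points v \<Longrightarrow> w \<in> int_points v \<Longrightarrow> z + w \<in> int_points v"
  by (auto simp: int_points_def intro: vge_add)

lemma vcong_axis: "vge v t (int e) \<Longrightarrow> vcong e z (z + axis i t)"
  by (auto simp: vcong_def axis_def)

text \<open>Over the residue field this is a linear equation in \<open>r\<close> whose coefficient
  is a unit.\<close>

lemma ex1_residue_solution:
  assumes "vge v h 0" "\<epsilon> \<noteq> 0" "v \<epsilon> = 0"
  shows "\<exists>!r. r \<in> reps 1 \<and> vge v (h + r * \<epsilon>) 1"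
proof -
  have "vge v (h + r * \<epsilon>) 1 \<longleftrightarrow> vge v (- h / \<epsilon> - r) (int 1)" for r
  proof -
    have "h + r * \<epsilon> = - (\<epsilon> * (- h / \<epsilon> - r))"
      using assms by (simp add: field_simps)
    then have "vge v (h + r * \<epsilon>) 1 \<longleftrightarrow> vge v (\<epsilon> * (- h / \<epsilon> - r)) 1"
      by (simp only: vge_uminus)
    moreover have "vge v (\<epsilon> * x) 1 \<longleftrightarrow> vge v x (int 1)" for x
      using assms v_mult[of \<epsilon> x] by (cases "x = 0") (auto simp: vge_nonzero)
    ultimately show ?thesis by blast
  qed
  moreover have "vge v (- h / \<epsilon>) 0"
    unfolding divide_inverse by (rule vge_mult_left) (use assms in \<open>auto simp: vge_nonzero v_inverse\<close>)
  ultimately show ?thesis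
    using ex1_rep[of "- h / \<epsilon>" 1] by simp
qed

text \<open>On the fibre where the partial derivative in direction \<open>i\<close> has valuation \<open>g\<close>, exactly one of
  the \<open>q\<close> translates by \<open>unif ^ (e - g) * r\<close> in that direction improves divisibility of \<open>H\<close> from
  \<open>e\<close> to \<open>e + 1\<close>; translation invariance of the measure then gives the factor \<open>q\<close>.\<close>
lemma density:
  assumes sm: "smooth H D" and X: "cyl 1 X"
    and nd: "\<And>z. z \<in> X \<Longrightarrow> \<exists>i. \<not> vge v (D i z) (int c + 1)"
    and e: "2 * c + 1 \<le> e"
  shows "measure M {z\<in>X. vge v (H z) (int (Suc e))} = measure M {z\<in>X. vge v (H z) (int e)} / real q"
proof -
  \<comment> \<open>A direction whose partial derivative has valuation at most \<open>c\<close>. The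
    choice depends only on the classes of the \<open>D i z\<close> modulo
    \<open>unif ^ (c + 1)\<close>, so it is constant on congruence classes and the pieces
    \<open>Y\<close> below are cylinder sets.\<close>
  define \<iota> where "\<iota> = (\<lambda>z. SOME i. \<not> vge v (D i z) (int c + 1))"
  define \<gamma> where "\<gamma> = (\<lambda>z. nat (v (D (\<iota> z) z)))"
  have \<iota>: "\<not> vge v (D (\<iota> z) z) (int c + 1)" if "z \<in> X" for z
    unfolding \<iota>_def by (rule someI_ex[OF nd[OF that]])
  have XO: "z \<in> int_points v" if "z \<in> X" for z
    using cyl_integral[OF X that] .
  have D: "D (\<iota> z) z \<noteq> 0" "v (D (\<iota> z) z) = int (\<gamma> z)" "\<gamma> z \<le> c" if "z \<in> X" for z
  proof -
    show nz: "D (\<iota> z) z \<noteq> 0"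
      using \<iota>[OF that] by (auto simp: vge_def)
    have "0 \<le> v (D (\<iota> z) z)"
      using sm XO[OF that] nz unfolding smooth_def by (auto simp: vge_def)
    then show "v (D (\<iota> z) z) = int (\<gamma> z)" "\<gamma> z \<le> c"
      using \<iota>[OF that] by (auto simp: \<gamma>_def vge_def)
  qed
  have inv: "w \<in> X \<and> \<iota> w = \<iota> z \<and> \<gamma> w = \<gamma> z" if z: "z \<in> X" and zw: "vcong (c + 1) z w" for z w
  proof -
    have w: "w \<in> X"
      using cylD[OF X z] vcong_mono[OF zw] by auto
    have cong: "vge v (D i z - D i w) (int c + 1)" for i
      using sm XO[OF z] zw unfolding smooth_def by (metis of_nat_Suc Suc_eq_plus1 add.commute)
    have eq: "vge v (D i z) b \<longleftrightarrow> vge v (D i w) b" if "b \<le> int c + 1" for i b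
      by (rule vge_cong_iff) (rule vge_mono[OF cong that])
    have i: "\<iota> w = \<iota> z"
      unfolding \<iota>_def using eq by auto
    have "v (D (\<iota> z) z) = v (D (\<iota> z) w)"
    proof (rule antisym)
      have "vge v (D (\<iota> z) w) (v (D (\<iota> z) z))"
        using eq[of "v (D (\<iota> z) z)" "\<iota> z"] D[OF z] by (simp add: vge_nonzero)
      then show "v (D (\<iota> z) z) \<le> v (D (\<iota> z) w)"
        using D(1)[OF w] i by (simp add: vge_nonzero)
      have "vge v (D (\<iota> z) z) (v (D (\<iota> z) w))"
        using eq[of "v (D (\<iota> z) w)" "\<iota> z"] D[OF w] i by (simp add: vge_nonzero)
      then show "v (D (\<iota> z) w) \<le> v (D (\<iota> z) z)"
        using D(1)[OF z] by (simp add: vge_nonzero)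
    qed
    then show ?thesis
      using w i by (simp add: \<gamma>_def)
  qed
  define Y where "Y = (\<lambda>(i, g). {z\<in>X. vge v (H z) (int e) \<and> \<iota> z = i \<and> \<gamma> z = g})"
  define Y' where "Y' = (\<lambda>p. {z\<in>Y p. vge v (H z) (int (Suc e))})"
  have Hinv: "vge v (H w) (int a) \<longleftrightarrow> vge v (H z) (int a)" if "z \<in> X" "vcong a z w" for z w a
    using sm XO[OF that(1)] that(2) vge_cong_iff unfolding smooth_def by blast
  have cylY: "cyl (Suc e) (Y p)" and cylY': "cyl (Suc e) (Y' p)" for p
  proof -
    obtain i g where [simp]: "p = (i, g)" by force
    show Y: "cyl (Suc e) (Y p)"
    proof (rule cylI)
      show "Y p \<subseteq> int_points v"
        using XO by (auto simp: Y_def)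
      fix z w assume z: "z \<in> Y p" and zw: "vcong (Suc e) z w"
      have zX: "z \<in> X" using z by (auto simp: Y_def)
      have 1: "vcong (c + 1) z w" and 2: "vcong e z w"
        using vcong_mono[OF zw] e by auto
      show "w \<in> Y p"
        using inv[OF zX 1] Hinv[OF zX 2] z by (auto simp: Y_def)
    qed
    show "cyl (Suc e) (Y' p)"
    proof (rule cylI)
      show "Y' p \<subseteq> int_points v"
        using XO by (auto simp: Y_def Y'_def)
      fix z w assume z: "z \<in> Y' p" and zw: "vcong (Suc e) z w"
      then have "w \<in> Y p"
        using cylD[OF Y] by (auto simp: Y'_def)
      moreover have "z \<in> X" using z by (auto simp: Y_def Y'_def)
      ultimately show "w \<in> Y' p"
        using Hinv[OF _ zw] z by (auto simp: Y'_def)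
    qed
  qed
  have main: "measure M (Y (i, g)) = real q * measure M (Y' (i, g))" if g: "g \<le> c" for i g
  proof -
    \<comment> \<open>A shift by \<open>unif ^ a * t\<close> along axis \<open>i\<close> moves
      \<open>H\<close> by a multiple of \<open>unif ^ e\<close>, up to an error divisible by
      \<open>unif ^ (2 * a)\<close>. From \<open>g \<le> c\<close> and
      \<open>2 * c + 1 \<le> e\<close> follow \<open>e + 1 \<le> 2 * a\<close>, so the error is
      invisible, and \<open>c + 1 \<le> a\<close>, so the shift stays in the same piece.\<close>
    define a where "a = e - g"
    have a: "c + 1 \<le> a" "a + g = e" "int e + 1 \<le> 2 * int a"
      using e g by (auto simp: a_def)
    have step: "z + axis i (unif ^ a * t) \<in> Y (i, g) \<and>
        (vge v (H (z + axis i (unif ^ a * t))) (int (Suc e)) \<longleftrightarrow>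
         vge v (H z / unif ^ e + t * (D i z / unif ^ g)) 1)"
      if z: "z \<in> Y (i, g)" and t: "vge v t 0" for z t
    proof -
      have zX: "z \<in> X" and i: "\<iota> z = i" and gg: "\<gamma> z = g" and Hz: "vge v (H z) (int e)"
        using z by (auto simp: Y_def)
      have ut: "vge v (unif ^ a * t) (int a)"
        using t by (simp add: vge_unif_power_mult)
      have "vcong a z (z + axis i (unif ^ a * t))"
        by (rule vcong_axis[OF ut])
      then have cc: "vcong (c + 1) z (z + axis i (unif ^ a * t))"
        using vcong_mono a by blast
      have "vge v (H (z + axis i (unif ^ a * t)) - H z - unif ^ a * t * D i z) (2 * int a)"
        using sm XO[OF zX] ut unfolding smooth_def by blast
      then have T: "vge v (H (z + axis i (unif ^ a * t)) - (H z + unif ^ a * t * D i z)) (int (Suc e))"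
        using a(3) by (intro vge_mono[of _ "2 * int a" "int (Suc e)"]) (auto simp: algebra_simps)
      have id: "H z + unif ^ a * t * D i z = unif ^ e * (H z / unif ^ e + t * (D i z / unif ^ g))"
        using unif by (simp add: a(2)[symmetric] power_add field_simps)
      have "vge v (D i z) (int g)"
        using D[OF zX] i gg by (simp add: vge_def)
      then have "vge v (H z / unif ^ e + t * (D i z / unif ^ g)) 0"
        using Hz t by (intro vge_add vge_mult_left) (auto simp: vge_unif_power_divide)
      then have "vge v (H z + unif ^ a * t * D i z) (int e)"
        unfolding id by (simp add: vge_unif_power_mult)
      then have "vge v (H (z + axis i (unif ^ a * t))) (int e)"
        using vge_cong_iff[OF vge_mono[OF T, of "int e"]] by auto
      then have 1: "z + axis i (unif ^ a * t) \<in> Y (i, g)"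
        using inv[OF zX cc] i gg by (auto simp: Y_def)
      have "vge v (H (z + axis i (unif ^ a * t))) (int (Suc e)) \<longleftrightarrow>
          vge v (H z + unif ^ a * t * D i z) (int (Suc e))"
        by (rule vge_cong_iff[OF T])
      also have "\<dots> \<longleftrightarrow> vge v (H z / unif ^ e + t * (D i z / unif ^ g)) 1"
        unfolding id by (simp add: vge_unif_power_mult)
      finally show ?thesis using 1 by blast
    qed
    define w where "w = (\<lambda>r. axis i (unif ^ a * r) :: 'k ^ 'N)"
    have wO: "w r \<in> int_points v" if "r \<in> reps 1" for r
      unfolding w_def using reps_integral[OF that]
      by (intro axis_int_points vge_mult_left) (auto simp: vge_unif_power)
    have ex1: "\<exists>!r. r \<in> reps 1 \<and> z + w r \<in> Y' (i, g)" if z: "z \<in> Y (i, g)" for z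
    proof -
      have zX: "z \<in> X" and i: "\<iota> z = i" and gg: "\<gamma> z = g" and Hz: "vge v (H z) (int e)"
        using z by (auto simp: Y_def)
      have "v (D i z / unif ^ g) = 0"
        using D[OF zX] i gg unif by (simp add: divide_inverse v_mult v_inverse v_unif_power)
      then have "\<exists>!r. r \<in> reps 1 \<and> vge v (H z / unif ^ e + r * (D i z / unif ^ g)) 1"
        using Hz D(1)[OF zX] i unif by (intro ex1_residue_solution) (auto simp: vge_unif_power_divide)
      moreover have "z + w r \<in> Y' (i, g) \<longleftrightarrow> vge v (H z / unif ^ e + r * (D i z / unif ^ g)) 1"
        if "r \<in> reps 1" for r
        using step[OF z reps_integral[OF that]] by (auto simp: Y'_def w_def)
      ultimately show ?thesis
        by (metis (no_types, lifting))
    qed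
    have bwd: "z \<in> Y (i, g)" if r: "r \<in> reps 1" and z: "z + w r \<in> Y' (i, g)" for r z
    proof -
      have "z + w r \<in> Y (i, g)" using z by (simp add: Y'_def)
      then have "(z + w r) + axis i (unif ^ a * (- r)) \<in> Y (i, g)"
        using step[of "z + w r" "- r"] reps_integral[OF r] by simp
      moreover have "(z + w r) + axis i (unif ^ a * (- r)) = z"
        by (simp add: w_def vec_eq_iff axis_def)
      ultimately show ?thesis by (simp only:)
    qed
    \<comment> \<open>Each point of \<open>Y\<close> reaches \<open>Y'\<close> by exactly one of the
      \<open>q\<close> shifts, so \<open>Y\<close> is a disjoint union of \<open>q\<close>
      translates of \<open>Y'\<close>.\<close>
    have "Y (i, g) = (\<Union>r\<in>reps 1. {z. z + w r \<in> Y' (i, g)})"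
      using ex1 bwd by blast
    moreover have "disjoint_family_on (\<lambda>r. {z. z + w r \<in> Y' (i, g)}) (reps 1)"
      unfolding disjoint_family_on_def using ex1 bwd by blast
    ultimately have "measure M (Y (i, g)) = (\<Sum>r\<in>reps 1. measure M {z. z + w r \<in> Y' (i, g)})"
      by (rule measure_cyl_Union) (use finite_reps cyl_translate(1)[OF cylY' wO] in auto)
    also have "\<dots> = real q * measure M (Y' (i, g))"
      using cyl_translate(2)[OF cylY' wO] by (simp add: card_reps)
    finally show ?thesis .
  qed
  have U: "measure M {z\<in>X. vge v (H z) (int e)} = (\<Sum>p\<in>UNIV \<times> {..c}. measure M (Y p))"
  proof -
    have "{z\<in>X. vge v (H z) (int e)} = (\<Union>p\<in>UNIV \<times> {..c}. Y p)"
      using D(3) by (auto simp: Y_def)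
    moreover have "disjoint_family_on Y (UNIV \<times> {..c})"
      by (auto simp: disjoint_family_on_def Y_def)
    ultimately show ?thesis
      by (rule measure_cyl_Union[OF _ _ _ cylY]) simp
  qed
  have U': "measure M {z\<in>X. vge v (H z) (int (Suc e))} = (\<Sum>p\<in>UNIV \<times> {..c}. measure M (Y' p))"
  proof -
    have "{z\<in>X. vge v (H z) (int (Suc e))} = (\<Union>p\<in>UNIV \<times> {..c}. Y' p)"
      using D(3) vge_mono[of "H _" "int (Suc e)" "int e"] by (auto simp: Y_def Y'_def)
    moreover have "disjoint_family_on Y' (UNIV \<times> {..c})"
      by (auto simp: disjoint_family_on_def Y_def Y'_def)
    ultimately show ?thesis
      by (rule measure_cyl_Union[OF _ _ _ cylY']) simp
  qed
  have "measure M {z\<in>X. vge v (H z) (int e)} = real q * measure M {z\<in>X. vge v (H z) (int (Suc e))}"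
    unfolding U U' sum_distrib_left by (rule sum.cong) (auto simp: main)
  then show ?thesis
    using q_pos by (simp add: field_simps)
qed

section \<open>Scaling of coordinates by powers of the uniformizer\<close>

definition scaled :: "('N \<Rightarrow> nat) \<Rightarrow> ('k ^ 'N) set \<Rightarrow> ('k ^ 'N) set" where
  "scaled \<kappa> S = {z. (\<chi> i. z $ i / unif ^ \<kappa> i) \<in> S}"

lemma cyl_scaled:
  assumes "cyl e S"
  shows "cyl (e + sum \<kappa> UNIV) (scaled \<kappa> S)"
proof (rule cylI)
  show "scaled \<kappa> S \<subseteq> int_points v"
  proof
    fix z assume "z \<in> scaled \<kappa> S"
    then have "(\<chi> i. z $ i / unif ^ \<kappa> i) \<in> int_points v"
      using assms cyl_integral by (auto simp: scaled_def)
    then show "z \<in> int_points v"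
      by (auto simp: int_points_def vge_unif_power_divide intro: vge_mono)
  qed
  fix z w assume z: "z \<in> scaled \<kappa> S" and zw: "vcong (e + sum \<kappa> UNIV) z w"
  have "vge v (z $ i / unif ^ \<kappa> i - w $ i / unif ^ \<kappa> i) (int e)" for i
  proof -
    have "\<kappa> i \<le> sum \<kappa> UNIV" by (rule member_le_sum) auto
    then have "int e + int (\<kappa> i) \<le> int (e + sum \<kappa> UNIV)" by linarith
    moreover have "vge v (z $ i - w $ i) (int (e + sum \<kappa> UNIV))"
      using zw unfolding vcong_def by blast
    ultimately have "vge v (z $ i - w $ i) (int e + int (\<kappa> i))"
      using vge_mono by blast
    then show ?thesis
      by (simp add: vge_unif_power_divide flip: diff_divide_distrib)
  qed
  then have "vcong e (\<chi> i. z $ i / unif ^ \<kappa> i) (\<chi> i. w $ i / unif ^ \<kappa> i)"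
    by (simp add: vcong_def)
  then show "w \<in> scaled \<kappa> S"
    using z cylD[OF assms] by (auto simp: scaled_def)
qed

text \<open>Scaling turns residue balls into translates of one another, so the scaled measure is
  proportional to the number of balls, hence to the measure; the constant is read off from the
  integral points.\<close>

lemma measure_scaled_aux:
  assumes S: "cyl e S"
  shows "measure M (scaled \<kappa> S) = measure M S * measure M (scaled \<kappa> (int_points v))"
proof -
  define \<beta> where "\<beta> = measure M (scaled \<kappa> {z. vcong e z 0})"
  define E where "E = e + sum \<kappa> UNIV"
  have ball: "cyl e {z. vcong e z r}" if "r \<in> int_points v" for r
    using that vcong_int_points vcong_sym vcong_trans by (intro cylI; blast)
  have zero: "(0 :: 'k ^ 'N) \<in> int_points v"
    by (simp add: int_points_def)
  have b: "measure M (scaled \<kappa> {z. vcong e z r}) = \<beta>" if r: "r \<in> int_points v" for r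
  proof -
    define c where "c = (\<chi> i. - (unif ^ \<kappa> i * r $ i))"
    have "c \<in> int_points v"
      using r by (auto simp: c_def int_points_def vge_unif_power intro: vge_mult_left)
    moreover have "scaled \<kappa> {z. vcong e z r} = {z. z + c \<in> scaled \<kappa> {z. vcong e z 0}}"
      using unif by (auto simp: scaled_def vcong_def c_def diff_divide_distrib)
    ultimately show ?thesis
      unfolding \<beta>_def using cyl_translate(2)[OF cyl_scaled[OF ball[OF zero]]] by simp
  qed
  have eq: "measure M (scaled \<kappa> S) = real (card (S \<inter> vreps e)) * \<beta>" if S: "cyl e S" for S
  proof -
    have rO: "r \<in> int_points v" if "r \<in> S \<inter> vreps e" for r
      using that cyl_integral[OF S] by blast
    have "scaled \<kappa> S = (\<Union>r\<in>S \<inter> vreps e. scaled \<kappa> {z. vcong e z r})"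
      using cyl_eq_Union_balls[OF S] unfolding scaled_def by auto
    moreover have "disjoint_family_on (\<lambda>r. scaled \<kappa> {z. vcong e z r}) (S \<inter> vreps e)"
      using disjoint_vrep_balls[of e] unfolding disjoint_family_on_def scaled_def by auto
    moreover have "finite (S \<inter> vreps e)"
      using finite_vreps by blast
    ultimately have "measure M (scaled \<kappa> S) = (\<Sum>r\<in>S \<inter> vreps e. measure M (scaled \<kappa> {z. vcong e z r}))"
      by (rule measure_cyl_Union) (rule cyl_scaled[OF ball[OF rO]])
    then show ?thesis
      using b rO by simp
  qed
  have "int_points v \<inter> vreps e = (vreps e :: ('k ^ 'N) set)"
    using vreps_int_points by blast
  then have "measure M (scaled \<kappa> (int_points v)) = real q ^ (e * CARD('N)) * \<beta>"
    using eq[OF cyl_int_points] by (simp add: card_vreps)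
  then show ?thesis
    using eq[OF S] measure_cyl[OF S] q_pos by simp
qed

text \<open>The \<open>q\<close> translates of this set by the residues along axis \<open>i\<close>
  partition the integral points.\<close>

lemma measure_coordinate_divisible: "measure M {z\<in>int_points v. vge v (z $ i) 1} = 1 / real q"
proof -
  define S where "S = {z\<in>int_points v. vge v ((z::'k ^ 'N) $ i) 1}"
  have S: "cyl 1 S"
  proof (rule cylI)
    show "S \<subseteq> int_points v" by (auto simp: S_def)
    fix z w assume z: "z \<in> S" and zw: "vcong 1 z w"
    have "vge v (z $ i - w $ i) 1"
      using zw by (auto simp: vcong_def)
    then show "w \<in> S"
      using z zw vge_cong_iff[of "z $ i" "w $ i" 1] vcong_int_points[OF zw] by (auto simp: S_def)
  qed
  have tr: "axis i (- r) \<in> int_points v" if "r \<in> reps 1" for r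
    using reps_integral[OF that] by (intro axis_int_points) simp
  have mem: "z + axis i (- r) \<in> S \<longleftrightarrow> z \<in> int_points v \<and> vge v (z $ i - r) (int 1)" if r: "r \<in> reps 1" for r z
  proof -
    have "z + axis i (- r) + axis i r = z"
      by (simp add: vec_eq_iff axis_def)
    then have "z + axis i (- r) \<in> int_points v \<longleftrightarrow> z \<in> int_points v"
      using add_int_points[OF _ tr[OF r]] add_int_points[OF _ axis_int_points[OF reps_integral[OF r]]] by metis
    then show ?thesis
      by (simp add: S_def axis_def)
  qed
  have zO: "vge v (z $ i) 0" if "z \<in> int_points v" for z :: "'k ^ 'N"
    using that by (simp add: int_points_def)
  have "int_points v = (\<Union>r\<in>reps 1. {z. z + axis i (- r) \<in> S})"
    using ex1_rep[OF zO, of _ 1] mem by blast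
  moreover have "disjoint_family_on (\<lambda>r. {z. z + axis i (- r) \<in> S}) (reps 1)"
    unfolding disjoint_family_on_def using ex1_rep[OF zO, of _ 1] mem by blast
  ultimately have "measure M (int_points v) = (\<Sum>r\<in>reps 1. measure M {z. z + axis i (- r) \<in> S})"
    by (rule measure_cyl_Union) (use finite_reps cyl_translate(1)[OF S tr] in auto)
  also have "\<dots> = real q * measure M S"
    using cyl_translate(2)[OF S tr] by (simp add: card_reps)
  finally show ?thesis
    using q_pos by (simp add: measure_int_points S_def field_simps)
qed

lemma measure_scaled_int_points: "measure M (scaled \<kappa> (int_points v)) = 1 / real q ^ sum \<kappa> UNIV"
proof (induction "sum \<kappa> UNIV" arbitrary: \<kappa>)
  case 0
  then have "\<kappa> i = 0" for i by simp
  then have "scaled \<kappa> (int_points v) = int_points v"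
    by (simp add: scaled_def)
  then show ?case
    using 0 by (simp add: measure_int_points flip: 0)
next
  case (Suc n)
  then obtain i where i: "\<kappa> i \<noteq> 0"
    by (metis sum.neutral nat.distinct(1))
  define \<kappa>' where "\<kappa>' = \<kappa>(i := \<kappa> i - 1)"
  have sum: "sum \<kappa> UNIV = Suc (sum \<kappa>' UNIV)"
    using i by (simp add: \<kappa>'_def sum.remove[of UNIV i])
  \<comment> \<open>One power of \<open>unif\<close> in coordinate \<open>i\<close> is traded for a
    divisibility condition there, which contributes the factor \<open>1 / q\<close>.\<close>
  have "scaled \<kappa> (int_points v) = scaled \<kappa>' {z\<in>int_points v. vge v (z $ i) 1}"
  proof -
    have "z \<in> scaled \<kappa> (int_points v) \<longleftrightarrow> z \<in> scaled \<kappa>' {z\<in>int_points v. vge v (z $ i) 1}" for z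
    proof -
      have "z \<in> scaled \<kappa> (int_points v) \<longleftrightarrow> (\<forall>j. vge v (z $ j) (int (\<kappa> j)))"
        by (simp add: scaled_def int_points_def vge_unif_power_divide)
      also have "\<dots> \<longleftrightarrow> (\<forall>j. vge v (z $ j) (int (\<kappa>' j))) \<and> vge v (z $ i) (1 + int (\<kappa>' i))"
      proof -
        have "1 + int (\<kappa>' i) = int (\<kappa> i)" "\<And>j. int (\<kappa>' j) \<le> int (\<kappa> j)" "\<And>j. j \<noteq> i \<Longrightarrow> \<kappa>' j = \<kappa> j"
          using i by (auto simp: \<kappa>'_def)
        then show ?thesis
          by (metis vge_mono)
      qed
      also have "\<dots> \<longleftrightarrow> z \<in> scaled \<kappa>' {z\<in>int_points v. vge v (z $ i) 1}"
        by (simp add: scaled_def int_points_def vge_unif_power_divide)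
      finally show ?thesis .
    qed
    then show ?thesis by blast
  qed
  moreover have "cyl 1 {z\<in>int_points v. vge v (z $ i) 1}"
  proof (rule cylI)
    fix z w :: "'k ^ 'N" assume z: "z \<in> {z\<in>int_points v. vge v (z $ i) 1}" and zw: "vcong 1 z w"
    have "vge v (z $ i - w $ i) 1"
      using zw by (auto simp: vcong_def)
    then show "w \<in> {z\<in>int_points v. vge v (z $ i) 1}"
      using z zw vge_cong_iff[of "z $ i" "w $ i" 1] vcong_int_points[OF zw] by auto
  qed auto
  ultimately have "measure M (scaled \<kappa> (int_points v)) = 1 / real q * (1 / real q ^ sum \<kappa>' UNIV)"
    using measure_scaled_aux measure_coordinate_divisible Suc(1)[of \<kappa>'] sum Suc(2) by simp
  then show ?case
    by (simp add: sum)
qed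

lemma measure_scaled:
  assumes "cyl e S"
  shows "measure M (scaled \<kappa> S) = measure M S / real q ^ sum \<kappa> UNIV"
  using measure_scaled_aux[OF assms] by (simp add: measure_scaled_int_points)

end

section \<open>The zeta integral as a sum over cells\<close>

context haar
begin

definition units :: "('k ^ 'N) set" where
  "units = {z. \<forall>i. z $ i \<noteq> 0 \<and> v (z $ i) = 0}"

lemma units_iff: "z \<in> units \<longleftrightarrow> z \<in> int_points v \<and> (\<forall>i. \<not> vge v (z $ i) 1)"
proof -
  have "x \<noteq> 0 \<and> v x = 0 \<longleftrightarrow> vge v x 0 \<and> \<not> vge v x 1" for x
    by (auto simp: vge_def)
  then show ?thesis
    by (auto simp: units_def int_points_def)
qed

lemma cyl_units: "cyl 1 units"
proof (rule cylI)
  show "units \<subseteq> int_points v" by (auto simp: units_iff)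
  fix z w assume z: "z \<in> units" and zw: "vcong 1 z w"
  have "vge v (z $ i) 1 \<longleftrightarrow> vge v (w $ i) 1" for i
    using zw by (intro vge_cong_iff) (auto simp: vcong_def)
  then show "w \<in> units"
    using z vcong_int_points[OF zw] by (auto simp: units_iff)
qed

definition cell :: "('N \<Rightarrow> nat) \<Rightarrow> ('k ^ 'N) set" where
  "cell \<kappa> = {z. \<forall>i. z $ i \<noteq> 0 \<and> v (z $ i) = int (\<kappa> i)}"

lemma cell_eq_scaled: "cell \<kappa> = scaled \<kappa> units"
proof -
  have "x \<noteq> 0 \<and> v x = int n \<longleftrightarrow> x / unif ^ n \<noteq> 0 \<and> v (x / unif ^ n) = 0" for x n
    using unif by (auto simp: divide_inverse v_mult v_inverse v_unif_power)
  then show ?thesis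
    by (auto simp: cell_def scaled_def units_def)
qed

lemma cell_disjoint: "\<kappa> \<noteq> \<kappa>' \<Longrightarrow> cell \<kappa> \<inter> cell \<kappa>' = {}"
  by (auto simp: cell_def fun_eq_iff)

lemma cell_int_points: "cell \<kappa> \<subseteq> int_points v"
  by (auto simp: cell_def int_points_def vge_def)

lemma cell_sets: "cell \<kappa> \<in> sets M"
  unfolding cell_eq_scaled by (rule cyl_sets[OF cyl_scaled[OF cyl_units]])

text \<open>The hyperplane lies in each set where coordinate \<open>i\<close> is divisible by
  \<open>unif ^ n\<close>, and that set has measure \<open>1 / q ^ n\<close>.\<close>

lemma null_coordinate: "{z\<in>int_points v. z $ i = 0} \<in> null_sets M"
proof -
  define S where "S = (\<lambda>n. scaled (\<lambda>j. if j = i then n else 0) (int_points v))"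
  have S: "S n = {z\<in>int_points v. vge v (z $ i) (int n)}" for n
  proof -
    have "z \<in> S n \<longleftrightarrow> (\<forall>j. vge v (z $ j) (if j = i then int n else 0))" for z
      by (simp add: S_def scaled_def int_points_def vge_unif_power_divide if_distrib[of "\<lambda>n. _ + int n"]
          if_distrib[of int] cong: if_cong)
    moreover have "(\<forall>j. vge v (z $ j) (if j = i then int n else 0)) \<longleftrightarrow>
        z \<in> int_points v \<and> vge v (z $ i) (int n)" for z :: "'k ^ 'N"
      unfolding int_points_def using vge_mono[of "z $ i" "int n" 0] by (auto split: if_splits)
    ultimately show ?thesis by blast
  qed
  have cylS: "cyl (0 + sum (\<lambda>j. if j = i then n else 0) UNIV) (S n)" for n
    unfolding S_def by (rule cyl_scaled[OF cyl_int_points])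
  have eq: "{z\<in>int_points v. z $ i = 0} = (\<Inter>n. S n)"
    unfolding S using vge_all_imp_zero by auto
  have meas: "{z\<in>int_points v. z $ i = 0} \<in> sets M"
    unfolding eq by (intro sets.countable_INT) (use cyl_sets[OF cylS] in auto)
  have le: "emeasure M {z\<in>int_points v. z $ i = 0} \<le> ennreal (1 / real q ^ n)" for n
  proof -
    have "emeasure M {z\<in>int_points v. z $ i = 0} \<le> emeasure M (S n)"
      unfolding eq by (intro emeasure_mono cyl_sets[OF cylS]) auto
    also have "\<dots> = ennreal (measure M (S n))"
      using cyl_finite_emeasure[OF cylS] by (simp add: emeasure_eq_ennreal_measure)
    also have "measure M (S n) = 1 / real q ^ n"
      unfolding S_def by (subst measure_scaled_int_points) simp
    finally show ?thesis .
  qed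
  have "(\<lambda>n. ennreal (1 / real q ^ n)) \<longlonglongrightarrow> ennreal 0"
  proof (rule tendsto_ennrealI)
    have "(\<lambda>n. (1 / real q) ^ n) \<longlonglongrightarrow> 0"
      by (rule LIMSEQ_power_zero) (use q_pos in simp)
    then show "(\<lambda>n. 1 / real q ^ n) \<longlonglongrightarrow> 0"
      by (simp add: power_one_over)
  qed
  then have "emeasure M {z\<in>int_points v. z $ i = 0} \<le> ennreal 0"
    by (rule LIMSEQ_le_const) (use le in auto)
  then show ?thesis
    using meas by (auto intro: null_setsI)
qed

lemma int_points_minus_cells: "int_points v - (\<Union>\<kappa>. cell \<kappa>) = (\<Union>i. {z\<in>int_points v. z $ i = 0})"
proof -
  have "z \<in> cell (\<lambda>i. nat (v (z $ i)))" if "z \<in> int_points v" "\<forall>i. z $ i \<noteq> 0" for z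
    using that by (auto simp: cell_def int_points_def vge_def)
  then have "(\<exists>\<kappa>. z \<in> cell \<kappa>) \<longleftrightarrow> (\<forall>i. z $ i \<noteq> 0)" if "z \<in> int_points v" for z
    using that by (metis (mono_tags, lifting) cell_def mem_Collect_eq)
  then show ?thesis by auto
qed

text \<open>Points with a zero coordinate form a null set, so the countably many cells exhaust
  \<open>B\<close> up to measure zero.\<close>

lemma has_sum_cells:
  assumes "cyl e B"
  shows "((\<lambda>\<kappa>. measure M (B \<inter> cell \<kappa>)) has_sum measure M B) UNIV"
proof -
  have B: "B \<in> sets M" "B \<subseteq> int_points v"
    using assms cyl_sets by (auto simp: cyl_def)
  \<comment> \<open>The valuation vectors are enumerated by \<open>to_nat\<close>, with the empty
    set at numbers that are not codes, to apply countable additivity along a sequence.\<close>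
  define A where "A = (\<lambda>n :: nat. if n \<in> range (to_nat :: ('N \<Rightarrow> nat) \<Rightarrow> nat) then B \<inter> cell (from_nat n) else {})"
  have UN: "(\<Union>n. A n) = B \<inter> (\<Union>\<kappa>. cell \<kappa>)"
  proof -
    have "z \<in> A (to_nat \<kappa>)" if "z \<in> B \<inter> cell \<kappa>" for z \<kappa>
      using that by (simp add: A_def)
    then show ?thesis
      by (auto simp: A_def split: if_splits)
  qed
  have UNs: "(\<Union>n. A n) \<in> sets M"
    unfolding A_def by (intro sets.countable_UN) (use B cell_sets in auto)
  have "(\<lambda>n. measure M (A n)) sums measure M (\<Union>n. A n)"
  proof (rule measure_UNION)
    show "range A \<subseteq> sets M"
      using B cell_sets by (auto simp: A_def)
    show "disjoint_family A"
      unfolding disjoint_family_on_def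
    proof (intro ballI impI)
      fix m n :: nat assume "m \<noteq> n"
      show "A m \<inter> A n = {}"
      proof (cases "m \<in> range (to_nat :: ('N \<Rightarrow> nat) \<Rightarrow> nat) \<and> n \<in> range (to_nat :: ('N \<Rightarrow> nat) \<Rightarrow> nat)")
        case True
        then have "from_nat m \<noteq> (from_nat n :: 'N \<Rightarrow> nat)"
          using \<open>m \<noteq> n\<close> by auto
        then show ?thesis
          using cell_disjoint by (auto simp: A_def)
      qed (auto simp: A_def)
    qed
    have "emeasure M (\<Union>n. A n) \<le> emeasure M B"
      by (rule emeasure_mono) (use UN B in auto)
    then show "emeasure M (\<Union>n. A n) \<noteq> \<infinity>"
      using cyl_finite_emeasure[OF assms] by (auto simp: top_unique)
  qed
  moreover have "measure M (\<Union>n. A n) = measure M B"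
  proof (rule measure_eq_AE)
    have "(\<Union>i. {z\<in>int_points v. z $ i = 0}) \<in> null_sets M"
      by (intro null_sets_UN) (use null_coordinate in auto)
    then have "AE z in M. z \<notin> (\<Union>i. {z\<in>int_points v. z $ i = 0})"
      by (rule AE_not_in)
    then show "AE z in M. z \<in> (\<Union>n. A n) \<longleftrightarrow> z \<in> B"
      unfolding UN int_points_minus_cells[symmetric] by eventually_elim (use B in auto)
  qed (use UNs B in auto)
  ultimately have "((\<lambda>n. measure M (A n)) has_sum measure M B) UNIV"
    by (intro sums_nonneg_imp_has_sum) auto
  also have "?this \<longleftrightarrow> ((\<lambda>n. measure M (A n)) has_sum measure M B) (range (to_nat :: ('N \<Rightarrow> nat) \<Rightarrow> nat))"
    by (rule has_sum_cong_neutral) (auto simp: A_def)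
  also have "\<dots> \<longleftrightarrow> ((\<lambda>n. measure M (A n)) \<circ> to_nat has_sum measure M B) (UNIV :: ('N \<Rightarrow> nat) set)"
    by (rule has_sum_reindex) simp
  also have "(\<lambda>n. measure M (A n)) \<circ> to_nat = (\<lambda>\<kappa>. measure M (B \<inter> cell \<kappa>))"
    by (auto simp: A_def fun_eq_iff)
  finally show ?thesis .
qed

section \<open>Level sets and the zeta integral as a power series\<close>

definition level :: "('k ^ 'N \<Rightarrow> 'k) \<Rightarrow> nat \<Rightarrow> ('k ^ 'N) set" where
  "level h e = {z\<in>int_points v. h z \<noteq> 0 \<and> v (h z) = int e}"

definition cong_preserving :: "('k ^ 'N \<Rightarrow> 'k) \<Rightarrow> bool" where
  "cong_preserving h \<longleftrightarrow> (\<forall>z\<in>int_points v. vge v (h z) 0 \<and>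
     (\<forall>e w. vcong e z w \<longrightarrow> vge v (h z - h w) (int e)))"

lemma level_eq: "level h e = {z\<in>int_points v. vge v (h z) (int e) \<and> \<not> vge v (h z) (int (Suc e))}"
  by (auto simp: level_def vge_def)

lemma cyl_level:
  assumes "cong_preserving h"
  shows "cyl (Suc e) (level h e)"
proof (rule cylI)
  show "level h e \<subseteq> int_points v" by (auto simp: level_def)
  fix z w assume z: "z \<in> level h e" and zw: "vcong (Suc e) z w"
  have "vge v (h z - h w) (int (Suc e))"
    using assms z zw unfolding cong_preserving_def level_def by blast
  then have "vge v (h z) a \<longleftrightarrow> vge v (h w) a" if "a \<le> int (Suc e)" for a
    using that vge_mono vge_cong_iff by blast
  then show "w \<in> level h e"
    using z vcong_int_points[OF zw] by (auto simp: level_eq)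
qed

lemma level_disjoint: "disjoint_family (level h)"
  by (auto simp: disjoint_family_on_def level_def)

lemma summable_measure_level:
  assumes "cong_preserving h"
  shows "summable (\<lambda>e. measure M (level h e))"
proof -
  have "(\<lambda>e. measure M (level h e)) sums measure M (\<Union>e. level h e)"
  proof (rule measure_UNION[OF _ level_disjoint])
    show "range (level h) \<subseteq> sets M"
      using cyl_sets[OF cyl_level[OF assms]] by auto
    have "emeasure M (\<Union>e. level h e) \<le> emeasure M (int_points v)"
      by (rule emeasure_mono) (use cyl_sets[OF cyl_int_points] in \<open>auto simp: level_def\<close>)
    then show "emeasure M (\<Union>e. level h e) \<noteq> \<infinity>"
      using emeasure_int_points by (auto simp: top_unique)
  qed
  then show ?thesis by (rule sums_summable)
qed

abbreviation T_of :: "complex \<Rightarrow> complex" where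
  "T_of s \<equiv> of_nat q powr (- s)"

lemma norm_T_of: "0 < Re s \<Longrightarrow> norm (T_of s) < 1"
  using q_pos by (subst norm_powr_real) auto

lemma absv_powr:
  assumes "x \<noteq> 0" "v x = int e"
  shows "complex_of_real (absv v q x) powr s = T_of s ^ e"
proof -
  have q: "of_nat q \<noteq> (0 :: complex)"
    using q_pos by auto
  have L: "Ln (of_nat q) = complex_of_real (ln (real q))"
    using Ln_of_real[OF q_pos(1)] by simp
  have "absv v q x = inverse (real q ^ e)"
    using assms q_pos by (simp add: absv_def powr_minus powr_realpow)
  then have "complex_of_real (absv v q x) powr s = exp (s * complex_of_real (ln (inverse (real q ^ e))))"
    using q_pos by (simp add: powr_def Ln_of_real del: of_real_inverse of_real_power)
  also have "ln (inverse (real q ^ e)) = - (real e * ln (real q))"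
    using q_pos by (simp add: ln_inverse ln_realpow)
  also have "exp (s * complex_of_real (- (real e * ln (real q)))) = exp (of_nat e * (- s * Ln (of_nat q)))"
    by (simp add: L mult_ac)
  also have "\<dots> = exp (- s * Ln (of_nat q)) ^ e"
    by (rule exp_of_nat_mult)
  also have "\<dots> = T_of s ^ e"
    using q by (simp add: powr_def)
  finally show ?thesis .
qed

text \<open>The integrand is constant on each level set, with value a power of
  \<open>T_of s\<close>; domination by the level measures, whose sum is finite, allows integration
  term by term.\<close>

lemma zeta_sums:
  assumes h: "cong_preserving h" and s: "0 < Re s"
  shows "(\<lambda>e. T_of s ^ e * of_real (measure M (level h e))) sums igusa_zeta v q M h s"
proof -
  define f where "f = (\<lambda>e z. indicat_real (level h e) z *\<^sub>R (T_of s ^ e))"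
  have T: "norm (T_of s) < 1"
    by (rule norm_T_of[OF s])
  have Tn: "norm (T_of s) ^ e \<le> 1" for e
    using T by (intro power_le_one) auto
  have fm: "level h e \<in> fmeasurable M" for e
    by (rule cyl_fmeasurable[OF cyl_level[OF h]])
  have em: "emeasure M (level h e) < \<infinity>" "level h e \<in> sets M" for e
    using fm[of e] by (auto simp: fmeasurable_def)
  have int: "integrable M (f e)" for e
    unfolding f_def by (intro integrable_scaleR_left) (use em in \<open>auto simp: less_top\<close>)
  have val: "integral\<^sup>L M (f e) = T_of s ^ e * of_real (measure M (level h e))" for e
    unfolding f_def using em[of e] by (simp add: space_M scaleR_conv_of_real mult.commute)
  have single: "f e z = (if z \<in> int_points v \<and> h z \<noteq> 0 \<and> e = nat (v (h z)) then T_of s ^ e else 0)" for e z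
  proof (cases "z \<in> int_points v \<and> h z \<noteq> 0")
    case True
    then have "0 \<le> v (h z)"
      using h by (auto simp: cong_preserving_def vge_def)
    then show ?thesis
      using True by (auto simp: f_def level_def indicator_def)
  qed (auto simp: f_def level_def indicator_def)
  have summ: "summable (\<lambda>e. norm (f e z))" for z
    unfolding single by (rule summable_finite[of "{nat (v (h z))}"]) auto
  have "(\<lambda>e. integral\<^sup>L M (f e)) sums (\<integral>z. (\<Sum>e. f e z) \<partial>M)"
  proof (rule sums_integral[OF int])
    show "AE z in M. summable (\<lambda>e. norm (f e z))"
      using summ by simp
    have "norm (\<integral>z. norm (f e z) \<partial>M) \<le> measure M (level h e)" for e
    proof -
      have "(\<integral>z. norm (f e z) \<partial>M) = norm (T_of s) ^ e * measure M (level h e)"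
        using em[of e] by (simp add: f_def space_M norm_power mult.commute)
      then show ?thesis
        using Tn[of e] by (simp add: mult_left_le_one_le)
    qed
    then show "summable (\<lambda>e. \<integral>z. norm (f e z) \<partial>M)"
      by (rule summable_comparison_test'[OF summable_measure_level[OF h], of 0])
  qed
  moreover have "(\<Sum>e. f e z) = indicat_real (int_points v) z *\<^sub>R complex_of_real (absv v q (h z)) powr s" for z
  proof (cases "z \<in> int_points v \<and> h z \<noteq> 0")
    case True
    then have "0 \<le> v (h z)"
      using h by (auto simp: cong_preserving_def vge_def)
    then have "complex_of_real (absv v q (h z)) powr s = T_of s ^ nat (v (h z))"
      using True by (intro absv_powr) auto
    moreover have "(\<Sum>e. f e z) = (\<Sum>e\<in>{nat (v (h z))}. f e z)"
      by (rule suminf_finite) (auto simp: single)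
    ultimately show ?thesis
      using True by (simp add: single)
  next
    \<comment> \<open>Where \<open>h\<close> vanishes the integrand is \<open>0 powr s = 0\<close>,
      matching the absence of a level there; outside the integral points both sides vanish through
      the indicators.\<close>
    case False
    then have "f e z = 0" for e
      by (auto simp: single)
    then show ?thesis
      using False by (auto simp: absv_def)
  qed
  ultimately show ?thesis
    unfolding igusa_zeta_def set_lebesgue_integral_def by (simp add: val)
qed

text \<open>The numerator of \<open>\<Sum> T\<^sup>e (w e - w (e + 1))\<close> over \<open>1 - T / q\<close> when \<open>w (e + 1) = w e / q\<close> for \<open>e \<ge> N\<close>.\<close>
definition cell_num :: "nat \<Rightarrow> (nat \<Rightarrow> real) \<Rightarrow> complex \<Rightarrow> complex" where
  "cell_num N w T = (1 - T / of_nat q) * (\<Sum>e<N. T ^ e * of_real (w e - w (Suc e))) +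
     T ^ N * of_real (w N) * (1 - 1 / of_nat q)"

text \<open>From \<open>N\<close> on the differences \<open>w e - w (Suc e)\<close> are geometric
  with ratio \<open>1 / q\<close>; the first \<open>N\<close> terms are kept and put over the common
  denominator.\<close>

lemma geometric_tail_sums:
  assumes w: "\<And>e. N \<le> e \<Longrightarrow> w (Suc e) = w e / real q" and T: "norm T < 1"
  shows "(\<lambda>e. T ^ e * of_real (w e - w (Suc e))) sums (cell_num N w T / (1 - T / of_nat q))"
proof -
  have wN: "w (e + N) = w N / real q ^ e" for e
    by (induction e) (simp_all add: w field_simps)
  have nT: "norm (T / of_nat q) < 1"
    using T q_pos by (simp add: norm_divide divide_simps)
  then have nz: "1 - T / of_nat q \<noteq> 0" by auto
  have "(\<lambda>e. (T / of_nat q) ^ e * (T ^ N * of_real (w N) * (1 - 1 / of_nat q))) sums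
      (1 / (1 - T / of_nat q) * (T ^ N * of_real (w N) * (1 - 1 / of_nat q)))"
    by (intro sums_mult2 geometric_sums nT)
  moreover have "(T / of_nat q) ^ e * (T ^ N * of_real (w N) * (1 - 1 / of_nat q)) =
      T ^ (e + N) * of_real (w (e + N) - w (Suc (e + N)))" for e
  proof -
    have "w (e + N) - w (Suc (e + N)) = w N / real q ^ e * (1 - 1 / real q)"
      using wN[of e] wN[of "Suc e"] q_pos by (simp add: field_simps)
    then show ?thesis
      by (simp add: power_divide power_add mult_ac)
  qed
  ultimately have "(\<lambda>e. T ^ (e + N) * of_real (w (e + N) - w (Suc (e + N)))) sums
      (1 / (1 - T / of_nat q) * (T ^ N * of_real (w N) * (1 - 1 / of_nat q)))"
    by simp
  then have "(\<lambda>e. T ^ e * of_real (w e - w (Suc e))) sums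
      (1 / (1 - T / of_nat q) * (T ^ N * of_real (w N) * (1 - 1 / of_nat q)) +
       (\<Sum>e<N. T ^ e * of_real (w e - w (Suc e))))"
    by (subst (asm) sums_iff_shift) (simp add: algebra_simps)
  also have "1 / (1 - T / of_nat q) * (T ^ N * of_real (w N) * (1 - 1 / of_nat q)) +
       (\<Sum>e<N. T ^ e * of_real (w e - w (Suc e))) = cell_num N w T / (1 - T / of_nat q)"
    unfolding cell_num_def add_divide_distrib using nz by simp
  finally show ?thesis .
qed

lemma cyl_units_vge:
  assumes "smooth H D"
  shows "cyl (Suc e) {u\<in>units. vge v (H u) (int e)}"
proof (rule cylI)
  show "{u\<in>units. vge v (H u) (int e)} \<subseteq> int_points v"
    by (auto simp: units_iff)
  fix z u assume z: "z \<in> {u\<in>units. vge v (H u) (int e)}" and zu: "vcong (Suc e) z u"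
  have "vge v (H z - H u) (int e)"
    using assms z vcong_mono[OF zu, of e] by (auto simp: smooth_def units_iff)
  then show "u \<in> {u\<in>units. vge v (H u) (int e)}"
    using z vge_cong_iff cylD[OF cyl_units, of z u] vcong_mono[OF zu, of 1] by auto
qed

text \<open>A double series is summed in two ways: by levels it gives the zeta integral, by cells
  the stated sum. On a cell the level measures are rescaled differences of
  \<open>w \<kappa>\<close>, shifted by \<open>\<mu> \<kappa>\<close>, and \<open>density\<close>
  makes them geometric from an index that is the same for all cells. Absolute summability, from the
  finite total measure and \<open>norm T < 1\<close>, justifies the exchange.\<close>

lemma zeta_has_sum_cells:
  assumes h: "cong_preserving h" and s: "0 < Re s"
    and fac: "\<And>\<kappa> z. z \<in> cell \<kappa> \<Longrightarrow> h z = unif ^ \<mu> \<kappa> * H \<kappa> (\<chi> i. z $ i / unif ^ \<kappa> i)"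
    and sm: "\<And>\<kappa>. smooth (H \<kappa>) (D \<kappa>)"
    and nd: "\<And>\<kappa> z. z \<in> units \<Longrightarrow> \<exists>i. \<not> vge v (D \<kappa> i z) (int c + 1)"
  shows "((\<lambda>\<kappa>. T_of s ^ \<mu> \<kappa> / of_nat q ^ sum \<kappa> UNIV *
      (cell_num (2 * c + 1) (\<lambda>e. measure M {u\<in>units. vge v (H \<kappa> u) (int e)}) (T_of s) / (1 - T_of s / of_nat q)))
      has_sum igusa_zeta v q M h s) UNIV"
proof -
  define T where "T = T_of s"
  define w where "w = (\<lambda>\<kappa> e. measure M {u\<in>units. vge v (H \<kappa> u) (int e)})"
  define m where "m = (\<lambda>\<kappa> e. measure M (level h e \<inter> cell \<kappa>))"
  have T: "norm T < 1"
    unfolding T_def by (rule norm_T_of[OF s])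
  have cylH: "cyl (Suc e) {u\<in>units. vge v (H \<kappa> u) (int e)}" for \<kappa> e
    by (rule cyl_units_vge[OF sm])
  have wS: "w \<kappa> (Suc e) = w \<kappa> e / real q" if "2 * c + 1 \<le> e" for \<kappa> e
    unfolding w_def by (rule density[OF sm cyl_units nd that])
  have g: "measure M {z\<in>cell \<kappa>. vge v (h z) (int (\<mu> \<kappa> + e))} = w \<kappa> e / real q ^ sum \<kappa> UNIV"
    and gc: "cyl (Suc e + sum \<kappa> UNIV) {z\<in>cell \<kappa>. vge v (h z) (int (\<mu> \<kappa> + e))}" for \<kappa> e
  proof -
    have eq: "{z\<in>cell \<kappa>. vge v (h z) (int (\<mu> \<kappa> + e))} = scaled \<kappa> {u\<in>units. vge v (H \<kappa> u) (int e)}"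
      using fac by (auto simp: vge_unif_power_mult cell_eq_scaled scaled_def)
    show "measure M {z\<in>cell \<kappa>. vge v (h z) (int (\<mu> \<kappa> + e))} = w \<kappa> e / real q ^ sum \<kappa> UNIV"
      unfolding eq w_def by (rule measure_scaled[OF cylH])
    show "cyl (Suc e + sum \<kappa> UNIV) {z\<in>cell \<kappa>. vge v (h z) (int (\<mu> \<kappa> + e))}"
      unfolding eq by (rule cyl_scaled[OF cylH])
  qed
  have m1: "m \<kappa> (\<mu> \<kappa> + e) = (w \<kappa> e - w \<kappa> (Suc e)) / real q ^ sum \<kappa> UNIV" for \<kappa> e
  proof -
    have "level h (\<mu> \<kappa> + e) \<inter> cell \<kappa> = {z\<in>cell \<kappa>. vge v (h z) (int (\<mu> \<kappa> + e))} -
        {z\<in>cell \<kappa>. vge v (h z) (int (\<mu> \<kappa> + Suc e))}"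
      using cell_int_points by (auto simp: level_eq)
    moreover have "{z\<in>cell \<kappa>. vge v (h z) (int (\<mu> \<kappa> + Suc e))} \<subseteq> {z\<in>cell \<kappa>. vge v (h z) (int (\<mu> \<kappa> + e))}"
      using vge_mono[of "h _" "int (\<mu> \<kappa> + Suc e)" "int (\<mu> \<kappa> + e)"] by auto
    ultimately have "m \<kappa> (\<mu> \<kappa> + e) = measure M {z\<in>cell \<kappa>. vge v (h z) (int (\<mu> \<kappa> + e))} -
        measure M {z\<in>cell \<kappa>. vge v (h z) (int (\<mu> \<kappa> + Suc e))}"
      unfolding m_def
      by (simp only: measure_Diff[OF cyl_finite_emeasure[OF gc] cyl_sets[OF gc] cyl_sets[OF gc]])
    then show ?thesis
      by (simp only: g diff_divide_distrib)
  qed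
  \<comment> \<open>As \<open>H \<kappa>\<close> is integral on the units, \<open>h\<close> is
    divisible by \<open>unif ^ \<mu> \<kappa>\<close> on the cell; the lower levels are empty there
    and the index shift loses nothing.\<close>
  have m0: "m \<kappa> e = 0" if "e < \<mu> \<kappa>" for \<kappa> e
  proof -
    have "level h e \<inter> cell \<kappa> = {}"
    proof -
      have False if z: "z \<in> level h e" "z \<in> cell \<kappa>" for z
      proof -
        have "(\<chi> i. z $ i / unif ^ \<kappa> i) \<in> units"
          using z by (simp add: cell_eq_scaled scaled_def)
        then have "vge v (H \<kappa> (\<chi> i. z $ i / unif ^ \<kappa> i)) 0"
          using sm[of \<kappa>] by (auto simp: smooth_def units_iff)
        then have "vge v (h z) (int (\<mu> \<kappa>))"
          using fac[OF z(2)] by (simp add: vge_unif_power_mult)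
        then show False
          using z(1) \<open>e < \<mu> \<kappa>\<close> by (auto simp: level_def vge_def)
      qed
      then show ?thesis by blast
    qed
    then show ?thesis by (simp add: m_def)
  qed
  have m_nonneg: "0 \<le> m \<kappa> e" for \<kappa> e
    by (simp add: m_def)
  have m_sum: "(m_row has_sum measure M (level h e)) UNIV" if "m_row = (\<lambda>\<kappa>. m \<kappa> e)" for e m_row
    unfolding that m_def by (rule has_sum_cells[OF cyl_level[OF h]])
  have level_summable: "(\<lambda>e. measure M (level h e)) summable_on UNIV"
    using summable_measure_level[OF h] by (simp add: summable_on_UNIV_nonneg_real_iff)
  have msum2: "(\<lambda>(e, \<kappa>). m \<kappa> e) summable_on (UNIV \<times> UNIV)"
    by (rule summable_on_SigmaI[where g = "\<lambda>e. measure M (level h e)"])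
      (use m_sum level_summable m_nonneg in auto)
  have F: "(\<lambda>(e, \<kappa>). T ^ e * of_real (m \<kappa> e)) summable_on (UNIV \<times> UNIV)"
  proof (rule abs_summable_summable, rule Infinite_Sum.abs_summable_on_comparison_test)
    show "(\<lambda>p. norm (case p of (e, \<kappa>) \<Rightarrow> m \<kappa> e)) summable_on (UNIV \<times> UNIV)"
      using msum2 by (simp add: case_prod_unfold m_nonneg abs_of_nonneg)
    fix p :: "nat \<times> ('N \<Rightarrow> nat)"
    obtain e \<kappa> where [simp]: "p = (e, \<kappa>)" by force
    have "norm T ^ e \<le> 1"
      using T by (intro power_le_one) auto
    then show "norm (case p of (e, \<kappa>) \<Rightarrow> T ^ e * of_real (m \<kappa> e)) \<le> norm (case p of (e, \<kappa>) \<Rightarrow> m \<kappa> e)"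
      using m_nonneg by (simp add: norm_mult norm_power mult_left_le_one_le)
  qed
  have Z: "((\<lambda>e. T ^ e * of_real (measure M (level h e))) has_sum igusa_zeta v q M h s) UNIV"
  proof (rule norm_summable_imp_has_sum)
    show "(\<lambda>e. T ^ e * of_real (measure M (level h e))) sums igusa_zeta v q M h s"
      unfolding T_def by (rule zeta_sums[OF h s])
    have "norm T ^ e \<le> 1" for e
      using T by (intro power_le_one) auto
    then show "summable (\<lambda>e. norm (T ^ e * of_real (measure M (level h e))))"
      by (intro summable_comparison_test'[OF summable_measure_level[OF h], of 0])
        (simp add: norm_mult norm_power mult_left_le_one_le)
  qed
  have "((\<lambda>(e, \<kappa>). T ^ e * of_real (m \<kappa> e)) has_sum igusa_zeta v q M h s) (UNIV \<times> UNIV)"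
    by (rule has_sum_SigmaI[OF _ Z F]) (auto intro!: has_sum_cmult_right has_sum_of_real m_sum)
  then have swapped: "((\<lambda>(\<kappa>, e). T ^ e * of_real (m \<kappa> e)) has_sum igusa_zeta v q M h s) (UNIV \<times> UNIV)"
    by (subst has_sum_swap) simp
  have "((\<lambda>\<kappa>. T ^ \<mu> \<kappa> / of_nat q ^ sum \<kappa> UNIV * (cell_num (2 * c + 1) (w \<kappa>) T / (1 - T / of_nat q)))
      has_sum igusa_zeta v q M h s) UNIV"
  proof (rule has_sum_SigmaD[OF swapped])
    fix \<kappa> :: "'N \<Rightarrow> nat"
    have "(\<lambda>e. T ^ \<mu> \<kappa> / of_nat q ^ sum \<kappa> UNIV * (T ^ e * of_real (w \<kappa> e - w \<kappa> (Suc e)))) sums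
        (T ^ \<mu> \<kappa> / of_nat q ^ sum \<kappa> UNIV * (cell_num (2 * c + 1) (w \<kappa>) T / (1 - T / of_nat q)))"
      by (intro sums_mult geometric_tail_sums wS T)
    moreover have "T ^ \<mu> \<kappa> / of_nat q ^ sum \<kappa> UNIV * (T ^ e * of_real (w \<kappa> e - w \<kappa> (Suc e))) =
        T ^ (e + \<mu> \<kappa>) * of_real (m \<kappa> (e + \<mu> \<kappa>))" for e
      using m1[of \<kappa> e] by (simp add: power_add add.commute[of e] mult.commute mult.left_commute)
    ultimately have "(\<lambda>e. T ^ (e + \<mu> \<kappa>) * of_real (m \<kappa> (e + \<mu> \<kappa>))) sums
        (T ^ \<mu> \<kappa> / of_nat q ^ sum \<kappa> UNIV * (cell_num (2 * c + 1) (w \<kappa>) T / (1 - T / of_nat q)))"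
      by simp
    then have sums: "(\<lambda>e. T ^ e * of_real (m \<kappa> e)) sums
        (T ^ \<mu> \<kappa> / of_nat q ^ sum \<kappa> UNIV * (cell_num (2 * c + 1) (w \<kappa>) T / (1 - T / of_nat q)))"
      by (subst (asm) sums_iff_shift) (simp add: m0)
    have "(\<lambda>e. norm (T ^ e * complex_of_real (m \<kappa> e))) summable_on UNIV"
    proof -
      have "(\<lambda>p. norm (case p of (\<kappa>, e) \<Rightarrow> T ^ e * complex_of_real (m \<kappa> e))) summable_on (UNIV \<times> UNIV)"
        using swapped summable_on_iff_abs_summable_on_complex by (auto simp: summable_on_def)
      then have "(\<lambda>(\<kappa>, e). norm (T ^ e * complex_of_real (m \<kappa> e))) summable_on (UNIV \<times> UNIV)"
        by (simp add: case_prod_unfold)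
      then show ?thesis
        by (rule summable_on_SigmaD1) simp
    qed
    then have "summable (\<lambda>e. norm (T ^ e * complex_of_real (m \<kappa> e)))"
      by (rule summable_on_imp_summable)
    from norm_summable_imp_has_sum[OF this sums]
    show "((\<lambda>e. case (\<kappa>, e) of (\<kappa>, e) \<Rightarrow> T ^ e * of_real (m \<kappa> e)) has_sum
        (T ^ \<mu> \<kappa> / of_nat q ^ sum \<kappa> UNIV * (cell_num (2 * c + 1) (w \<kappa>) T / (1 - T / of_nat q)))) UNIV"
      by simp
  qed
  then show ?thesis
    by (simp add: T_def w_def)
qed

end

section \<open>Newton polyhedra and uniform noncriticality\<close>

definition dot :: "nat ^ 'n \<Rightarrow> nat ^ 'n \<Rightarrow> nat" where
  "dot a \<omega> = (\<Sum>i\<in>UNIV. a $ i * \<omega> $ i)"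

text \<open>The number \<open>m_f(a)\<close> as a natural number, computed on the support instead of
  the polyhedron; \<open>m_newton_eq\<close> identifies the two.\<close>

definition mn :: "(nat ^ 'n) set \<Rightarrow> nat ^ 'n \<Rightarrow> nat" where
  "mn S a = Min (dot a ` S)"

text \<open>The exponent of the uniformizer left at the monomial \<open>\<omega>\<close> after
  scaling by the weight \<open>a\<close> and extracting the common power; on \<open>S\<close> it
  vanishes exactly on the face selected by \<open>a\<close>.\<close>

definition excess :: "(nat ^ 'n) set \<Rightarrow> nat ^ 'n \<Rightarrow> nat ^ 'n \<Rightarrow> nat" where
  "excess S a \<omega> = dot a \<omega> - mn S a"

lemma mn_le: "finite S \<Longrightarrow> \<omega> \<in> S \<Longrightarrow> mn S a \<le> dot a \<omega>"
  by (simp add: mn_def)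

lemma mn_attained: "finite S \<Longrightarrow> S \<noteq> {} \<Longrightarrow> \<exists>\<omega>\<in>S. dot a \<omega> = mn S a"
  unfolding mn_def using Min_in[of "dot a ` S"] by fastforce

lemma mn_eqI: "finite S \<Longrightarrow> \<omega> \<in> S \<Longrightarrow> dot a \<omega> = m \<Longrightarrow> (\<And>\<omega>. \<omega> \<in> S \<Longrightarrow> m \<le> dot a \<omega>) \<Longrightarrow> mn S a = m"
  unfolding mn_def by (intro Min_eqI) auto

lemma dot_eq_excess: "finite S \<Longrightarrow> \<omega> \<in> S \<Longrightarrow> dot a \<omega> = mn S a + excess S a \<omega>"
  using mn_le[of S \<omega> a] by (simp add: excess_def)

lemma rvec_inner: "rvec a \<bullet> rvec \<omega> = real (dot a \<omega>)"
  by (simp add: rvec_def dot_def inner_vec_def)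

lemma convex_newton_poly: "convex (newton_poly A)"
  by (simp add: newton_poly_def)

lemma newton_poly_contains: "\<omega> \<in> supp A \<Longrightarrow> (\<And>i. 0 \<le> r $ i) \<Longrightarrow> rvec \<omega> + r \<in> newton_poly A"
  unfolding newton_poly_def by (rule hull_inc) auto

lemma rvec_in_newton_poly: "\<omega> \<in> supp A \<Longrightarrow> rvec \<omega> \<in> newton_poly A"
  using newton_poly_contains[of \<omega> A 0] by simp

lemma newton_poly_ge:
  fixes c :: "real ^ 'n" and A :: "nat ^ 'n \<Rightarrow> 'k::zero"
  assumes "\<And>i. 0 \<le> c $ i" "\<And>\<omega>. \<omega> \<in> supp A \<Longrightarrow> m \<le> c \<bullet> rvec \<omega>" "x \<in> newton_poly A"
  shows "m \<le> c \<bullet> x"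
proof -
  have "newton_poly A \<subseteq> {x. m \<le> c \<bullet> x}"
    unfolding newton_poly_def
  proof (rule hull_minimal)
    show "(\<Union>\<omega>\<in>supp A. {rvec \<omega> + r |r. \<forall>i. 0 \<le> r $ i}) \<subseteq> {x. m \<le> c \<bullet> x}"
    proof safe
      fix \<omega> and r :: "real ^ 'n" assume w: "\<omega> \<in> supp A" and r: "\<forall>i. 0 \<le> r $ i"
      have "0 \<le> c \<bullet> r"
        using assms(1) r by (auto simp: inner_vec_def intro!: sum_nonneg)
      then show "m \<le> c \<bullet> (rvec \<omega> + r)"
        using assms(2)[OF w] by (simp add: inner_add_right)
    qed
    show "convex {x. m \<le> c \<bullet> x}"
      using convex_halfspace_ge[of m c] by simp
  qed
  then show ?thesis
    using assms(3) by blast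
qed

lemma newton_poly_ge_mn:
  assumes "finite (supp A)" "x \<in> newton_poly A"
  shows "real (mn (supp A) a) \<le> rvec a \<bullet> x"
  by (rule newton_poly_ge[OF _ _ assms(2)]) (use mn_le[OF assms(1)] in \<open>auto simp: rvec_inner\<close>, simp add: rvec_def)

lemma m_newton_eq:
  assumes "finite (supp A)" "supp A \<noteq> {}"
  shows "m_newton A a = real (mn (supp A) a)"
proof -
  obtain \<omega> where w: "\<omega> \<in> supp A" "dot a \<omega> = mn (supp A) a"
    using mn_attained[OF assms] by blast
  show ?thesis
    unfolding m_newton_def
  proof (rule cInf_eq_minimum)
    show "real (mn (supp A) a) \<in> (\<lambda>x. rvec a \<bullet> x) ` newton_poly A"
      by (rule image_eqI[of _ _ "rvec \<omega>"]) (use w rvec_in_newton_poly in \<open>auto simp: rvec_inner\<close>)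
  qed (use newton_poly_ge_mn[OF assms(1)] in auto)
qed

text \<open>Noncriticality speaks of faces; this makes it available for any natural weight
  \<open>b\<close>, the weight 0 giving the whole polyhedron.\<close>

lemma newton_face_of_weight:
  assumes "finite (supp A)" "supp A \<noteq> {}"
  shows "newton_poly A \<inter> {x. rvec b \<bullet> x = real (mn (supp A) b)} \<in> newton_faces A"
proof -
  obtain \<omega> where w: "\<omega> \<in> supp A" "dot b \<omega> = mn (supp A) b"
    using mn_attained[OF assms] by blast
  then have "rvec \<omega> \<in> newton_poly A \<inter> {x. rvec b \<bullet> x = real (mn (supp A) b)}"
    using rvec_in_newton_poly by (auto simp: rvec_inner)
  moreover have "newton_poly A \<inter> {x. rvec b \<bullet> x = real (mn (supp A) b)} exposed_face_of newton_poly A"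
    by (rule exposed_face_of_Int_supporting_hyperplane_ge[OF convex_newton_poly newton_poly_ge_mn[OF assms(1)]])
  ultimately show ?thesis
    unfolding newton_faces_def by blast
qed

definition dmon :: "'n \<Rightarrow> 'k::comm_ring_1 ^ 'n \<Rightarrow> nat ^ 'n \<Rightarrow> 'k" where
  "dmon i x \<omega> = of_nat (\<omega> $ i) * (\<Prod>j\<in>UNIV. (x $ j) ^ (if j = i then \<omega> $ j - 1 else \<omega> $ j))"

definition psum :: "(nat ^ 'n) set \<Rightarrow> (nat ^ 'n \<Rightarrow> 'k::comm_ring_1) \<Rightarrow> 'k ^ 'n \<Rightarrow> 'k" where
  "psum S C x = (\<Sum>\<omega>\<in>S. C \<omega> * mon x \<omega>)"

definition pder :: "(nat ^ 'n) set \<Rightarrow> (nat ^ 'n \<Rightarrow> 'k::comm_ring_1) \<Rightarrow> 'n \<Rightarrow> 'k ^ 'n \<Rightarrow> 'k" where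
  "pder S C i x = (\<Sum>\<omega>\<in>S. C \<omega> * dmon i x \<omega>)"

lemma peval_eq_psum: "peval A = psum (supp A) A"
  by (simp add: peval_def psum_def fun_eq_iff)

lemma pdiff_eq_pder: "pdiff A = pder (supp A) A"
  by (simp add: pdiff_def pder_def dmon_def fun_eq_iff mult.assoc)

lemma mon_split: "mon x \<omega> = (x $ i) ^ (\<omega> $ i) * (\<Prod>j\<in>UNIV - {i}. (x $ j) ^ (\<omega> $ j))"
  by (simp add: mon_def prod.remove[of UNIV i])

lemma dmon_split:
  "dmon i x \<omega> = of_nat (\<omega> $ i) * (x $ i) ^ (\<omega> $ i - 1) * (\<Prod>j\<in>UNIV - {i}. (x $ j) ^ (\<omega> $ j))"
  by (simp add: dmon_def prod.remove[of UNIV i] mult.assoc)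

text \<open>Euler's identity for a single monomial. Multiplying by \<open>x $ i\<close> undoes the
  truncated exponent \<open>\<omega> $ i - 1\<close>, so the scaling of derivatives reduces to that
  of monomials.\<close>

lemma euler_dmon: "x $ i * dmon i x \<omega> = of_nat (\<omega> $ i) * mon x \<omega>"
proof -
  have "x $ i * (of_nat n * (x $ i) ^ (n - 1)) = of_nat n * (x $ i) ^ n" for n
    by (cases n) (auto simp: algebra_simps)
  then show ?thesis
    unfolding dmon_split mon_split[of x \<omega> i] by (simp add: mult.assoc[symmetric])
qed

lemma mon_scale: "mon (\<chi> i. p ^ (k $ i) * u $ i) \<omega> = p ^ dot k \<omega> * mon u \<omega>"
  by (simp add: mon_def dot_def power_mult_distrib prod.distrib power_sum flip: power_mult)

lemma dmon_scale:
  fixes u :: "'k::field ^ 'n"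
  assumes "u $ i \<noteq> 0"
  shows "p ^ (k $ i) * dmon i (\<chi> i. p ^ (k $ i) * u $ i) \<omega> = p ^ dot k \<omega> * dmon i u \<omega>"
proof -
  have "u $ i * (p ^ (k $ i) * dmon i (\<chi> i. p ^ (k $ i) * u $ i) \<omega>) =
      (\<chi> i. p ^ (k $ i) * u $ i) $ i * dmon i (\<chi> i. p ^ (k $ i) * u $ i) \<omega>"
    by simp
  also have "\<dots> = of_nat (\<omega> $ i) * (p ^ dot k \<omega> * mon u \<omega>)"
    by (simp only: euler_dmon mon_scale)
  also have "\<dots> = u $ i * (p ^ dot k \<omega> * dmon i u \<omega>)"
    using euler_dmon[of u i \<omega>] by (simp add: mult_ac)
  finally show ?thesis
    using assms by simp
qed

text \<open>A function of finite range is constant on an infinite set; one of infinite range exceeds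
  any of its values at some later argument, and iterating such jumps gives a strictly increasing
  subsequence.\<close>

lemma const_or_strict_mono_subseq:
  fixes f :: "nat \<Rightarrow> nat"
  shows "\<exists>r :: nat \<Rightarrow> nat. strict_mono r \<and> ((\<forall>i j. f (r i) = f (r j)) \<or> strict_mono (f \<circ> r))"
proof (cases "finite (range f)")
  case True
  then obtain j0 where "infinite {j. f j = f j0}"
    using pigeonhole_infinite[of UNIV f] by auto
  from infinite_enumerate[OF this] obtain r :: "nat \<Rightarrow> nat" where "strict_mono r" "\<And>j. f (r j) = f j0"
    by auto
  then show ?thesis by (intro exI[of _ r]) simp
next
  case False
  have step: "\<exists>j. m < j \<and> f m < f j" for m
  proof (rule ccontr)
    assume "\<nexists>j. m < j \<and> f m < f j"
    then have "f j \<in> f ` {..m} \<union> {..f m}" for j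
      by (cases "j \<le> m") (auto simp: not_less not_le)
    then have "range f \<subseteq> f ` {..m} \<union> {..f m}"
      by blast
    then show False
      using False finite_subset by blast
  qed
  obtain g where g: "\<And>m. m < g m \<and> f m < f (g m)"
    using step by metis
  define r where "r = rec_nat 0 (\<lambda>_. g)"
  have "strict_mono r" "strict_mono (f \<circ> r)"
    using g by (auto simp: strict_mono_Suc_iff r_def)
  then show ?thesis by blast
qed

lemma const_or_strict_mono_subseq_finite:
  fixes F :: "(nat \<Rightarrow> nat) set"
  assumes "finite F"
  shows "\<exists>r :: nat \<Rightarrow> nat. strict_mono r \<and> (\<forall>f\<in>F. (\<forall>i j. f (r i) = f (r j)) \<or> strict_mono (f \<circ> r))"
  using assms
proof (induction F rule: finite_induct)
  case empty
  show ?case by (auto intro: exI[of _ id] strict_mono_id)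
next
  case (insert f F)
  then obtain r :: "nat \<Rightarrow> nat" where r: "strict_mono r"
    "\<And>g. g \<in> F \<Longrightarrow> (\<forall>i j. g (r i) = g (r j)) \<or> strict_mono (g \<circ> r)" by blast
  obtain r' :: "nat \<Rightarrow> nat" where r': "strict_mono r'" "(\<forall>i j. (f \<circ> r) (r' i) = (f \<circ> r) (r' j)) \<or> strict_mono ((f \<circ> r) \<circ> r')"
    using const_or_strict_mono_subseq[of "f \<circ> r"] by blast
  have "(\<forall>i j. g ((r \<circ> r') i) = g ((r \<circ> r') j)) \<or> strict_mono (g \<circ> (r \<circ> r'))" if "g \<in> insert f F" for g
  proof (cases "g = f")
    case True
    then show ?thesis using r' by (simp add: o_assoc)
  next
    case False
    then show ?thesis
      using r(2)[of g] that strict_mono_o[OF _ r'(1), of "g \<circ> r"] by (auto simp: o_assoc)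
  qed
  then show ?case
    using strict_mono_o[OF r(1) r'(1)] by (intro exI[of _ "r \<circ> r'"]) blast
qed

context padic
begin

section \<open>Integrality, congruences and Taylor expansion of polynomials\<close>

lemma mon_integral: "x \<in> int_points v \<Longrightarrow> vge v (mon x \<omega>) 0"
  by (auto simp: mon_def int_points_def intro!: vge_prod vge_power)

lemma dmon_integral: "x \<in> int_points v \<Longrightarrow> vge v (dmon i x \<omega>) 0"
  by (auto simp: dmon_def int_points_def intro!: vge_prod vge_power vge_mult_left)

lemma mon_cong:
  assumes "x \<in> int_points v" "vcong e x y"
  shows "vge v (mon x \<omega> - mon y \<omega>) (int e)"
  using assms vcong_int_points[OF assms(2)] unfolding mon_def int_points_def vcong_def
  by (intro vge_prod_cong vge_power_cong vge_power) blast+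

lemma dmon_cong:
  assumes "x \<in> int_points v" "vcong e x y"
  shows "vge v (dmon i x \<omega> - dmon i y \<omega>) (int e)"
  unfolding dmon_def right_diff_distrib[symmetric]
proof (rule vge_mult_left)
  show "vge v ((\<Prod>j\<in>UNIV. x $ j ^ (if j = i then \<omega> $ j - 1 else \<omega> $ j)) -
      (\<Prod>j\<in>UNIV. y $ j ^ (if j = i then \<omega> $ j - 1 else \<omega> $ j))) (int e)"
    using assms vcong_int_points[OF assms(2)] unfolding int_points_def vcong_def
    by (intro vge_prod_cong vge_power_cong vge_power) blast+
qed simp

text \<open>Multiplying the expansion for \<open>n\<close> by \<open>x + t\<close> creates just one
  new error term, a multiple of \<open>t * t\<close>.\<close>

lemma power_taylor:
  assumes x: "vge v x 0" and t: "vge v t (int e)"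
  shows "vge v ((x + t) ^ n - x ^ n - t * (of_nat n * x ^ (n - 1))) (2 * int e)"
proof (induction n)
  case (Suc n)
  have "x * (of_nat n * x ^ (n - 1)) = of_nat n * x ^ n"
    by (cases n) auto
  then have "x * (t * (of_nat n * x ^ (n - 1))) = t * (of_nat n * x ^ n)"
    by (metis mult.left_commute)
  then have eq: "(x + t) ^ Suc n - x ^ Suc n - t * (of_nat (Suc n) * x ^ (Suc n - 1)) =
      (x + t) * ((x + t) ^ n - x ^ n - t * (of_nat n * x ^ (n - 1))) + (t * t) * (of_nat n * x ^ (n - 1))"
    by (simp add: algebra_simps)
  have t0: "vge v t 0"
    using t vge_mono by force
  have "vge v (t * t) (2 * int e)"
    using vge_mult[OF t t] by simp
  then show ?case
    unfolding eq using Suc x t0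
    by (intro vge_add[OF vge_mult_left[OF vge_add] vge_mult_right]) (auto intro: vge_power vge_mult_left)
qed simp

lemma mon_taylor:
  assumes x: "x \<in> int_points v" and t: "vge v t (int e)"
  shows "vge v (mon (x + axis i t) \<omega> - mon x \<omega> - t * dmon i x \<omega>) (2 * int e)"
proof -
  have rest: "(\<Prod>j\<in>UNIV - {i}. ((x + axis i t) $ j) ^ (\<omega> $ j)) = (\<Prod>j\<in>UNIV - {i}. (x $ j) ^ (\<omega> $ j))"
    by (rule prod.cong) (auto simp: axis_def)
  have "mon (x + axis i t) \<omega> - mon x \<omega> - t * dmon i x \<omega> =
      ((x $ i + t) ^ (\<omega> $ i) - x $ i ^ (\<omega> $ i) - t * (of_nat (\<omega> $ i) * x $ i ^ (\<omega> $ i - 1))) *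
      (\<Prod>j\<in>UNIV - {i}. (x $ j) ^ (\<omega> $ j))"
    unfolding mon_split[of _ \<omega> i] dmon_split[of i] rest by (simp add: axis_def algebra_simps)
  also have "vge v \<dots> (2 * int e)"
    using x t by (intro vge_mult_right power_taylor vge_prod vge_power) (auto simp: int_points_def)
  finally show ?thesis .
qed

lemma psum_integral:
  assumes "\<And>\<omega>. \<omega> \<in> S \<Longrightarrow> vge v (C \<omega>) 0" "x \<in> int_points v"
  shows "vge v (psum S C x) 0" "vge v (pder S C i x) 0"
  unfolding psum_def pder_def using assms
  by (auto intro!: vge_sum vge_mult_left mon_integral dmon_integral)

lemma psum_cong:
  assumes "\<And>\<omega>. \<omega> \<in> S \<Longrightarrow> vge v (C \<omega>) 0" "x \<in> int_points v" "vcong e x y"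
  shows "vge v (psum S C x - psum S C y) (int e)" "vge v (pder S C i x - pder S C i y) (int e)"
  unfolding psum_def pder_def using assms
  by (auto intro!: vge_sum vge_mult_left mon_cong dmon_cong
      simp: right_diff_distrib[symmetric] sum_subtractf[symmetric])

lemma psum_taylor:
  assumes "\<And>\<omega>. \<omega> \<in> S \<Longrightarrow> vge v (C \<omega>) 0" "x \<in> int_points v" "vge v t (int e)"
  shows "vge v (psum S C (x + axis i t) - psum S C x - t * pder S C i x) (2 * int e)"
proof -
  have "psum S C (x + axis i t) - psum S C x - t * pder S C i x =
      (\<Sum>\<omega>\<in>S. C \<omega> * (mon (x + axis i t) \<omega> - mon x \<omega> - t * dmon i x \<omega>))"
    by (simp add: psum_def pder_def sum_distrib_left sum_subtractf[symmetric] algebra_simps)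
  also have "vge v \<dots> (2 * int e)"
    using assms by (intro vge_sum vge_mult_left mon_taylor) auto
  finally show ?thesis .
qed

lemma psum_coeff_cong:
  assumes "\<And>\<omega>. \<omega> \<in> S \<Longrightarrow> vge v (C \<omega> - C' \<omega>) e" "x \<in> int_points v"
  shows "vge v (psum S C x - psum S C' x) e"
  unfolding psum_def sum_subtractf[symmetric] left_diff_distrib[symmetric] using assms
  by (intro vge_sum vge_mult_right mon_integral) auto

definition twist :: "(nat ^ 'n \<Rightarrow> 'k) \<Rightarrow> (nat ^ 'n \<Rightarrow> nat) \<Rightarrow> nat ^ 'n \<Rightarrow> 'k" where
  "twist A \<phi> \<omega> = A \<omega> * unif ^ \<phi> \<omega>"

lemma twist_integral: "(\<And>\<omega>. vge v (A \<omega>) 0) \<Longrightarrow> vge v (twist A \<phi> \<omega>) 0"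
  by (auto simp: twist_def vge_unif_power intro!: vge_mult_left)

lemma peval_scale:
  assumes "finite (supp A)"
  shows "peval A (\<chi> i. unif ^ (k $ i) * u $ i) =
    unif ^ mn (supp A) k * psum (supp A) (twist A (excess (supp A) k)) u"
  unfolding peval_eq_psum psum_def sum_distrib_left
proof (rule sum.cong)
  fix \<omega> assume "\<omega> \<in> supp A"
  then show "A \<omega> * mon (\<chi> i. unif ^ (k $ i) * u $ i) \<omega> =
      unif ^ mn (supp A) k * (twist A (excess (supp A) k) \<omega> * mon u \<omega>)"
    using dot_eq_excess[OF assms, of \<omega> k] by (simp add: mon_scale twist_def power_add)
qed simp

text \<open>A failing sequence of points would, after passing to a subsequence along which each exponent
  \<open>excess S k \<omega>\<close> is constant or tends to infinity, converge to a critical point of the face polynomial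
  supported on the monomials with constant exponent; the face is cut out by a difference of two of
  the weights \<open>k\<close>.\<close>
lemma uniform_noncritical:
  fixes A :: "nat ^ 'n \<Rightarrow> 'k"
  assumes fin: "finite (supp A)" and ne: "supp A \<noteq> {}" and int: "\<And>\<omega>. vge v (A \<omega>) 0"
    and nc: "newton_noncritical A"
  shows "\<exists>c. \<forall>k u. (\<forall>i. u $ i \<noteq> 0 \<and> v (u $ i) = 0) \<longrightarrow>
    (\<exists>i. \<not> vge v (pder (supp A) (twist A (excess (supp A) k)) i u) (int c + 1))"
proof (rule ccontr)
  define S where "S = supp A"
  assume "\<not> ?thesis"
  then have "\<forall>c. \<exists>k u. (\<forall>i. u $ i \<noteq> 0 \<and> v (u $ i) = 0) \<and>
      (\<forall>i. vge v (pder S (twist A (excess S k)) i u) (int c + 1))"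
    unfolding S_def by blast
  then obtain K U where U: "\<And>c i. U c $ i \<noteq> 0 \<and> v (U c $ i) = 0"
    and small: "\<And>c i. vge v (pder S (twist A (excess S (K c))) i (U c)) (int c + 1)"
    by metis
  have UO: "U c \<in> int_points v" for c
    using U by (auto simp: int_points_def vge_def)
  obtain r1 :: "nat \<Rightarrow> nat" and L where r1: "strict_mono r1" and L1: "\<And>e. \<exists>J. \<forall>j\<ge>J. vcong e (U (r1 j)) L"
    using convergent_subseq[of U, OF UO] by blast
  \<comment> \<open>The coordinates of the weights are included besides the excesses: along the
    subsequence they do not decrease, so the difference of two weights is again a natural
    vector.\<close>
  define F where "F = range (\<lambda>i j. K (r1 j) $ i) \<union> (\<lambda>\<omega> j. excess S (K (r1 j)) \<omega>) ` S"
  have "finite F"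
    using fin by (simp add: F_def S_def)
  then obtain r2 :: "nat \<Rightarrow> nat" where r2: "strict_mono r2"
    and F: "\<And>f. f \<in> F \<Longrightarrow> (\<forall>i j. f (r2 i) = f (r2 j)) \<or> strict_mono (f \<circ> r2)"
    using const_or_strict_mono_subseq_finite by meson
  define r where "r = r1 \<circ> r2"
  have r: "strict_mono r"
    unfolding r_def by (rule strict_mono_o[OF r1 r2])
  have L: "\<exists>J. \<forall>j\<ge>J. vcong e (U (r j)) L" for e
    using L1[of e] seq_suble[OF r2] unfolding r_def o_def by (meson order_trans)
  have Lu: "L $ i \<noteq> 0 \<and> v (L $ i) = 0" for i
  proof -
    obtain j where "vcong 1 (U (r j)) L"
      using L[of 1] by blast
    then have "vge v (U (r j) $ i - L $ i) 1"
      by (auto simp: vcong_def)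
    then have "vge v (U (r j) $ i) a \<longleftrightarrow> vge v (L $ i) a" if "a \<le> 1" for a
      using that vge_mono vge_cong_iff by blast
    from this[of 0] this[of 1] show ?thesis
      using U[of "r j" i] by (auto simp: vge_def)
  qed
  have LO: "L \<in> int_points v"
    using Lu by (auto simp: int_points_def vge_def)
  define E where "E = (\<lambda>j \<omega>. excess S (K (r j)) \<omega>)"
  define S1 where "S1 = {\<omega>\<in>S. \<forall>i j. E i \<omega> = E j \<omega>}"
  have strict: "strict_mono (\<lambda>j. E j \<omega>)" if "\<omega> \<in> S - S1" for \<omega>
    using F[of "\<lambda>j. excess S (K (r1 j)) \<omega>"] that by (auto simp: F_def S1_def E_def r_def o_def)
  have E_ge: "j \<le> E j \<omega>" if "\<omega> \<in> S - S1" for \<omega> j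
    using seq_suble[OF strict[OF that]] by simp
  have E01: "E 0 \<omega> \<le> E 1 \<omega>" "E 0 \<omega> = E 1 \<omega> \<longleftrightarrow> \<omega> \<in> S1" if "\<omega> \<in> S" for \<omega>
  proof -
    have "E 0 \<omega> < E 1 \<omega>" if "\<omega> \<notin> S1"
      using strict[of \<omega>] that \<open>\<omega> \<in> S\<close> by (simp add: strict_mono_def)
    moreover have "E 0 \<omega> = E 1 \<omega>" if "\<omega> \<in> S1"
      using that unfolding S1_def by blast
    ultimately show "E 0 \<omega> \<le> E 1 \<omega>" "E 0 \<omega> = E 1 \<omega> \<longleftrightarrow> \<omega> \<in> S1"
      by fastforce+
  qed
  define k0 where "k0 = K (r 0)"
  define k1 where "k1 = K (r 1)"
  have k01: "k0 $ i \<le> k1 $ i" for i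
  proof -
    have "(\<lambda>j. K (r1 j) $ i) \<in> F"
      by (simp add: F_def)
    from F[OF this] show ?thesis
    proof
      assume "\<forall>a b. K (r1 (r2 a)) $ i = K (r1 (r2 b)) $ i"
      then have "k0 $ i = k1 $ i"
        unfolding k0_def k1_def r_def o_def by blast
      then show ?thesis by simp
    next
      assume "strict_mono ((\<lambda>j. K (r1 j) $ i) \<circ> r2)"
      then show ?thesis
        unfolding k0_def k1_def r_def by (simp add: strict_mono_def less_imp_le)
    qed
  qed
  \<comment> \<open>On \<open>S\<close>, \<open>dot b\<close> equals the growth
    \<open>E 1 - E 0\<close> of the excess up to a constant. That growth is zero on
    \<open>S1\<close> and positive elsewhere, and \<open>S1\<close> is nonempty because a minimizer
    of \<open>k1\<close> has \<open>E 1 = 0\<close>. So \<open>b\<close> attains its minimum exactly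
    on \<open>S1\<close>.\<close>
  define b where "b = (\<chi> i. k1 $ i - k0 $ i)"
  have dot_b: "dot b \<omega> + dot k0 \<omega> = dot k1 \<omega>" for \<omega>
    unfolding dot_def sum.distrib[symmetric] b_def using k01
    by (intro sum.cong) (auto simp: add_mult_distrib[symmetric])
  have finS: "finite S" and neS: "S \<noteq> {}"
    using fin ne by (auto simp: S_def)
  have dot_b': "dot b \<omega> + (mn S k0 + E 0 \<omega>) = mn S k1 + E 1 \<omega>" if "\<omega> \<in> S" for \<omega>
    using dot_b[of \<omega>] dot_eq_excess[OF finS that, of k0] dot_eq_excess[OF finS that, of k1]
    by (simp add: E_def k0_def k1_def)
  obtain \<omega>1 where w1: "\<omega>1 \<in> S" "dot k1 \<omega>1 = mn S k1"
    using mn_attained[OF finS neS] by blast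
  have e1: "E 1 \<omega>1 = 0"
    using w1 by (simp add: E_def excess_def k1_def)
  have w1S: "\<omega>1 \<in> S1"
    using E_ge[of \<omega>1 1] w1 e1 by force
  have le: "mn S k0 \<le> mn S k1"
    using dot_b'[OF w1(1)] e1 E01[OF w1(1)] by simp
  have mnb: "mn S b = mn S k1 - mn S k0"
    by (rule mn_eqI[OF finS w1(1)]) (use dot_b' e1 E01 w1 in force)+
  have b_iff: "dot b \<omega> = mn S b \<longleftrightarrow> \<omega> \<in> S1" if "\<omega> \<in> S" for \<omega>
    using dot_b'[OF that] E01[OF that] mnb le by linarith
  define \<tau> where "\<tau> = newton_poly A \<inter> {x. rvec b \<bullet> x = real (mn (supp A) b)}"
  have \<tau>: "\<tau> \<in> newton_faces A"
    unfolding \<tau>_def by (rule newton_face_of_weight[OF fin ne])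
  have \<tau>_iff: "rvec \<omega> \<in> \<tau> \<longleftrightarrow> \<omega> \<in> S1" if "\<omega> \<in> S" for \<omega>
    using that b_iff[OF that] rvec_in_newton_poly[of \<omega> A] by (auto simp: \<tau>_def rvec_inner S_def)
  have S1S: "S1 \<subseteq> S" by (auto simp: S1_def)
  have fp: "supp (face_poly A \<tau>) = S1" "\<And>\<omega>. \<omega> \<in> S1 \<Longrightarrow> face_poly A \<tau> \<omega> = A \<omega>"
    using \<tau>_iff S1S by (auto simp: supp_def face_poly_def S_def split: if_splits)
  \<comment> \<open>The critical point is \<open>L\<close> scaled by \<open>k0\<close>: up to the
    factor \<open>unif ^ mn S k0\<close>, this scaling produces exactly the constant exponents
    \<open>E 0\<close> on \<open>S1\<close>.\<close>
  define x where "x = (\<chi> i. unif ^ (k0 $ i) * L $ i)"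
  define Q where "Q = (\<lambda>i. \<Sum>\<omega>\<in>S1. twist A (E 0) \<omega> * dmon i L \<omega>)"
  have pd: "unif ^ (k0 $ i) * pdiff (face_poly A \<tau>) i x = unif ^ mn S k0 * Q i" for i
  proof -
    have "unif ^ (k0 $ i) * pdiff (face_poly A \<tau>) i x = (\<Sum>\<omega>\<in>S1. A \<omega> * (unif ^ (k0 $ i) * dmon i x \<omega>))"
      unfolding pdiff_eq_pder pder_def fp(1) sum_distrib_left
      by (rule sum.cong) (auto simp: fp(2) mult_ac)
    also have "\<dots> = (\<Sum>\<omega>\<in>S1. unif ^ mn S k0 * (twist A (E 0) \<omega> * dmon i L \<omega>))"
    proof (rule sum.cong)
      fix \<omega> assume "\<omega> \<in> S1"
      then have "dot k0 \<omega> = mn S k0 + E 0 \<omega>"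
        using dot_eq_excess[OF finS, of \<omega> k0] S1S by (auto simp: E_def k0_def)
      moreover have "unif ^ (k0 $ i) * dmon i x \<omega> = unif ^ dot k0 \<omega> * dmon i L \<omega>"
        unfolding x_def by (rule dmon_scale) (use Lu in auto)
      ultimately show "A \<omega> * (unif ^ (k0 $ i) * dmon i x \<omega>) = unif ^ mn S k0 * (twist A (E 0) \<omega> * dmon i L \<omega>)"
        by (simp add: twist_def power_add mult_ac)
    qed simp
    finally show ?thesis
      by (simp add: Q_def sum_distrib_left)
  qed
  \<comment> \<open>\<open>Q i\<close> does not depend on \<open>j\<close>. For large
    \<open>j\<close> the full derivative at \<open>L\<close> is small by the choice of the sequence,
    and the terms off \<open>S1\<close> are small because their exponents are at least
    \<open>j\<close>.\<close>
  have "vge v (Q i) (int e)" for i e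
  proof -
    obtain J where J: "\<And>j. J \<le> j \<Longrightarrow> vcong e (U (r j)) L"
      using L[of e] by blast
    define j where "j = max J e"
    have tw: "vge v (twist A (E j) \<omega>) 0" for \<omega>
      by (rule twist_integral[OF int])
    have "e \<le> r j"
      using seq_suble[OF r, of j] by (simp add: j_def)
    then have "vge v (pder S (twist A (E j)) i (U (r j))) (int e)"
      using small[of "r j" i] unfolding E_def by (rule_tac vge_mono) auto
    then have "vge v (pder S (twist A (E j)) i L) (int e)"
      using vge_cong_iff[OF psum_cong(2)[of S "twist A (E j)", OF tw UO J]] by (simp add: j_def)
    moreover have "pder S (twist A (E j)) i L = Q i + (\<Sum>\<omega>\<in>S - S1. twist A (E j) \<omega> * dmon i L \<omega>)"
    proof -
      have "Q i = (\<Sum>\<omega>\<in>S1. twist A (E j) \<omega> * dmon i L \<omega>)"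
        unfolding Q_def twist_def by (rule sum.cong) (simp, metis (mono_tags, lifting) S1_def mem_Collect_eq)
      then show ?thesis
        unfolding pder_def using sum.subset_diff[OF S1S finS, of "\<lambda>\<omega>. twist A (E j) \<omega> * dmon i L \<omega>"]
        by (simp add: add.commute)
    qed
    moreover have "vge v (\<Sum>\<omega>\<in>S - S1. twist A (E j) \<omega> * dmon i L \<omega>) (int e)"
    proof (rule vge_sum)
      fix \<omega> assume "\<omega> \<in> S - S1"
      then have "e \<le> E j \<omega>"
        using E_ge[of \<omega> j] by (simp add: j_def)
      then show "vge v (twist A (E j) \<omega> * dmon i L \<omega>) (int e)"
        unfolding twist_def
        by (intro vge_mult_right vge_mult_left int dmon_integral LO) (simp add: vge_unif_power)
    qed
    ultimately show ?thesis
      using vge_diff[of "pder S (twist A (E j)) i L" "int e" "\<Sum>\<omega>\<in>S - S1. twist A (E j) \<omega> * dmon i L \<omega>"]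
      by simp
  qed
  then have "Q i = 0" for i
    by (rule vge_all_imp_zero)
  then have "pdiff (face_poly A \<tau>) i x = 0" for i
    using pd[of i] unif by simp
  moreover have "x $ i \<noteq> 0" for i
    using Lu unif by (simp add: x_def)
  ultimately show False
    using nc \<tau> unfolding newton_noncritical_def by blast
qed

end

section \<open>Pairings of linear recurrent sequences\<close>

text \<open>Agreement is demanded only on the open unit disc, where the infinite sums converge;
  \<open>T = q^(-s)\<close> lies there for \<open>Re s > 0\<close>.\<close>

definition rat_poly_fun :: "(complex \<Rightarrow> complex) \<Rightarrow> bool" where
  "rat_poly_fun f \<longleftrightarrow> (\<exists>p. (\<forall>i. coeff p i \<in> \<rat>) \<and> (\<forall>T. norm T < 1 \<longrightarrow> f T = poly p T))"

lemma Rats_of_real: "x \<in> \<rat> \<Longrightarrow> complex_of_real x \<in> \<rat>"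
  by (auto simp: Rats_eq_int_div_int intro!: Rats_divide)

lemma rat_poly_fun_cong: "(\<And>T. norm T < 1 \<Longrightarrow> f T = g T) \<Longrightarrow> rat_poly_fun f \<longleftrightarrow> rat_poly_fun g"
  by (auto simp: rat_poly_fun_def)

lemma rat_poly_fun_const: "c \<in> \<rat> \<Longrightarrow> rat_poly_fun (\<lambda>T. c)"
  unfolding rat_poly_fun_def by (intro exI[of _ "[:c:]"]) (auto simp: coeff_pCons split: nat.splits)

lemma rat_poly_fun_ident: "rat_poly_fun (\<lambda>T. T)"
  unfolding rat_poly_fun_def by (intro exI[of _ "[:0, 1:]"]) (auto simp: coeff_pCons split: nat.splits)

lemma rat_poly_fun_add: "rat_poly_fun f \<Longrightarrow> rat_poly_fun g \<Longrightarrow> rat_poly_fun (\<lambda>T. f T + g T)"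
  unfolding rat_poly_fun_def by (metis Rats_add coeff_add poly_add)

lemma rat_poly_fun_mult: "rat_poly_fun f \<Longrightarrow> rat_poly_fun g \<Longrightarrow> rat_poly_fun (\<lambda>T. f T * g T)"
proof -
  assume "rat_poly_fun f" "rat_poly_fun g"
  then obtain p r where p: "\<forall>i. coeff p i \<in> \<rat>" "\<forall>T. norm T < 1 \<longrightarrow> f T = poly p T"
    and r: "\<forall>i. coeff r i \<in> \<rat>" "\<forall>T. norm T < 1 \<longrightarrow> g T = poly r T"
    unfolding rat_poly_fun_def by blast
  have "coeff (p * r) i \<in> \<rat>" for i
    unfolding coeff_mult using p r by (intro Rats_sum Rats_mult) auto
  then show ?thesis
    unfolding rat_poly_fun_def using p r by (intro exI[of _ "p * r"]) auto
qed

lemma rat_poly_fun_cmult: "c \<in> \<rat> \<Longrightarrow> rat_poly_fun f \<Longrightarrow> rat_poly_fun (\<lambda>T. c * f T)"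
  by (intro rat_poly_fun_mult rat_poly_fun_const)

lemma rat_poly_fun_diff: "rat_poly_fun f \<Longrightarrow> rat_poly_fun g \<Longrightarrow> rat_poly_fun (\<lambda>T. f T - g T)"
  using rat_poly_fun_add[of f "\<lambda>T. (-1) * g T"] rat_poly_fun_cmult[of "-1" g] by simp

lemma rat_poly_fun_power: "rat_poly_fun f \<Longrightarrow> rat_poly_fun (\<lambda>T. f T ^ n)"
  by (induction n) (auto intro: rat_poly_fun_mult rat_poly_fun_const)

lemma rat_poly_fun_sum: "(\<And>i. i \<in> I \<Longrightarrow> rat_poly_fun (f i)) \<Longrightarrow> rat_poly_fun (\<lambda>T. \<Sum>i\<in>I. f i T)"
  by (induction I rule: infinite_finite_induct) (auto intro: rat_poly_fun_add rat_poly_fun_const)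

lemma rat_poly_fun_prod_list: "(\<And>i. i \<in> set I \<Longrightarrow> rat_poly_fun (f i)) \<Longrightarrow> rat_poly_fun (\<lambda>T. \<Prod>i\<leftarrow>I. f i T)"
  by (induction I) (auto intro: rat_poly_fun_mult rat_poly_fun_const)

lemma rat_poly_fun_imp_rat_poly:
  assumes "rat_poly_fun f"
  shows "\<exists>P :: rat poly. \<forall>T. norm T < 1 \<longrightarrow> f T = poly (map_poly of_rat P) T"
proof -
  obtain p where p: "\<forall>i. coeff p i \<in> \<rat>" "\<forall>T. norm T < 1 \<longrightarrow> f T = poly p T"
    using assms unfolding rat_poly_fun_def by blast
  define \<rho> :: "complex \<Rightarrow> rat" where "\<rho> = inv of_rat"
  have \<rho>: "of_rat (\<rho> x) = x" if "x \<in> \<rat>" for x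
    using that unfolding \<rho>_def Rats_def by (rule f_inv_into_f)
  have "\<rho> 0 = 0"
    using \<rho>[of 0] by simp
  then have "map_poly of_rat (map_poly \<rho> p) = p"
    using p \<rho> by (intro poly_eqI) (simp add: coeff_map_poly)
  then show ?thesis
    using p by (intro exI[of _ "map_poly \<rho> p"]) auto
qed

section \<open>Delays (generating functions times powers of the variable) and recurrences\<close>

definition delay :: "nat \<Rightarrow> (nat \<Rightarrow> real) \<Rightarrow> nat \<Rightarrow> real" where
  "delay m U = (\<lambda>M. if m \<le> M then U (M - m) else 0)"

lemma delay_delay: "delay m (delay n U) = delay (m + n) U"
  by (auto simp: delay_def fun_eq_iff)

lemma delay_0 [simp]: "delay 0 U = U"
  by (simp add: delay_def)

lemma delay_linear: "delay m (\<lambda>M. U M - c * V M) = (\<lambda>M. delay m U M - c * delay m V M)"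
  by (auto simp: delay_def fun_eq_iff)

lemma has_sum_delay: "(delay m U has_sum s) UNIV \<longleftrightarrow> (U has_sum s) UNIV"
proof -
  have "(delay m U has_sum s) UNIV \<longleftrightarrow> (delay m U has_sum s) (range (\<lambda>M. M + m))"
    by (rule has_sum_cong_neutral) (auto simp: delay_def image_iff, metis le_add_diff_inverse2)
  also have "\<dots> \<longleftrightarrow> (delay m U \<circ> (\<lambda>M. M + m) has_sum s) UNIV"
    by (rule has_sum_reindex) (auto simp: inj_on_def)
  also have "delay m U \<circ> (\<lambda>M. M + m) = U"
    by (simp add: delay_def fun_eq_iff)
  finally show ?thesis .
qed

lemma summable_delay: "U summable_on UNIV \<Longrightarrow> delay m U summable_on UNIV"
  unfolding summable_on_def has_sum_delay .

text \<open>The product of the operators \<open>U \<mapsto> U - \<alpha> delay m U\<close> over the list sends \<open>U\<close> to a finitely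
  supported rational sequence.\<close>
fun rat_rec :: "(real \<times> nat) list \<Rightarrow> (nat \<Rightarrow> real) \<Rightarrow> bool" where
  "rat_rec [] U = (finite {M. U M \<noteq> 0} \<and> range U \<subseteq> \<rat>)"
| "rat_rec ((\<alpha>, m) # L) U = rat_rec L (\<lambda>M. U M - \<alpha> * delay m U M)"

lemma rat_rec_lincomb: "rat_rec L U \<Longrightarrow> rat_rec L V \<Longrightarrow> c \<in> \<rat> \<Longrightarrow> rat_rec L (\<lambda>M. U M + c * V M)"
proof (induction L U arbitrary: V rule: rat_rec.induct)
  case (1 U)
  have "{M. U M + c * V M \<noteq> 0} \<subseteq> {M. U M \<noteq> 0} \<union> {M. V M \<noteq> 0}" by auto
  then show ?case
    using 1 by (auto intro: finite_subset intro!: Rats_add Rats_mult)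
next
  case (2 \<alpha> m L U)
  have "(\<lambda>M. U M + c * V M - \<alpha> * delay m (\<lambda>M. U M + c * V M) M) =
      (\<lambda>M. (U M - \<alpha> * delay m U M) + c * (V M - \<alpha> * delay m V M))"
    by (auto simp: delay_def fun_eq_iff algebra_simps)
  then show ?case
    using 2 by simp
qed

lemma rat_rec_zero: "rat_rec L (\<lambda>M. 0)"
proof (induction L)
  case (Cons p L)
  then show ?case by (cases p) (simp add: delay_def)
qed simp

lemma rat_rec_cmult: "rat_rec L U \<Longrightarrow> c \<in> \<rat> \<Longrightarrow> rat_rec L (\<lambda>M. c * U M)"
  using rat_rec_lincomb[OF rat_rec_zero, of L U c] by simp

lemma rat_rec_add: "rat_rec L U \<Longrightarrow> rat_rec L V \<Longrightarrow> rat_rec L (\<lambda>M. U M + V M)"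
  using rat_rec_lincomb[of L U V 1] by simp

lemma rat_rec_delay: "rat_rec L U \<Longrightarrow> rat_rec L (delay n U)"
proof (induction L U rule: rat_rec.induct)
  case (1 U)
  have "{M. delay n U M \<noteq> 0} \<subseteq> (\<lambda>M. M + n) ` {M. U M \<noteq> 0}"
    by (auto simp: delay_def image_iff split: if_splits) (metis le_add_diff_inverse2)
  moreover have "range (delay n U) \<subseteq> \<rat>"
    using 1 by (auto simp: delay_def)
  ultimately show ?case
    using 1 by (auto intro: finite_subset)
next
  case (2 \<alpha> m L U)
  have "(\<lambda>M. delay n U M - \<alpha> * delay m (delay n U) M) = delay n (\<lambda>M. U M - \<alpha> * delay m U M)"
    by (auto simp: delay_def fun_eq_iff add.commute)
  then show ?case
    using 2 by simp
qed

lemma rat_rec_sum: "(\<And>i. i \<in> I \<Longrightarrow> rat_rec L (f i)) \<Longrightarrow> rat_rec L (\<lambda>M. \<Sum>i\<in>I. f i M)"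
  by (induction I rule: infinite_finite_induct) (auto intro: rat_rec_add rat_rec_zero)

definition admissible :: "(real \<times> nat) list \<Rightarrow> bool" where
  "admissible L \<longleftrightarrow> (\<forall>(\<alpha>, m)\<in>set L. \<alpha> \<in> \<rat> \<and> 0 \<le> \<alpha> \<and> \<alpha> < 1)"

lemma rat_rec_Rats: "admissible L \<Longrightarrow> rat_rec L U \<Longrightarrow> U M \<in> \<rat>"
proof (induction L U arbitrary: M rule: rat_rec.induct)
  case (2 \<alpha> m L U)
  have a: "\<alpha> \<in> \<rat>" "\<alpha> < 1" and admissible: "admissible L"
    using 2(2) by (auto simp: admissible_def)
  have IH: "U M - \<alpha> * delay m U M \<in> \<rat>" for M
    using 2(1)[OF admissible] 2(3) by simp
  show ?case
  \<comment> \<open>For \<open>m = 0\<close> the operator is multiplication by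
    \<open>1 - \<alpha> \<noteq> 0\<close>; for \<open>m > 0\<close> the delayed value is an earlier
    one, so rationality propagates by strong induction.\<close>
  proof (cases "m = 0")
    case True
    have "U M = inverse (1 - \<alpha>) * (U M - \<alpha> * delay m U M)"
      using True a by (simp add: field_simps)
    then show ?thesis
      using IH a by (metis Rats_mult Rats_inverse Rats_diff Rats_1)
  next
    case False
    show ?thesis
    proof (induction M rule: less_induct)
      case (less M)
      have "delay m U M \<in> \<rat>"
        using less False by (auto simp: delay_def)
      then have "(U M - \<alpha> * delay m U M) + \<alpha> * delay m U M \<in> \<rat>"
        using IH a by (intro Rats_add Rats_mult)
      then show ?case by simp
    qed
  qed
qed auto

lemma summable_on_finite_sum:
  fixes f :: "'i \<Rightarrow> 'a \<Rightarrow> real"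
  shows "(\<And>i. i \<in> I \<Longrightarrow> f i summable_on X) \<Longrightarrow> (\<lambda>x. \<Sum>i\<in>I. f i x) summable_on X"
  by (induction I rule: infinite_finite_induct) (auto intro: summable_on_add)

lemma summable_rat_rec_step:
  assumes "(U :: nat \<Rightarrow> real) summable_on UNIV"
  shows "(\<lambda>M. U M - \<alpha> * delay m U M) summable_on UNIV"
  using summable_on_add[OF assms summable_on_cmult_right[OF summable_delay[OF assms], of "- \<alpha>"]] by simp

text \<open>A delay preserves the total, so each operator multiplies it by the nonzero rational
  \<open>1 - \<alpha>\<close>; the sequence reached at the end is finitely supported and
  rational.\<close>

lemma rat_rec_infsum_Rats: "admissible L \<Longrightarrow> rat_rec L U \<Longrightarrow> U summable_on UNIV \<Longrightarrow> infsum U UNIV \<in> \<rat>"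
proof (induction L U rule: rat_rec.induct)
  case (1 U)
  have "infsum U UNIV = infsum U {M. U M \<noteq> 0}"
    by (rule infsum_cong_neutral) auto
  also have "\<dots> = (\<Sum>M | U M \<noteq> 0. U M)"
    using 1 by simp
  also have "\<dots> \<in> \<rat>"
    using 1 by (intro Rats_sum) auto
  finally show ?case .
next
  case (2 \<alpha> m L U)
  have a: "\<alpha> \<in> \<rat>" "\<alpha> < 1" and admissible: "admissible L"
    using 2(2) by (auto simp: admissible_def)
  have s: "(U has_sum infsum U UNIV) UNIV"
    using 2(4) by simp
  have "((\<lambda>M. - \<alpha> * delay m U M) has_sum (- \<alpha> * infsum U UNIV)) UNIV"
    by (rule has_sum_cmult_right) (use s in \<open>simp add: has_sum_delay\<close>)
  from has_sum_add[OF s this]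
  have "((\<lambda>M. U M - \<alpha> * delay m U M) has_sum (infsum U UNIV - \<alpha> * infsum U UNIV)) UNIV"
    by simp
  then have "infsum (\<lambda>M. U M - \<alpha> * delay m U M) UNIV = infsum U UNIV - \<alpha> * infsum U UNIV"
    by (rule infsumI)
  then have "infsum U UNIV - \<alpha> * infsum U UNIV \<in> \<rat>"
    using 2(1)[OF admissible _ summable_rat_rec_step[OF 2(4)]] 2(3) by simp
  moreover have "infsum U UNIV = inverse (1 - \<alpha>) * (infsum U UNIV - \<alpha> * infsum U UNIV)"
    using a by (simp add: field_simps)
  ultimately show ?case
    using a by (metis Rats_mult Rats_inverse Rats_diff Rats_1)
qed

section \<open>Bilinear pairings of sequences against a kernel\<close>

type_synonym kernel = "nat \<Rightarrow> nat \<Rightarrow> complex \<Rightarrow> complex"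

definition bounded_kernel :: "kernel \<Rightarrow> bool" where
  "bounded_kernel \<theta> \<longleftrightarrow> (\<forall>T. norm T < 1 \<longrightarrow> (\<exists>C. \<forall>M M'. norm (\<theta> M M' T) \<le> C))"

definition pairing :: "kernel \<Rightarrow> (nat \<Rightarrow> real) \<Rightarrow> (nat \<Rightarrow> real) \<Rightarrow> complex \<Rightarrow> complex" where
  "pairing \<theta> U V T = infsum (\<lambda>(M, M'). of_real (U M) * of_real (V M') * \<theta> M M' T) (UNIV \<times> UNIV)"

lemma summable_real_abs: "(U :: nat \<Rightarrow> real) summable_on UNIV \<Longrightarrow> (\<lambda>M. \<bar>U M\<bar>) summable_on UNIV"
  using summable_on_iff_abs_summable_on_real[of U UNIV] by simp

lemma pairing_summable:
  assumes \<theta>: "bounded_kernel \<theta>" and U: "U summable_on UNIV" and V: "V summable_on UNIV" and T: "norm T < 1"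
  shows "(\<lambda>(M, M'). of_real (U M) * of_real (V M') * \<theta> M M' T) summable_on (UNIV \<times> UNIV)"
proof -
  obtain C where C: "\<And>M M'. norm (\<theta> M M' T) \<le> C"
    using \<theta> T unfolding bounded_kernel_def by blast
  have "(\<lambda>(M, M'). \<bar>U M\<bar> * \<bar>V M'\<bar>) summable_on (UNIV \<times> UNIV)"
  proof (rule summable_on_SigmaI[where g = "\<lambda>M. \<bar>U M\<bar> * infsum (\<lambda>M'. \<bar>V M'\<bar>) UNIV"])
    show "((\<lambda>M'. case (M, M') of (M, M') \<Rightarrow> \<bar>U M\<bar> * \<bar>V M'\<bar>) has_sum \<bar>U M\<bar> * infsum (\<lambda>M'. \<bar>V M'\<bar>) UNIV) UNIV" for M
      using summable_real_abs[OF V] by (simp add: has_sum_cmult_right)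
    show "(\<lambda>M. \<bar>U M\<bar> * infsum (\<lambda>M'. \<bar>V M'\<bar>) UNIV) summable_on UNIV"
      using summable_real_abs[OF U] by (rule summable_on_cmult_left)
  qed auto
  then have "(\<lambda>p. C * (case p of (M, M') \<Rightarrow> \<bar>U M\<bar> * \<bar>V M'\<bar>)) summable_on (UNIV \<times> UNIV)"
    by (rule summable_on_cmult_right)
  then have "(\<lambda>p. norm (case p of (M, M') \<Rightarrow> complex_of_real (U M) * complex_of_real (V M') * \<theta> M M' T)) summable_on (UNIV \<times> UNIV)"
  proof (rule summable_on_comparison_test)
    fix p :: "nat \<times> nat"
    obtain M M' where [simp]: "p = (M, M')" by force
    have "norm (complex_of_real (U M) * complex_of_real (V M') * \<theta> M M' T) \<le> \<bar>U M\<bar> * \<bar>V M'\<bar> * C"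
      unfolding norm_mult norm_of_real by (intro mult_left_mono C) auto
    then show "norm (case p of (M, M') \<Rightarrow> complex_of_real (U M) * complex_of_real (V M') * \<theta> M M' T)
        \<le> C * (case p of (M, M') \<Rightarrow> \<bar>U M\<bar> * \<bar>V M'\<bar>)"
      by (simp add: mult_ac)
  qed auto
  then show ?thesis
    by (rule abs_summable_summable)
qed

lemma pairing_swap: "pairing \<theta> U V T = pairing (\<lambda>M M'. \<theta> M' M) V U T"
proof -
  have "pairing (\<lambda>M M'. \<theta> M' M) V U T =
      infsum ((\<lambda>(M, M'). of_real (U M) * of_real (V M') * \<theta> M M' T) \<circ> prod.swap) (UNIV \<times> UNIV)"
    unfolding pairing_def by (rule infsum_cong) (auto simp: mult_ac)
  also have "\<dots> = pairing \<theta> U V T"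
    unfolding pairing_def by (subst infsum_reindex[symmetric]) (auto simp: inj_on_def)
  finally show ?thesis ..
qed

lemma pairing_lincomb:
  assumes "bounded_kernel \<theta>" "U summable_on UNIV" "V summable_on UNIV" "W summable_on UNIV" "norm T < 1"
  shows "pairing \<theta> (\<lambda>M. U M + c * W M) V T = pairing \<theta> U V T + of_real c * pairing \<theta> W V T"
proof -
  have "pairing \<theta> (\<lambda>M. U M + c * W M) V T =
     infsum (\<lambda>p. (case p of (M, M') \<Rightarrow> of_real (U M) * of_real (V M') * \<theta> M M' T) +
       of_real c * (case p of (M, M') \<Rightarrow> of_real (W M) * of_real (V M') * \<theta> M M' T)) (UNIV \<times> UNIV)"
    unfolding pairing_def by (rule infsum_cong) (auto simp: algebra_simps)
  also have "\<dots> = pairing \<theta> U V T + infsum (\<lambda>p. of_real c * (case p of (M, M') \<Rightarrow> of_real (W M) * of_real (V M') * \<theta> M M' T)) (UNIV \<times> UNIV)"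
    unfolding pairing_def by (intro infsum_add summable_on_cmult_right pairing_summable assms)
  also have "infsum (\<lambda>p. of_real c * (case p of (M, M') \<Rightarrow> of_real (W M) * of_real (V M') * \<theta> M M' T)) (UNIV \<times> UNIV) = of_real c * pairing \<theta> W V T"
    unfolding pairing_def by (intro infsum_cmult_right pairing_summable assms)
  finally show ?thesis .
qed

lemma bounded_kernel_swap: "bounded_kernel \<theta> \<Longrightarrow> bounded_kernel (\<lambda>M M'. \<theta> M' M)"
  unfolding bounded_kernel_def by blast

lemma pairing_lincomb_right:
  assumes "bounded_kernel \<theta>" "U summable_on UNIV" "V summable_on UNIV" "W summable_on UNIV" "norm T < 1"
  shows "pairing \<theta> U (\<lambda>M. V M + c * W M) T = pairing \<theta> U V T + of_real c * pairing \<theta> U W T"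
  unfolding pairing_swap[of \<theta> U] by (rule pairing_lincomb[OF bounded_kernel_swap[OF assms(1)] assms(3,2,4,5)])

lemma pairing_cmult: "pairing \<theta> (\<lambda>M. c * U M) V T = of_real c * pairing \<theta> U V T"
proof -
  have "pairing \<theta> (\<lambda>M. c * U M) V T =
     infsum (\<lambda>p. of_real c * (case p of (M, M') \<Rightarrow> of_real (U M) * of_real (V M') * \<theta> M M' T)) (UNIV \<times> UNIV)"
    unfolding pairing_def by (rule infsum_cong) (auto simp: algebra_simps)
  then show ?thesis
    by (simp add: pairing_def infsum_cmult_right')
qed

text \<open>Delayed sequences vanish below \<open>l\<close>, so the double sum is the old one
  reindexed by a diagonal shift, along which the kernel is homogeneous.\<close>

lemma pairing_delay:
  assumes \<theta>: "\<And>M M'. \<theta> (M + l) (M' + l) T = T ^ l * \<theta> M M' T"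
  shows "pairing \<theta> (delay l U) (delay l V) T = T ^ l * pairing \<theta> U V T"
proof -
  define g where "g = (\<lambda>(M, M'). of_real (delay l U M) * of_real (delay l V M') * \<theta> M M' T)"
  define j where "j = (\<lambda>(M, M'). (M + l, M' + l))"
  have "pairing \<theta> (delay l U) (delay l V) T = infsum g (j ` (UNIV \<times> UNIV))"
    unfolding pairing_def g_def[symmetric]
  proof (rule infsum_cong_neutral)
    fix p :: "nat \<times> nat" assume p: "p \<in> UNIV \<times> UNIV - j ` (UNIV \<times> UNIV)"
    obtain M M' where [simp]: "p = (M, M')" by force
    have "\<not> (l \<le> M \<and> l \<le> M')"
    proof
      assume "l \<le> M \<and> l \<le> M'"
      then have "p = j (M - l, M' - l)" by (simp add: j_def)
      then show False using p by blast
    qed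
    then show "g p = 0" by (auto simp: g_def delay_def)
  qed auto
  also have "\<dots> = infsum (g \<circ> j) (UNIV \<times> UNIV)"
    by (rule infsum_reindex) (auto simp: inj_on_def j_def)
  also have "\<dots> = infsum (\<lambda>p. T ^ l * (case p of (M, M') \<Rightarrow> of_real (U M) * of_real (V M') * \<theta> M M' T)) (UNIV \<times> UNIV)"
    by (rule infsum_cong) (auto simp: g_def j_def delay_def \<theta> algebra_simps)
  also have "\<dots> = T ^ l * pairing \<theta> U V T"
    by (simp add: pairing_def infsum_cmult_right')
  finally show ?thesis .
qed

text \<open>Base case of the recursion on factors. For fixed \<open>M\<close> the kernel equals a
  fixed \<open>g M\<close> once \<open>M'\<close> is large, so a row is the total of
  \<open>V\<close> times \<open>g M\<close> plus a finite correction, and only finitely many rows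
  count. Rationality of the total keeps the coefficients rational.\<close>

lemma pairing_finite_support:
  assumes \<theta>: "bounded_kernel \<theta>" and RPt: "\<And>M M'. rat_poly_fun (\<theta> M M')"
    and ev: "\<And>M. \<exists>N g. rat_poly_fun g \<and> (\<forall>M'\<ge>N. \<forall>T. \<theta> M M' T = g T)"
    and U: "finite {M. U M \<noteq> 0}" "range U \<subseteq> \<rat>"
    and V: "V summable_on UNIV" "\<And>M. V M \<in> \<rat>" "infsum V UNIV \<in> \<rat>"
  shows "rat_poly_fun (pairing \<theta> U V)"
proof -
  obtain N g where g: "\<And>M. rat_poly_fun (g M)" and N: "\<And>M M' T. N M \<le> M' \<Longrightarrow> \<theta> M M' T = g M T"
    using ev by metis
  have Us: "U summable_on UNIV"
    by (rule finite_nonzero_values_imp_summable_on) (use U in simp)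
  define row where "row = (\<lambda>M T. (\<Sum>M'<N M. of_real (V M') * (\<theta> M M' T - g M T)) + of_real (infsum V UNIV) * g M T)"
  have row: "((\<lambda>M'. of_real (V M') * \<theta> M M' T) has_sum row M T) UNIV" for M T
  proof -
    have "((\<lambda>M'. complex_of_real (V M')) has_sum of_real (infsum V UNIV)) UNIV"
      using V by (intro has_sum_of_real) simp
    then have 1: "((\<lambda>M'. of_real (V M') * g M T) has_sum of_real (infsum V UNIV) * g M T) UNIV"
      by (rule has_sum_cmult_left)
    have 2: "((\<lambda>M'. of_real (V M') * (\<theta> M M' T - g M T)) has_sum
        (\<Sum>M'<N M. of_real (V M') * (\<theta> M M' T - g M T))) UNIV"
      by (rule has_sum_finite_neutralI) (use N in \<open>auto simp: not_less\<close>)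
    from has_sum_add[OF 2 1] show ?thesis
      unfolding row_def by (simp add: algebra_simps)
  qed
  have "pairing \<theta> U V T = (\<Sum>M | U M \<noteq> 0. of_real (U M) * row M T)" if T: "norm T < 1" for T
  proof -
    have s: "((\<lambda>(M, M'). of_real (U M) * of_real (V M') * \<theta> M M' T) has_sum pairing \<theta> U V T) (UNIV \<times> UNIV)"
      using pairing_summable[OF \<theta> Us V(1) T] by (simp add: pairing_def)
    have "((\<lambda>M. of_real (U M) * row M T) has_sum pairing \<theta> U V T) UNIV"
      by (rule has_sum_SigmaD[OF s]) (use has_sum_cmult_right[OF row] in \<open>auto simp: mult.assoc\<close>)
    moreover have "((\<lambda>M. of_real (U M) * row M T) has_sum (\<Sum>M | U M \<noteq> 0. of_real (U M) * row M T)) UNIV"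
      by (rule has_sum_finite_neutralI) (use U in auto)
    ultimately show ?thesis
      by (rule has_sum_unique)
  qed
  then have "rat_poly_fun (pairing \<theta> U V) \<longleftrightarrow> rat_poly_fun (\<lambda>T. \<Sum>M | U M \<noteq> 0. of_real (U M) * row M T)"
    by (rule rat_poly_fun_cong)
  moreover have "rat_poly_fun (\<lambda>T. \<Sum>M | U M \<noteq> 0. of_real (U M) * row M T)"
    unfolding row_def using U V g RPt
    by (intro rat_poly_fun_sum rat_poly_fun_mult rat_poly_fun_add rat_poly_fun_diff rat_poly_fun_const) (auto intro!: Rats_of_real)
  ultimately show ?thesis by blast
qed

text \<open>With \<open>\<alpha> = q^(-|a|)\<close>, \<open>\<beta> = q^(-|b|)\<close> and
  \<open>T = q^(-s)\<close> this is \<open>q^c\<close> for \<open>c = c_{a,b}(s)\<close>; the value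
  0 at a vanishing delay is the convention \<open>q^(-\<infinity>) = 0\<close>.\<close>

definition pole_term :: "real \<times> nat \<Rightarrow> real \<times> nat \<Rightarrow> complex \<Rightarrow> complex" where
  "pole_term = (\<lambda>(\<alpha>, m) (\<beta>, m') T. if m = 0 \<or> m' = 0 then 0
     else of_real (\<alpha> ^ (m' div gcd m m') * \<beta> ^ (m div gcd m m')) * T ^ lcm m m')"

definition pole_product :: "(real \<times> nat) list \<Rightarrow> (real \<times> nat) list \<Rightarrow> complex \<Rightarrow> complex" where
  "pole_product L L' T = (\<Prod>p\<leftarrow>L. \<Prod>p'\<leftarrow>L'. 1 - pole_term p p' T)"

lemma pole_product_Nil [simp]: "pole_product [] L' T = 1" "pole_product L [] T = 1"
  by (simp add: pole_product_def) (induction L; simp add: pole_product_def)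

lemma pole_product_Cons_left: "pole_product (p # L) L' T = (\<Prod>p'\<leftarrow>L'. 1 - pole_term p p' T) * pole_product L L' T"
  by (simp add: pole_product_def)

lemma pole_product_Cons_right: "pole_product L (p' # L') T = (\<Prod>p\<leftarrow>L. 1 - pole_term p p' T) * pole_product L L' T"
  by (induction L) (auto simp: pole_product_def mult_ac)

lemma rat_poly_fun_Yf:
  assumes "fst p \<in> \<rat>" "fst p' \<in> \<rat>"
  shows "rat_poly_fun (\<lambda>T. 1 - pole_term p p' T)"
proof -
  obtain \<alpha> m \<beta> m' where [simp]: "p = (\<alpha>, m)" "p' = (\<beta>, m')" by force
  show ?thesis
  proof (cases "m = 0 \<or> m' = 0")
    case True
    then show ?thesis by (simp add: pole_term_def rat_poly_fun_const)
  next
    case False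
    then have "pole_term p p' = (\<lambda>T. of_real (\<alpha> ^ (m' div gcd m m') * \<beta> ^ (m div gcd m m')) * T ^ lcm m m')"
      by (auto simp: pole_term_def)
    then show ?thesis
      using assms by (auto intro!: rat_poly_fun_diff rat_poly_fun_mult rat_poly_fun_power rat_poly_fun_const rat_poly_fun_ident Rats_of_real Rats_mult Rats_power
          simp del: of_real_mult of_real_power)
  qed
qed

text \<open>Telescoping of \<open>U = (U - \<alpha> S^m U) + \<alpha> S^m U\<close>, where
  \<open>S\<close> is the unit delay.\<close>

lemma delay_iterate:
  "U M = (\<Sum>i<E. \<alpha> ^ i * delay (i * m) (\<lambda>M. U M - \<alpha> * delay m U M) M) + \<alpha> ^ E * delay (E * m) U M"
proof (induction E)
  case (Suc E)
  have eq: "delay (E * m) (\<lambda>M. U M - \<alpha> * delay m U M) M = delay (E * m) U M - \<alpha> * delay (Suc E * m) U M"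
    unfolding delay_linear delay_delay by (simp add: add.commute)
  show ?case
    unfolding sum.lessThan_Suc eq using Suc by (simp add: algebra_simps)
qed simp

text \<open>With \<open>U = U1 + a S\<^sup>l U\<close> and \<open>V = V1 + b S\<^sup>l V\<close>, where \<open>S\<close> is the unit delay and \<open>l\<close> the least
  common multiple of the two periods, bilinearity and homogeneity of the kernel give
  \<open>(1 - a b T\<^sup>l) pairing U V = pairing U1 V + pairing U V1 - pairing U1 V1\<close>.\<close>
theorem pairing_rational:
  assumes \<theta>: "bounded_kernel \<theta>" and RPt: "\<And>M M'. rat_poly_fun (\<theta> M M')"
    and ev: "\<And>M. \<exists>N g. rat_poly_fun g \<and> (\<forall>M'\<ge>N. \<forall>T. \<theta> M M' T = g T)"
    and ev': "\<And>M'. \<exists>N g. rat_poly_fun g \<and> (\<forall>M\<ge>N. \<forall>T. \<theta> M M' T = g T)"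
    and hom: "\<And>M M' l T. \<theta> (M + l) (M' + l) T = T ^ l * \<theta> M M' T"
    and "admissible L" "admissible L'" "rat_rec L U" "rat_rec L' V" "U summable_on UNIV" "V summable_on UNIV"
  shows "rat_poly_fun (\<lambda>T. pairing \<theta> U V T * pole_product L L' T)"
  using assms(6-)
\<comment> \<open>Each of the three pairings on the right of the identity has one factor less on at
  least one side.\<close>
proof (induction "length L + length L'" arbitrary: L L' U V rule: less_induct)
  case less
  note admissible = less.prems(1,2) and rat_rec = less.prems(3,4) and sm = less.prems(5,6)
  consider "L = []" | "L' = []" | \<alpha> m L1 \<beta> m' L1' where "L = (\<alpha>, m) # L1" "L' = (\<beta>, m') # L1'"
    by (metis list.exhaust surj_pair)
  then show ?case
  proof cases
    case 1
    then have "rat_poly_fun (pairing \<theta> U V)"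
      using rat_rec sm rat_rec_Rats[OF admissible(2) rat_rec(2)] rat_rec_infsum_Rats[OF admissible(2) rat_rec(2) sm(2)]
      by (intro pairing_finite_support[OF \<theta> RPt ev]) auto
    then show ?thesis using 1 by simp
  next
    case 2
    then have "rat_poly_fun (pairing (\<lambda>M M'. \<theta> M' M) V U)"
      using rat_rec sm rat_rec_Rats[OF admissible(1) rat_rec(1)] rat_rec_infsum_Rats[OF admissible(1) rat_rec(1) sm(1)]
      by (intro pairing_finite_support[OF bounded_kernel_swap[OF \<theta>] RPt ev']) auto
    then have "rat_poly_fun (pairing \<theta> U V)"
      using rat_poly_fun_cong[of "pairing \<theta> U V" "pairing (\<lambda>M M'. \<theta> M' M) V U"] pairing_swap by blast
    then show ?thesis using 2 by simp
  next
    case 3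
    have ad1: "admissible L1" "\<alpha> \<in> \<rat>" "0 \<le> \<alpha>" "\<alpha> < 1" and ad2: "admissible L1'" "\<beta> \<in> \<rat>" "0 \<le> \<beta>" "\<beta> < 1"
      using admissible 3 by (auto simp: admissible_def)
    have rat: "fst p \<in> \<rat>" if "p \<in> set L \<union> set L'" for p
      using admissible that by (auto simp: admissible_def)
    define U0 where "U0 = (\<lambda>M. U M - \<alpha> * delay m U M)"
    define V0 where "V0 = (\<lambda>M. V M - \<beta> * delay m' V M)"
    have U0: "rat_rec L1 U0" "U0 summable_on UNIV" and V0: "rat_rec L1' V0" "V0 summable_on UNIV"
      using rat_rec 3 summable_rat_rec_step sm by (simp_all add: U0_def V0_def)
    have scal: "complex_of_real (inverse (1 - x)) \<in> \<rat>" if "x \<in> \<rat>" for x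
      using that by (intro Rats_of_real Rats_inverse Rats_diff Rats_1)
    show ?thesis
    \<comment> \<open>A zero delay makes the operator a nonzero scalar, which is divided out;
      correspondingly its pole terms are 0 and its factors are 1.\<close>
    proof (cases "m = 0 \<or> m' = 0")
      case True
      then show ?thesis
      proof
        assume m: "m = 0"
        have "U = (\<lambda>M. inverse (1 - \<alpha>) * U0 M)"
          using m ad1 by (auto simp: U0_def fun_eq_iff field_simps)
        then have "pairing \<theta> U V T = of_real (inverse (1 - \<alpha>)) * pairing \<theta> U0 V T" for T
          using pairing_cmult by metis
        moreover have "pole_product L L' T = pole_product L1 L' T" for T
        proof -
          have "(\<Prod>p'\<leftarrow>L'. 1 - pole_term (\<alpha>, m) p' T) = 1" for L'
            using m by (induction L') (auto simp: pole_term_def)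
          then show ?thesis
            unfolding 3(1) pole_product_Cons_left by simp
        qed
        moreover have "rat_poly_fun (\<lambda>T. pairing \<theta> U0 V T * pole_product L1 L' T)"
          using less(1)[of L1 L' U0 V] 3 ad1 admissible rat_rec U0 sm by simp
        ultimately show ?thesis
          using rat_poly_fun_cmult[OF scal[OF ad1(2)]] by (simp add: mult.assoc)
      next
        assume m: "m' = 0"
        have "V = (\<lambda>M. inverse (1 - \<beta>) * V0 M)"
          using m ad2 by (auto simp: V0_def fun_eq_iff field_simps)
        then have "pairing \<theta> U V T = of_real (inverse (1 - \<beta>)) * pairing \<theta> U V0 T" for T
          using pairing_cmult pairing_swap by metis
        moreover have "pole_product L L' T = pole_product L L1' T" for T
        proof -
          have "(\<Prod>p\<leftarrow>L. 1 - pole_term p (\<beta>, m') T) = 1" for L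
            using m by (induction L) (auto simp: pole_term_def)
          then show ?thesis
            unfolding 3(2) pole_product_Cons_right by simp
        qed
        moreover have "rat_poly_fun (\<lambda>T. pairing \<theta> U V0 T * pole_product L L1' T)"
          using less(1)[of L L1' U V0] 3 ad2 admissible rat_rec V0 sm by simp
        ultimately show ?thesis
          using rat_poly_fun_cmult[OF scal[OF ad2(2)]] by (simp add: mult.assoc)
      qed
    next
      case False
      \<comment> \<open>\<open>E\<close> and \<open>E'\<close> are the least numbers of steps after
        which the delays \<open>m\<close> and \<open>m'\<close> meet, at \<open>l\<close>;
        homogeneity of the kernel needs equal delays on both sides.\<close>
      define E where "E = m' div gcd m m'"
      define E' where "E' = m div gcd m m'"
      define l where "l = lcm m m'"
      have El: "E * m = l" "E' * m' = l"
        by (simp_all add: E_def E'_def l_def lcm_nat_def div_mult_swap dvd_div_mult mult.commute)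
      define U1 where "U1 = (\<lambda>M. \<Sum>i<E. \<alpha> ^ i * delay (i * m) U0 M)"
      define V1 where "V1 = (\<lambda>M. \<Sum>i<E'. \<beta> ^ i * delay (i * m') V0 M)"
      have U1: "rat_rec L1 U1" "U1 summable_on UNIV" and V1: "rat_rec L1' V1" "V1 summable_on UNIV"
        unfolding U1_def V1_def using ad1 ad2 U0 V0
        by (auto intro!: rat_rec_sum rat_rec_cmult rat_rec_delay summable_on_finite_sum summable_on_cmult_right summable_delay)
      have Ueq: "U = (\<lambda>M. U1 M + \<alpha> ^ E * delay l U M)"
        unfolding U1_def U0_def El(1)[symmetric] by (rule ext) (rule delay_iterate)
      have Veq: "V = (\<lambda>M. V1 M + \<beta> ^ E' * delay l V M)"
        unfolding V1_def V0_def El(2)[symmetric] by (rule ext) (rule delay_iterate)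
      define Y where "Y = (\<lambda>T. of_real (\<alpha> ^ E * \<beta> ^ E') * T ^ l :: complex)"
      have key: "(1 - Y T) * pairing \<theta> U V T = pairing \<theta> U1 V T + pairing \<theta> U V1 T - pairing \<theta> U1 V1 T" if T: "norm T < 1" for T
      proof -
        have 1: "pairing \<theta> U W T = pairing \<theta> U1 W T + of_real (\<alpha> ^ E) * pairing \<theta> (delay l U) W T" if "W summable_on UNIV" for W
          by (subst (1) Ueq) (rule pairing_lincomb[OF \<theta> U1(2) that summable_delay[OF sm(1)] T])
        have 2: "pairing \<theta> (delay l U) V T = pairing \<theta> (delay l U) V1 T + of_real (\<beta> ^ E') * pairing \<theta> (delay l U) (delay l V) T"
          by (subst (1) Veq) (rule pairing_lincomb_right[OF \<theta> summable_delay[OF sm(1)] V1(2) summable_delay[OF sm(2)] T])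
        have 3: "pairing \<theta> (delay l U) (delay l V) T = T ^ l * pairing \<theta> U V T"
          by (rule pairing_delay) (rule hom)
        show ?thesis
          using 1[OF sm(2)] 1[OF V1(2)] 2 3 unfolding Y_def by (simp add: algebra_simps)
      qed
      \<comment> \<open>The induction hypothesis supplies smaller products; \<open>R1\<close> and
        \<open>R2\<close> are the missing row and column of factors, with \<open>1 - Y T\<close> at
        the corner.\<close>
      define R1 where "R1 = (\<lambda>T. \<Prod>p'\<leftarrow>L1'. 1 - pole_term (\<alpha>, m) p' T)"
      define R2 where "R2 = (\<lambda>T. \<Prod>p\<leftarrow>L1. 1 - pole_term p (\<beta>, m') T)"
      have R: "rat_poly_fun R1" "rat_poly_fun R2"
        unfolding R1_def R2_def using rat 3 by (auto intro!: rat_poly_fun_prod_list rat_poly_fun_Yf)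
      have YY: "pole_term (\<alpha>, m) (\<beta>, m') T = Y T" for T
        using False by (simp add: pole_term_def Y_def E_def E'_def l_def)
      have PPs: "pole_product L L' T = (1 - Y T) * R1 T * (R2 T * pole_product L1 L1' T)" "pole_product L1 L' T = R2 T * pole_product L1 L1' T"
        "pole_product L L1' T = R1 T * pole_product L1 L1' T" for T
        unfolding 3 pole_product_Cons_left pole_product_Cons_right R1_def R2_def by (simp_all add: YY)
      have g: "rat_poly_fun (\<lambda>T. pairing \<theta> U1 V T * pole_product L1 L' T)" "rat_poly_fun (\<lambda>T. pairing \<theta> U V1 T * pole_product L L1' T)"
        "rat_poly_fun (\<lambda>T. pairing \<theta> U1 V1 T * pole_product L1 L1' T)"
        using less(1)[of L1 L' U1 V] less(1)[of L L1' U V1] less(1)[of L1 L1' U1 V1] 3 ad1 ad2 admissible rat_rec U1 V1 sm by simp_all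
      have "rat_poly_fun (\<lambda>T. pairing \<theta> U1 V T * pole_product L1 L' T * R1 T + pairing \<theta> U V1 T * pole_product L L1' T * R2 T - pairing \<theta> U1 V1 T * pole_product L1 L1' T * (R1 T * R2 T))"
        by (rule rat_poly_fun_diff[OF rat_poly_fun_add[OF rat_poly_fun_mult[OF g(1) R(1)] rat_poly_fun_mult[OF g(2) R(2)]] rat_poly_fun_mult[OF g(3) rat_poly_fun_mult[OF R]]])
      moreover have "pairing \<theta> U V T * pole_product L L' T =
          pairing \<theta> U1 V T * pole_product L1 L' T * R1 T + pairing \<theta> U V1 T * pole_product L L1' T * R2 T - pairing \<theta> U1 V1 T * pole_product L1 L1' T * (R1 T * R2 T)"
        if "norm T < 1" for T
      proof -
        have "pairing \<theta> U V T * pole_product L L' T = ((1 - Y T) * pairing \<theta> U V T) * (R1 T * R2 T * pole_product L1 L1' T)"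
          unfolding PPs by (simp only: mult_ac)
        then show ?thesis
          unfolding key[OF that] PPs by (simp add: algebra_simps)
      qed
      ultimately show ?thesis
        using rat_poly_fun_cong by (metis (no_types, lifting))
    qed
  qed
qed

section \<open>Facet normals generate the normal cones\<close>

definition dcone :: "'a::euclidean_space set \<Rightarrow> 'a set" where
  "dcone C = {k. \<forall>w\<in>C. 0 \<le> k \<bullet> w}"

definition tight :: "'a::euclidean_space set \<Rightarrow> 'a \<Rightarrow> 'a set" where
  "tight C k = {w\<in>C. k \<bullet> w = 0}"

text \<open>Extreme rays in algebraic form: the tight constraints determine \<open>k\<close> up to a
  factor. In this form integrality of the constraints can be used to make \<open>k\<close>
  rational.\<close>

definition ext_rays :: "'a::euclidean_space set \<Rightarrow> 'a set" where
  "ext_rays C = {k\<in>dcone C. k \<noteq> 0 \<and> (\<forall>d. (\<forall>w\<in>tight C k. d \<bullet> w = 0) \<longrightarrow> (\<exists>c. d = c *\<^sub>R k))}"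

text \<open>Walk from \<open>k\<close> along \<open>d\<close> until the first constraint becomes
  tight, at the smallest ratio \<open>t\<close>. Constraints tight at \<open>k\<close> stay tight
  because \<open>d\<close> is orthogonal to them, so the set of slack ones shrinks strictly.\<close>

lemma push_to_boundary:
  assumes C: "finite C" and k: "k \<in> dcone C" and d: "\<And>w. w \<in> tight C k \<Longrightarrow> d \<bullet> w = 0"
    and w0: "w0 \<in> C" "d \<bullet> w0 < 0"
  shows "\<exists>t>0. k + t *\<^sub>R d \<in> dcone C \<and> {w\<in>C. (k + t *\<^sub>R d) \<bullet> w \<noteq> 0} \<subset> {w\<in>C. k \<bullet> w \<noteq> 0}"
proof -
  define N where "N = {w\<in>C. d \<bullet> w < 0}"
  define r where "r = (\<lambda>w. (k \<bullet> w) / (- (d \<bullet> w)))"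
  define t where "t = Min (r ` N)"
  have N: "finite N" "N \<noteq> {}"
    using C w0 by (auto simp: N_def)
  have kpos: "0 < k \<bullet> w" if "w \<in> N" for w
  proof -
    have "k \<bullet> w \<noteq> 0"
      using that d[of w] by (auto simp: N_def tight_def)
    then show ?thesis
      using k that by (fastforce simp: dcone_def N_def)
  qed
  have rpos: "0 < r w" if "w \<in> N" for w
    using kpos[OF that] that by (auto simp: r_def N_def divide_pos_neg)
  have "t \<in> r ` N"
    unfolding t_def using N by (intro Min_in) auto
  then obtain w1 where w1: "w1 \<in> N" "t = r w1" by blast
  have tpos: "0 < t"
    using w1 rpos by simp
  have ge: "0 \<le> (k + t *\<^sub>R d) \<bullet> w" if w: "w \<in> C" for w
  proof (cases "d \<bullet> w < 0")
    case True
    then have "t \<le> r w"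
      unfolding t_def using N w by (intro Min_le) (auto simp: N_def)
    then show ?thesis
      using True by (simp add: r_def inner_add_left pos_le_divide_eq field_simps)
  next
    case False
    then show ?thesis
      using k w tpos by (simp add: dcone_def inner_add_left)
  qed
  have z: "(k + t *\<^sub>R d) \<bullet> w1 = 0"
    using w1 by (auto simp: r_def N_def inner_add_left inner_diff_left)
  have "{w\<in>C. (k + t *\<^sub>R d) \<bullet> w \<noteq> 0} \<subseteq> {w\<in>C. k \<bullet> w \<noteq> 0}"
    using d by (auto simp: tight_def inner_add_left)
  moreover have "w1 \<in> {w\<in>C. k \<bullet> w \<noteq> 0}" "w1 \<notin> {w\<in>C. (k + t *\<^sub>R d) \<bullet> w \<noteq> 0}"
    using w1 z kpos by (force simp: N_def)+
  ultimately show ?thesis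
    using tpos ge by (intro exI[of _ t]) (auto simp: dcone_def)
qed

text \<open>Generation of a pointed cone by its extreme rays, proved by induction on the number of
  slack constraints: a non-extreme \<open>k\<close> is a convex combination of the boundary points
  reached along \<open>d\<close> and \<open>- d\<close>.\<close>

lemma dcone_induct:
  assumes C: "finite C" and e: "\<And>k. k \<in> dcone C \<Longrightarrow> k \<noteq> 0 \<Longrightarrow> 0 < e \<bullet> k"
    and Q0: "Q 0" and Qadd: "\<And>x y. Q x \<Longrightarrow> Q y \<Longrightarrow> Q (x + y)" and Qext: "\<And>x. x \<in> ext_rays C \<Longrightarrow> Q x"
    and "k \<in> dcone C"
  shows "Q k"
  using \<open>k \<in> dcone C\<close>
proof (induction "card {w\<in>C. k \<bullet> w \<noteq> 0}" arbitrary: k rule: less_induct)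
  case less
  show ?case
  proof (cases "k = 0 \<or> k \<in> ext_rays C")
    case True
    then show ?thesis using Q0 Qext by blast
  next
    case False
    then obtain d0 where d0: "\<forall>w\<in>tight C k. d0 \<bullet> w = 0" "\<And>c. d0 \<noteq> c *\<^sub>R k"
      using less.prems unfolding ext_rays_def by blast
    have ek: "0 < e \<bullet> k"
      using e less.prems False by blast
    \<comment> \<open>The correction by a multiple of \<open>k\<close> achieves
      \<open>e \<bullet> d = 0\<close>. As \<open>e\<close> is positive on nonzero vectors of the
      cone, neither \<open>d\<close> nor \<open>- d\<close> lies in the cone, so both walks hit the
      boundary.\<close>
    define d where "d = d0 - (e \<bullet> d0 / (e \<bullet> k)) *\<^sub>R k"
    have d: "d \<bullet> w = 0" if "w \<in> tight C k" for w
      using that d0 by (simp add: d_def inner_diff_left tight_def)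
    have ed: "e \<bullet> d = 0"
      using ek by (simp add: d_def inner_diff_right)
    have dnz: "d \<noteq> 0"
      using d0(2)[of "e \<bullet> d0 / (e \<bullet> k)"] by (simp add: d_def)
    have "d \<notin> dcone C" "- d \<notin> dcone C"
      using e[of d] e[of "- d"] ed dnz by auto
    then obtain w1 w2 where w1: "w1 \<in> C" "d \<bullet> w1 < 0" and w2: "w2 \<in> C" "(- d) \<bullet> w2 < 0"
      unfolding dcone_def by (auto simp: not_le)
    obtain t1 where t1: "0 < t1" "k + t1 *\<^sub>R d \<in> dcone C"
      "{w\<in>C. (k + t1 *\<^sub>R d) \<bullet> w \<noteq> 0} \<subset> {w\<in>C. k \<bullet> w \<noteq> 0}"
      using push_to_boundary[OF C less.prems d w1] by blast
    have d': "(- d) \<bullet> w = 0" if "w \<in> tight C k" for w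
      using d[OF that] by simp
    obtain t2 where t2: "0 < t2" "k + t2 *\<^sub>R (- d) \<in> dcone C"
      "{w\<in>C. (k + t2 *\<^sub>R (- d)) \<bullet> w \<noteq> 0} \<subset> {w\<in>C. k \<bullet> w \<noteq> 0}"
      using push_to_boundary[OF C less.prems d' w2] by blast
    have scale: "Q (s *\<^sub>R x)" if s: "0 < s" and x: "x \<in> dcone C" "{w\<in>C. x \<bullet> w \<noteq> 0} \<subset> {w\<in>C. k \<bullet> w \<noteq> 0}" for s x
    proof (rule less.hyps)
      have "{w\<in>C. (s *\<^sub>R x) \<bullet> w \<noteq> 0} = {w\<in>C. x \<bullet> w \<noteq> 0}"
        using s by auto
      then show "card {w\<in>C. (s *\<^sub>R x) \<bullet> w \<noteq> 0} < card {w\<in>C. k \<bullet> w \<noteq> 0}"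
        using x(2) C by (simp add: psubset_card_mono)
      show "s *\<^sub>R x \<in> dcone C"
        using x(1) s by (simp add: dcone_def)
    qed
    have "Q ((t2 / (t1 + t2)) *\<^sub>R (k + t1 *\<^sub>R d) + (t1 / (t1 + t2)) *\<^sub>R (k + t2 *\<^sub>R (- d)))"
      using t1 t2 by (intro Qadd scale) auto
    moreover have "(t2 / (t1 + t2)) *\<^sub>R (k + t1 *\<^sub>R d) + (t1 / (t1 + t2)) *\<^sub>R (k + t2 *\<^sub>R (- d)) = k"
    proof -
      have "(t2 / (t1 + t2)) *\<^sub>R (k + t1 *\<^sub>R d) + (t1 / (t1 + t2)) *\<^sub>R (k + t2 *\<^sub>R (- d)) =
          (t2 / (t1 + t2) + t1 / (t1 + t2)) *\<^sub>R k + (t2 / (t1 + t2) * t1 - t1 / (t1 + t2) * t2) *\<^sub>R d"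
        by (simp add: algebra_simps)
      also have "\<dots> = k"
        using t1 t2 by (simp add: add_divide_distrib[symmetric] add.commute)
      finally show ?thesis .
    qed
    ultimately show ?thesis by simp
  qed
qed

text \<open>Applied to the coordinates of a real vector, such a map preserves every integral linear
  relation; it turns a real solution of an integral system into a rational one, and the
  normalization keeps it nonzero.\<close>

lemma ex_rational_functional:
  fixes x0 :: real
  assumes "x0 \<noteq> 0"
  shows "\<exists>g :: real \<Rightarrow> rat. (\<forall>x y. g (x + y) = g x + g y) \<and> (\<forall>r x. g (of_rat r * x) = r * g x) \<and> g x0 = 1"
proof -
  interpret vector_space_pair "\<lambda>(r::rat) (x::real). of_rat r * x" "(*) :: rat \<Rightarrow> rat \<Rightarrow> rat"
    by unfold_locales (auto simp: algebra_simps of_rat_add of_rat_mult)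
  have "vs1.independent {x0}"
    using assms by (simp add: vs1.dependent_single)
  from linear_independent_extend[OF this, of "\<lambda>_. 1"] obtain g
    where g: "Vector_Spaces.linear (\<lambda>(r::rat) (x::real). of_rat r * x) ((*) :: rat \<Rightarrow> rat \<Rightarrow> rat) g" "g x0 = 1"
    by auto
  then show ?thesis
    using linear_add[OF g(1)] linear_scale[OF g(1)] by blast
qed

lemma Gcd_range_mult: "Gcd (range (\<lambda>i. c * f i)) = c * Gcd (range f)" for c :: nat
  using Gcd_mult[of c "range f"] by (simp add: image_image)

text \<open>Taking gcds over \<open>j\<close> in \<open>b $ i * a $ j = a $ i * b $ j\<close> gives
  \<open>b $ i = a $ i\<close>.\<close>

lemma primitive_parallel:
  fixes a b :: "nat ^ 'n"
  assumes "Gcd (range (\<lambda>i. a $ i)) = 1" "Gcd (range (\<lambda>i. b $ i)) = 1" "rvec b = c *\<^sub>R rvec a"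
  shows "a = b"
proof -
  have "real (b $ i) = c * real (a $ i)" for i
    using assms(3) by (simp add: rvec_def vec_eq_iff)
  then have "real (b $ i * a $ j) = real (a $ i * b $ j)" for i j
    by simp
  then have eq: "b $ i * a $ j = a $ i * b $ j" for i j
    using of_nat_eq_iff by blast
  have "b $ i = a $ i" for i
    using Gcd_range_mult[of "b $ i" "\<lambda>j. a $ j"] Gcd_range_mult[of "a $ i" "\<lambda>j. b $ j"] assms(1,2)
    by (simp add: eq[of i])
  then show ?thesis
    by (simp add: vec_eq_iff)
qed

lemma ex_primitive_multiple:
  fixes r :: "'n::finite \<Rightarrow> rat"
  assumes nonneg: "\<And>i. 0 \<le> r i" and nz: "r i0 \<noteq> 0"
  shows "\<exists>(a :: nat ^ 'n) t. 0 < t \<and> Gcd (range (\<lambda>i. a $ i)) = 1 \<and> (\<forall>i. real_of_rat (r i) = t * real (a $ i))"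
proof -
  define dn where "dn = (\<lambda>i. nat (snd (quotient_of (r i))))"
  define N where "N = (\<Prod>i\<in>UNIV. dn i)"
  have dn: "0 < dn i" "\<exists>p. r i * of_nat (dn i) = of_int p" for i
  proof -
    obtain p d where q: "quotient_of (r i) = (p, d)" by force
    then have "0 < d" "r i = of_int p / of_int d"
      using quotient_of_denom_pos quotient_of_div by auto
    then show "0 < dn i" "\<exists>p. r i * of_nat (dn i) = of_int p"
      using q by (auto simp: dn_def)
  qed
  have N: "0 < N"
    unfolding N_def using dn by (intro prod_pos) auto
  have "\<exists>b. r i * of_nat N = of_nat b" for i
  proof -
    obtain p where p: "r i * of_nat (dn i) = of_int p" using dn by blast
    have "N = dn i * (\<Prod>j\<in>UNIV - {i}. dn j)"
      by (simp add: N_def prod.remove[of UNIV i])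
    then have eq: "r i * of_nat N = of_int (p * int (\<Prod>j\<in>UNIV - {i}. dn j))"
      using p by (simp add: mult.assoc[symmetric])
    have "0 \<le> r i * of_nat N"
      using nonneg by simp
    then have "0 \<le> p * int (\<Prod>j\<in>UNIV - {i}. dn j)"
      unfolding eq by (simp only: of_int_0_le_iff)
    then show ?thesis
      unfolding eq by (metis of_int_of_nat_eq nonneg_int_cases)
  qed
  then obtain b where b: "\<And>i. r i * of_nat N = of_nat (b i)" by metis
  define G where "G = Gcd (range b)"
  have "b i0 \<noteq> 0"
    using b[of i0] nz N by (metis of_nat_0 mult_eq_0_iff of_nat_eq_0_iff less_numeral_extra(3))
  then have G: "0 < G"
    unfolding G_def by (metis Gcd_0_iff bot_nat_0.not_eq_extremum rangeI singletonD subset_eq)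
  define a :: "nat ^ 'n" where "a = (\<chi> i. b i div G)"
  have ab: "b i = G * a $ i" for i
    by (simp add: a_def G_def)
  have "G = G * Gcd (range (\<lambda>i. a $ i))"
    using Gcd_range_mult[of G "\<lambda>i. a $ i"] unfolding ab[symmetric] by (simp add: G_def)
  then have 1: "Gcd (range (\<lambda>i. a $ i)) = 1"
    using G by simp
  have "real_of_rat (r i) = (real G / real N) * real (a $ i)" for i
  proof -
    have "r i = of_nat (b i) / of_nat N"
      using b[of i] N by (simp add: field_simps)
    then have "real_of_rat (r i) = real (b i) / real N"
      by (simp add: of_rat_divide)
    then show ?thesis
      by (simp add: ab)
  qed
  then show ?thesis
    using 1 G N by (intro exI[of _ a] exI[of _ "real G / real N"]) auto
qed

text \<open>Constraints of the normal cone at \<open>\<omega>\<close>: the dual cone consists of the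
  nonnegative weights that are minimal over \<open>S\<close> at \<open>\<omega>\<close>. The unit
  vectors stand for the recession directions of the polyhedron.\<close>

definition ncons :: "(nat ^ 'n) set \<Rightarrow> nat ^ 'n \<Rightarrow> (real ^ 'n) set" where
  "ncons S \<omega> = (\<lambda>\<omega>'. rvec \<omega>' - rvec \<omega>) ` S \<union> range (\<lambda>i. axis i 1)"

lemma finite_ncons: "finite S \<Longrightarrow> finite (ncons S \<omega>)"
  by (simp add: ncons_def)

lemma ncons_integral: "w \<in> ncons S \<omega> \<Longrightarrow> \<exists>z. \<forall>i. w $ i = real_of_int (z i)"
  unfolding ncons_def
proof (elim UnE imageE)
  fix \<omega>' assume "w = rvec \<omega>' - rvec \<omega>"
  then show ?thesis
    by (intro exI[of _ "\<lambda>i. int (\<omega>' $ i) - int (\<omega> $ i)"]) (simp add: rvec_def)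
next
  fix j assume "w = axis j 1"
  then show ?thesis
    by (intro exI[of _ "\<lambda>i. if i = j then 1 else 0"]) (simp add: axis_def)
qed

lemma dcone_ncons_nonneg: "k \<in> dcone (ncons S \<omega>) \<Longrightarrow> 0 \<le> k $ i"
  by (simp add: dcone_def ncons_def ball_Un inner_axis)

lemma rvec_in_dcone:
  assumes "finite S" "\<omega> \<in> S"
  shows "rvec a \<in> dcone (ncons S \<omega>) \<longleftrightarrow> dot a \<omega> = mn S a"
proof -
  have "rvec a \<in> dcone (ncons S \<omega>) \<longleftrightarrow> (\<forall>\<omega>'\<in>S. dot a \<omega> \<le> dot a \<omega>')"
  proof -
    have "0 \<le> rvec a $ i" for i
      by (simp add: rvec_def)
    then show ?thesis
      by (simp add: dcone_def ncons_def ball_Un inner_axis inner_diff_right rvec_inner)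
  qed
  also have "\<dots> \<longleftrightarrow> dot a \<omega> = mn S a"
    using mn_le[OF assms(1)] mn_eqI[OF assms refl] by metis
  finally show ?thesis .
qed

lemma ncons_pointed:
  assumes "k \<in> dcone (ncons S \<omega>)" "k \<noteq> 0"
  shows "0 < (\<chi> i. 1) \<bullet> k"
proof -
  obtain i where "k $ i \<noteq> 0"
    using assms(2) by (auto simp: vec_eq_iff)
  then have "0 < (\<Sum>i\<in>UNIV. k $ i)"
    using dcone_ncons_nonneg[OF assms(1)] by (intro sum_pos2[of _ i]) (auto simp: less_le)
  then show ?thesis
    by (simp add: inner_vec_def)
qed

text \<open>The constraints are integral, so the image of \<open>k\<close> under
  \<open>ex_rational_functional\<close> satisfies the same tight equations and is proportional to
  \<open>k\<close> by extremality; clearing denominators and the gcd leaves a primitive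
  vector.\<close>

lemma ext_ray_primitive:
  assumes k: "k \<in> ext_rays (ncons S \<omega>)"
  shows "\<exists>a t. 0 < t \<and> k = t *\<^sub>R rvec a \<and> Gcd (range (\<lambda>i. a $ i)) = 1 \<and> rvec a \<in> ext_rays (ncons S \<omega>)"
proof -
  define C where "C = ncons S \<omega>"
  have kC: "k \<in> dcone C" "k \<noteq> 0" and kext: "\<And>d. (\<And>w. w \<in> tight C k \<Longrightarrow> d \<bullet> w = 0) \<Longrightarrow> \<exists>c. d = c *\<^sub>R k"
    using k by (auto simp: ext_rays_def C_def)
  obtain i0 where i0: "k $ i0 \<noteq> 0"
    using kC(2) by (auto simp: vec_eq_iff)
  have kn: "0 \<le> k $ i" for i
    using dcone_ncons_nonneg kC(1) by (auto simp: C_def)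
  obtain g :: "real \<Rightarrow> rat" where g: "\<And>x y. g (x + y) = g x + g y" "\<And>r x. g (of_rat r * x) = r * g x" "g (k $ i0) = 1"
    using ex_rational_functional[OF i0] by blast
  have g0: "g 0 = 0"
    using g(1)[of 0 0] by simp
  have gsum: "g (\<Sum>i\<in>I. f i) = (\<Sum>i\<in>I. g (f i))" for f :: "'b \<Rightarrow> real" and I
    by (induction I rule: infinite_finite_induct) (auto simp: g g0)
  define d where "d = (\<chi> i. real_of_rat (g (k $ i)))"
  have "d \<bullet> w = 0" if w: "w \<in> tight C k" for w
  proof -
    obtain z where z: "\<And>i. w $ i = real_of_int (z i)"
      using ncons_integral[of w S \<omega>] w by (auto simp: tight_def C_def)
    have "(\<Sum>i\<in>UNIV. k $ i * w $ i) = 0"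
      using w by (simp add: tight_def inner_vec_def)
    then have "(\<Sum>i\<in>UNIV. g (k $ i * w $ i)) = 0"
      using gsum[of "\<lambda>i. k $ i * w $ i" UNIV] g0 by simp
    moreover have "g (k $ i * w $ i) = of_int (z i) * g (k $ i)" for i
      using g(2)[of "of_int (z i)" "k $ i"] by (simp add: z mult.commute)
    ultimately have "(\<Sum>i\<in>UNIV. of_int (z i) * g (k $ i)) = 0"
      by simp
    then have "real_of_rat (\<Sum>i\<in>UNIV. of_int (z i) * g (k $ i)) = 0"
      by simp
    then show ?thesis
      by (simp add: d_def inner_vec_def of_rat_sum of_rat_mult z mult.commute)
  qed
  then obtain c where c: "d = c *\<^sub>R k"
    using kext by blast
  have dc: "real_of_rat (g (k $ i)) = c * k $ i" for i
    using c by (simp add: d_def vec_eq_iff)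
  have "c * k $ i0 = 1"
    using dc[of i0] g(3) by simp
  then have cpos: "0 < c"
    using kn[of i0] by (metis mult_nonpos_nonneg not_le not_one_le_zero)
  have "0 \<le> g (k $ i)" for i
    using dc[of i] kn[of i] cpos by (metis zero_le_mult_iff less_imp_le zero_le_of_rat_iff)
  moreover have "g (k $ i0) \<noteq> 0"
    using g(3) by simp
  ultimately obtain a :: "nat ^ 'a" and t where a: "0 < t" "Gcd (range (\<lambda>i. a $ i)) = 1"
    "\<And>i. real_of_rat (g (k $ i)) = t * real (a $ i)"
    using ex_primitive_multiple[of "\<lambda>i. g (k $ i)" i0] by blast
  have ka: "k = (t / c) *\<^sub>R rvec a"
    using a(3) dc cpos by (simp add: vec_eq_iff rvec_def field_simps)
  have tc: "0 < t / c"
    using a(1) cpos by simp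
  have "tight C (rvec a) = tight C k"
    unfolding ka using tc by (auto simp: tight_def)
  moreover have "rvec a \<in> dcone C"
    using kC(1) tc a(1) cpos unfolding ka dcone_def by (auto simp: zero_le_mult_iff zero_le_divide_iff)
  moreover have "rvec a \<noteq> 0"
    using kC(2) ka by auto
  moreover have "\<exists>c'. x *\<^sub>R k = c' *\<^sub>R rvec a" for x
    using ka by (intro exI[of _ "x * (t / c)"]) simp
  ultimately have "rvec a \<in> ext_rays C"
    unfolding ext_rays_def using kext by (simp, metis)
  then show ?thesis
    using ka tc a(2) unfolding C_def by blast
qed

definition prim_rays :: "(nat ^ 'n) set \<Rightarrow> nat ^ 'n \<Rightarrow> (nat ^ 'n) set" where
  "prim_rays S \<omega> = {a. Gcd (range (\<lambda>i. a $ i)) = 1 \<and> rvec a \<in> ext_rays (ncons S \<omega>)}"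

text \<open>A primitive extreme ray is determined by its tight set, one of finitely many subsets of
  the constraints.\<close>

lemma finite_prim_rays:
  assumes "finite S"
  shows "finite (prim_rays S \<omega>)"
proof (rule inj_on_finite[of "\<lambda>a. tight (ncons S \<omega>) (rvec a)"])
  show "inj_on (\<lambda>a. tight (ncons S \<omega>) (rvec a)) (prim_rays S \<omega>)"
  proof (rule inj_onI)
    fix a b assume ab: "a \<in> prim_rays S \<omega>" "b \<in> prim_rays S \<omega>"
      and eq: "tight (ncons S \<omega>) (rvec a) = tight (ncons S \<omega>) (rvec b)"
    have "\<forall>w\<in>tight (ncons S \<omega>) (rvec a). rvec b \<bullet> w = 0"
      unfolding eq by (simp add: tight_def)
    then obtain c where "rvec b = c *\<^sub>R rvec a"
      using ab(1) unfolding prim_rays_def ext_rays_def by blast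
    then show "a = b"
      using ab primitive_parallel[of a b c] by (auto simp: prim_rays_def)
  qed
  show "(\<lambda>a. tight (ncons S \<omega>) (rvec a)) ` prim_rays S \<omega> \<subseteq> Pow (ncons S \<omega>)"
    by (auto simp: tight_def)
  show "finite (Pow (ncons S \<omega>))"
    using finite_ncons[OF assms] by simp
qed

lemma dcone_generated:
  assumes S: "finite S" and k: "k \<in> dcone (ncons S \<omega>)"
  shows "\<exists>t. (\<forall>a. 0 \<le> t a) \<and> k = (\<Sum>a\<in>prim_rays S \<omega>. t a *\<^sub>R rvec a)"
  using finite_ncons[OF S] ncons_pointed _ _ _ k
proof (rule dcone_induct)
  show "\<exists>t. (\<forall>a. 0 \<le> t a) \<and> (0 :: real ^ 'a) = (\<Sum>a\<in>prim_rays S \<omega>. t a *\<^sub>R rvec a)"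
    by (intro exI[of _ "\<lambda>_. 0"]) simp
next
  fix x y :: "real ^ 'a"
  assume "\<exists>t. (\<forall>a. 0 \<le> t a) \<and> x = (\<Sum>a\<in>prim_rays S \<omega>. t a *\<^sub>R rvec a)"
    "\<exists>t. (\<forall>a. 0 \<le> t a) \<and> y = (\<Sum>a\<in>prim_rays S \<omega>. t a *\<^sub>R rvec a)"
  then obtain t u where "\<forall>a. 0 \<le> t a" "x = (\<Sum>a\<in>prim_rays S \<omega>. t a *\<^sub>R rvec a)"
    "\<forall>a. 0 \<le> u a" "y = (\<Sum>a\<in>prim_rays S \<omega>. u a *\<^sub>R rvec a)" by blast
  then show "\<exists>t. (\<forall>a. 0 \<le> t a) \<and> x + y = (\<Sum>a\<in>prim_rays S \<omega>. t a *\<^sub>R rvec a)"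
    by (intro exI[of _ "\<lambda>a. t a + u a"]) (simp add: scaleR_add_left sum.distrib)
next
  fix x assume "x \<in> ext_rays (ncons S \<omega>)"
  then obtain b t where b: "0 < t" "x = t *\<^sub>R rvec b" "b \<in> prim_rays S \<omega>"
    using ext_ray_primitive unfolding prim_rays_def by blast
  have "(\<Sum>a\<in>prim_rays S \<omega>. (if a = b then t else 0) *\<^sub>R rvec a) = (\<Sum>a\<in>prim_rays S \<omega>. if a = b then t *\<^sub>R rvec a else 0)"
    by (rule sum.cong) auto
  also have "\<dots> = x"
    using b finite_prim_rays[OF S] by (simp add: sum.delta)
  finally show "\<exists>t. (\<forall>a. 0 \<le> t a) \<and> x = (\<Sum>a\<in>prim_rays S \<omega>. t a *\<^sub>R rvec a)"
    using b(1) by (intro exI[of _ "\<lambda>a. if a = b then t else 0"]) auto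
qed

section \<open>Extreme rays versus facet normals\<close>

lemma orthogonal_complement_line:
  fixes V :: "'a::euclidean_space set"
  assumes dim: "dim V = DIM('a) - 1" and a: "a \<noteq> 0" "\<And>x. x \<in> V \<Longrightarrow> a \<bullet> x = 0" and c: "\<And>x. x \<in> V \<Longrightarrow> c \<bullet> x = 0"
  shows "\<exists>t. c = t *\<^sub>R a"
proof -
  define Y where "Y = {y. \<forall>x\<in>span V. orthogonal x y}"
  have "dim {y \<in> UNIV. \<forall>x\<in>span V. orthogonal x y} + dim (span V) = dim (UNIV :: 'a set)"
    by (rule dim_subspace_orthogonal_to_vectors) auto
  then have "dim Y + (DIM('a) - 1) = DIM('a)"
    using dim by (simp add: Y_def)
  moreover have "0 < DIM('a)"
    by (rule DIM_positive)
  ultimately have dimY: "dim Y = 1"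
    by linarith
  have mem: "z \<in> Y" if "\<And>x. x \<in> V \<Longrightarrow> z \<bullet> x = 0" for z
  proof -
    have "orthogonal z x" if "x \<in> span V" for x
      by (rule orthogonal_to_span[OF that]) (use \<open>\<And>x. x \<in> V \<Longrightarrow> z \<bullet> x = 0\<close> in \<open>simp add: orthogonal_def\<close>)
    then show ?thesis
      by (auto simp: Y_def orthogonal_commute)
  qed
  have "c \<in> span {a}"
  proof (rule ccontr)
    assume "c \<notin> span {a}"
    then have "independent {c, a}"
      using a(1) by (simp add: independent_insert)
    moreover have "c \<noteq> a"
      using \<open>c \<notin> span {a}\<close> span_base by blast
    moreover have "{c, a} \<subseteq> Y"
      using mem a c by auto
    ultimately have "2 \<le> dim Y"
      using independent_card_le_dim[of "{c, a}" Y] by simp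
    then show False using dimY by simp
  qed
  then show ?thesis
    by (auto simp: span_singleton)
qed

lemma dim_orthogonal_to_line:
  fixes W :: "'a::euclidean_space set"
  assumes k: "k \<noteq> 0" "\<And>w. w \<in> W \<Longrightarrow> k \<bullet> w = 0" and un: "\<And>d. (\<And>w. w \<in> W \<Longrightarrow> d \<bullet> w = 0) \<Longrightarrow> \<exists>c. d = c *\<^sub>R k"
  shows "dim W = DIM('a) - 1"
proof -
  have "{y \<in> UNIV. \<forall>x\<in>span W. orthogonal x y} = span {k}"
  proof (intro equalityI subsetI)
    fix y assume "y \<in> {y \<in> UNIV. \<forall>x\<in>span W. orthogonal x y}"
    then have "y \<bullet> w = 0" if "w \<in> W" for w
      using that span_base by (auto simp: orthogonal_def inner_commute)
    then obtain c where "y = c *\<^sub>R k"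
      using un by blast
    then show "y \<in> span {k}"
      by (auto simp: span_singleton)
  next
    fix y assume "y \<in> span {k}"
    then obtain c where y: "y = c *\<^sub>R k" by (auto simp: span_singleton)
    have "orthogonal y x" if "x \<in> span W" for x
      by (rule orthogonal_to_span[OF that]) (simp add: orthogonal_def y k(2))
    then show "y \<in> {y \<in> UNIV. \<forall>x\<in>span W. orthogonal x y}"
      by (auto simp: orthogonal_commute)
  qed
  moreover have "dim {y \<in> UNIV. \<forall>x\<in>span W. orthogonal x y} + dim (span W) = dim (UNIV :: 'a set)"
    by (rule dim_subspace_orthogonal_to_vectors) auto
  moreover have "dim (span {k}) = 1"
    using k(1) by (simp add: dim_singleton)
  ultimately show ?thesis
    by (simp add: dim_UNIV)
qed

lemma aff_dim_newton_poly:
  fixes A :: "nat ^ 'n \<Rightarrow> 'k::zero"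
  assumes "\<omega> \<in> supp A"
  shows "aff_dim (newton_poly A) = int CARD('n)"
proof -
  have p: "rvec \<omega> \<in> affine hull newton_poly A"
    using rvec_in_newton_poly[OF assms] by (rule hull_inc)
  have "axis i 1 \<in> (\<lambda>x. x - rvec \<omega>) ` newton_poly A" for i
    by (rule image_eqI[of _ _ "rvec \<omega> + axis i 1"]) (use assms in \<open>auto intro!: newton_poly_contains simp: axis_def\<close>)
  then have "(Basis :: (real ^ 'n) set) \<subseteq> (\<lambda>x. x - rvec \<omega>) ` newton_poly A"
    by (auto simp: Basis_vec_def)
  then have "DIM(real ^ 'n) \<le> dim ((\<lambda>x. x - rvec \<omega>) ` newton_poly A)"
    using dim_subset[of Basis] by (metis dim_UNIV dim_span span_Basis)
  then have "int CARD('n) \<le> aff_dim (newton_poly A)"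
    unfolding aff_dim_eq_dim_subtract[OF p] by simp
  then show ?thesis
    using aff_dim_le_DIM[of "newton_poly A"] by simp
qed

text \<open>The tight constraints of an extreme ray span a hyperplane. Translated by
  \<open>\<omega>\<close> they lie in the face selected by \<open>a\<close>, which therefore has
  codimension one.\<close>

lemma prim_rays_subset_facet_normals:
  fixes A :: "nat ^ 'n \<Rightarrow> 'k::zero"
  assumes fin: "finite (supp A)" and w: "\<omega> \<in> supp A" and a: "a \<in> prim_rays (supp A) \<omega>"
  shows "a \<in> facet_normals A" "dot a \<omega> = mn (supp A) a"
proof -
  define C where "C = ncons (supp A) \<omega>"
  define W where "W = tight C (rvec a)"
  define F where "F = newton_poly A \<inter> {x. rvec a \<bullet> x = real (mn (supp A) a)}"
  have prim: "Gcd (range (\<lambda>i. a $ i)) = 1" and ext: "rvec a \<in> ext_rays C"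
    using a by (auto simp: prim_rays_def C_def)
  have anz: "rvec a \<noteq> 0" and acone: "rvec a \<in> dcone C"
    using ext by (auto simp: ext_rays_def)
  show dot: "dot a \<omega> = mn (supp A) a"
    using acone rvec_in_dcone[OF fin w] by (simp add: C_def)
  have dimW: "dim W = DIM(real ^ 'n) - 1"
    by (rule dim_orthogonal_to_line[OF anz]) (use ext in \<open>auto simp: ext_rays_def W_def tight_def\<close>)
  have wF: "rvec \<omega> \<in> F"
    using rvec_in_newton_poly[OF w] dot by (simp add: F_def rvec_inner)
  have WF: "rvec \<omega> + x \<in> F" if x: "x \<in> W" for x
  proof -
    have "rvec \<omega> + x \<in> newton_poly A"
      using x unfolding W_def tight_def C_def ncons_def
      by (auto intro: rvec_in_newton_poly newton_poly_contains[OF w] simp: axis_def)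
    moreover have "rvec a \<bullet> (rvec \<omega> + x) = real (mn (supp A) a)"
      using x dot by (simp add: W_def tight_def inner_add_right rvec_inner)
    ultimately show ?thesis by (simp add: F_def)
  qed
  have "W \<subseteq> (\<lambda>x. x - rvec \<omega>) ` F"
  proof
    fix x assume "x \<in> W"
    then show "x \<in> (\<lambda>x. x - rvec \<omega>) ` F"
      using WF by (intro image_eqI[of _ _ "rvec \<omega> + x"]) auto
  qed
  then have "DIM(real ^ 'n) - 1 \<le> dim ((\<lambda>x. x - rvec \<omega>) ` F)"
    using dim_subset dimW by metis
  moreover have "aff_dim F = int (dim ((\<lambda>x. x - rvec \<omega>) ` F))"
    by (rule aff_dim_eq_dim_subtract) (use wF in \<open>auto intro: hull_inc\<close>)
  ultimately have "int CARD('n) - 1 \<le> aff_dim F"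
    by simp
  moreover have "aff_dim F \<le> aff_dim {x. rvec a \<bullet> x = real (mn (supp A) a)}"
    by (rule aff_dim_subset) (auto simp: F_def)
  moreover have "aff_dim {x. rvec a \<bullet> x = real (mn (supp A) a)} = int CARD('n) - 1"
    using anz by (simp add: aff_dim_hyperplane)
  ultimately have "aff_dim F = aff_dim (newton_poly A) - 1"
    using aff_dim_newton_poly[OF w] by simp
  moreover have "F face_of newton_poly A"
    unfolding F_def
    by (rule face_of_Int_supporting_hyperplane_ge[OF convex_newton_poly newton_poly_ge_mn[OF fin]])
  ultimately have "F facet_of newton_poly A"
    using wF by (auto simp: facet_of_def)
  moreover have "\<forall>x\<in>F. \<forall>y\<in>F. rvec a \<bullet> (x - y) = 0"
    by (auto simp: F_def inner_diff_right)
  moreover have "a \<noteq> 0"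
    using anz by (auto simp: rvec_def vec_eq_iff)
  ultimately show "a \<in> facet_normals A"
    using prim unfolding facet_normals_def by blast
qed

text \<open>Yields finiteness of the facet normals. Being perpendicular to a facet says nothing
  about signs, so \<open>a\<close> is first shown to be minimal on the facet. Expand
  \<open>a\<close> in rays of the normal cone at a minimizer \<open>\<omega>\<close>: a ray with
  positive coefficient is constant on the facet, hence parallel to \<open>a\<close>, hence equal to
  it.\<close>

lemma facet_normals_subset_prim_rays:
  fixes A :: "nat ^ 'n \<Rightarrow> 'k::zero"
  assumes fin: "finite (supp A)" and ne: "supp A \<noteq> {}" and a: "a \<in> facet_normals A"
  shows "a \<in> (\<Union>\<omega>\<in>supp A. prim_rays (supp A) \<omega>)"
proof -
  define \<Gamma> where "\<Gamma> = newton_poly A"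
  obtain F where anz: "a \<noteq> 0" and prim: "Gcd (range (\<lambda>i. a $ i)) = 1" and F: "F facet_of \<Gamma>"
    and perp: "\<And>x y. x \<in> F \<Longrightarrow> y \<in> F \<Longrightarrow> rvec a \<bullet> (x - y) = 0"
    using a unfolding facet_normals_def \<Gamma>_def by blast
  have ranz: "rvec a \<noteq> 0"
    using anz by (auto simp: rvec_def vec_eq_iff)
  have face: "F face_of \<Gamma>" "F \<noteq> {}" and adF: "aff_dim F = aff_dim \<Gamma> - 1"
    using F by (auto simp: facet_of_def)
  have cvx: "convex \<Gamma>" "convex F"
    using convex_newton_poly face_of_imp_convex[OF face(1)] by (auto simp: \<Gamma>_def)
  obtain \<omega> where w: "\<omega> \<in> supp A" "dot a \<omega> = mn (supp A) a"
    using mn_attained[OF fin ne] by blast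
  \<comment> \<open>A supporting hyperplane at a relative interior point of \<open>F\<close>
    contains all of \<open>F\<close>.\<close>
  obtain p where p: "p \<in> rel_interior F"
    using rel_interior_eq_empty[OF cvx(2)] face(2) by blast
  have pF: "p \<in> F"
    using p rel_interior_subset by blast
  have par: "\<exists>t. c = t *\<^sub>R rvec a" if c: "\<And>x. x \<in> F \<Longrightarrow> c \<bullet> (x - p) = 0" for c
  proof (rule orthogonal_complement_line)
    have "aff_dim F = int (dim ((\<lambda>x. x - p) ` F))"
      by (rule aff_dim_eq_dim_subtract) (use pF in \<open>auto intro: hull_inc\<close>)
    then show "dim ((\<lambda>x. x - p) ` F) = DIM(real ^ 'n) - 1"
      using adF aff_dim_newton_poly[OF w(1)] by (simp add: \<Gamma>_def)
  qed (use ranz perp pF c in auto)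
  have "F \<noteq> \<Gamma>"
    using adF by auto
  then have "p \<in> \<Gamma>" "p \<notin> rel_interior \<Gamma>"
    using pF face_of_imp_subset[OF face(1)] face_of_disjoint_rel_interior[OF face(1)] by auto
  then obtain c where c: "c \<noteq> 0" "\<And>y. y \<in> \<Gamma> \<Longrightarrow> c \<bullet> p \<le> c \<bullet> y"
    using supporting_hyperplane_rel_boundary[OF cvx(1)] by metis
  have "\<Gamma> \<inter> {x. c \<bullet> x = c \<bullet> p} face_of \<Gamma>"
    by (rule face_of_Int_supporting_hyperplane_ge[OF cvx(1)]) (rule c(2))
  then have "F \<subseteq> \<Gamma> \<inter> {x. c \<bullet> x = c \<bullet> p}"
    by (rule subset_of_face_of) (use face_of_imp_subset[OF face(1)] p \<open>p \<in> \<Gamma>\<close> in auto)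
  then obtain t where t: "c = t *\<^sub>R rvec a"
    using par[of c] by (auto simp: inner_diff_right)
  have tpos: "0 < t"
  proof -
    obtain i where i: "0 < a $ i"
      using anz by (auto simp: vec_eq_iff)
    have "0 \<le> c $ i"
    proof (rule ccontr)
      assume neg: "\<not> 0 \<le> c $ i"
      \<comment> \<open>A negative coordinate of \<open>c\<close> would let \<open>c\<close> drop by
        \<open>s\<close> along the recession direction \<open>axis i\<close>, below its minimum at
        \<open>p\<close>.\<close>
      define s where "s = \<bar>c \<bullet> p - c \<bullet> rvec \<omega>\<bar> + 1"
      have "rvec \<omega> + axis i (s / (- c $ i)) \<in> \<Gamma>"
        unfolding \<Gamma>_def using neg
        by (intro newton_poly_contains[OF w(1)]) (auto simp: axis_def s_def divide_nonneg_neg divide_nonpos_pos)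
      then have "c \<bullet> p \<le> c \<bullet> (rvec \<omega> + axis i (s / (- c $ i)))"
        by (rule c(2))
      also have "\<dots> = c \<bullet> rvec \<omega> - s"
        using neg by (simp add: inner_add_right inner_axis)
      finally show False
        by (simp add: s_def abs_if split: if_splits)
    qed
    moreover have "c $ i = t * real (a $ i)"
      by (simp add: t rvec_def)
    ultimately have "0 \<le> t"
      using i by (simp add: zero_le_mult_iff)
    moreover have "t \<noteq> 0"
      using c(1) t by auto
    ultimately show ?thesis by simp
  qed
  have "rvec a \<bullet> p \<le> rvec a \<bullet> rvec \<omega>"
    using c(2)[of "rvec \<omega>"] rvec_in_newton_poly[OF w(1)] tpos by (simp add: t \<Gamma>_def)
  then have ap: "rvec a \<bullet> p = real (mn (supp A) a)"
    using newton_poly_ge_mn[OF fin, of p a] \<open>p \<in> \<Gamma>\<close> w(2) by (simp add: rvec_inner \<Gamma>_def)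
  have af: "rvec a \<bullet> x = real (mn (supp A) a)" if "x \<in> F" for x
    using perp[OF that pF] ap by (simp add: inner_diff_right)
  have "rvec a \<in> dcone (ncons (supp A) \<omega>)"
    using rvec_in_dcone[OF fin w(1)] w(2) by simp
  from dcone_generated[OF fin this] obtain u where u: "\<And>b. 0 \<le> u b"
    and au: "rvec a = (\<Sum>b\<in>prim_rays (supp A) \<omega>. u b *\<^sub>R rvec b)" by blast
  have "\<exists>b\<in>prim_rays (supp A) \<omega>. u b \<noteq> 0"
    using au ranz by (metis (no_types, lifting) scaleR_eq_0_iff sum.neutral)
  then obtain b where b: "b \<in> prim_rays (supp A) \<omega>" "u b \<noteq> 0" by blast
  note b_facet = prim_rays_subset_facet_normals[OF fin w(1)]
  have bx: "rvec b \<bullet> x = real (mn (supp A) b)" if x: "x \<in> F" for x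
  proof -
    have x\<Gamma>: "x \<in> newton_poly A"
      using x face_of_imp_subset[OF face(1)] by (auto simp: \<Gamma>_def)
    have "(\<Sum>b\<in>prim_rays (supp A) \<omega>. u b * (rvec b \<bullet> (x - rvec \<omega>))) = rvec a \<bullet> (x - rvec \<omega>)"
      by (simp add: au inner_sum_left)
    also have "\<dots> = 0"
      using af[OF x] w(2) by (simp add: inner_diff_right rvec_inner)
    finally have "\<forall>b\<in>prim_rays (supp A) \<omega>. u b * (rvec b \<bullet> (x - rvec \<omega>)) = 0"
    proof (subst (asm) sum_nonneg_eq_0_iff)
      fix b assume "b \<in> prim_rays (supp A) \<omega>"
      then have "0 \<le> rvec b \<bullet> (x - rvec \<omega>)"
        using newton_poly_ge_mn[OF fin x\<Gamma>, of b] b_facet(2)[of b] by (simp add: inner_diff_right rvec_inner)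
      then show "0 \<le> u b * (rvec b \<bullet> (x - rvec \<omega>))"
        using u by simp
    qed (use finite_prim_rays[OF fin] in auto)
    then have "rvec b \<bullet> (x - rvec \<omega>) = 0"
      using b by auto
    then show ?thesis
      using b_facet(2)[OF b(1)] by (simp add: inner_diff_right rvec_inner)
  qed
  obtain t' where "rvec b = t' *\<^sub>R rvec a"
    using par[of "rvec b"] bx pF by (auto simp: inner_diff_right)
  then have "a = b"
    using primitive_parallel[OF prim, of b t'] b(1) by (auto simp: prim_rays_def)
  then show ?thesis
    using b(1) w(1) by blast
qed

lemma finite_facet_normals: "finite (supp A) \<Longrightarrow> supp A \<noteq> {} \<Longrightarrow> finite (facet_normals A)"
  using facet_normals_subset_prim_rays finite_prim_rays
  by (metis (no_types, lifting) finite_UN_I finite_subset subsetI)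

text \<open>Rounding the coefficients of a conical combination of facet normals down leaves a remainder in
  a bounded set.\<close>
lemma weight_decomposition:
  fixes A :: "nat ^ 'n \<Rightarrow> 'k::zero"
  assumes fin: "finite (supp A)" and w: "\<omega> \<in> supp A" "dot k \<omega> = mn (supp A) k"
  shows "\<exists>k0 n. k = k0 + (\<Sum>a\<in>facet_normals A. n a *s a) \<and> (\<forall>i. k0 $ i \<le> (\<Sum>a\<in>facet_normals A. a $ i)) \<and>
    dot k0 \<omega> = mn (supp A) k0 \<and> (\<forall>a. n a \<noteq> 0 \<longrightarrow> a \<in> facet_normals A \<and> dot a \<omega> = mn (supp A) a)"
proof -
  define D where "D = facet_normals A"
  define R where "R = prim_rays (supp A) \<omega>"
  have finD: "finite D"
    unfolding D_def using fin w by (intro finite_facet_normals) auto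
  have R: "R \<subseteq> D" "finite R" and Rdot: "\<And>a. a \<in> R \<Longrightarrow> dot a \<omega> = mn (supp A) a"
    using prim_rays_subset_facet_normals[OF fin w(1)] finite_prim_rays[OF fin] by (auto simp: R_def D_def)
  have kc: "rvec k \<in> dcone (ncons (supp A) \<omega>)"
    using rvec_in_dcone[OF fin w(1)] w(2) by simp
  obtain t where t: "\<And>a. 0 \<le> t a" "rvec k = (\<Sum>a\<in>R. t a *\<^sub>R rvec a)"
    using dcone_generated[OF fin kc] unfolding R_def by blast
  define n where "n = (\<lambda>a. if a \<in> R then nat \<lfloor>t a\<rfloor> else 0)"
  have ki: "real (k $ i) = (\<Sum>a\<in>R. t a * real (a $ i))" for i
    using arg_cong[OF t(2), of "\<lambda>x. x $ i"] by (simp add: rvec_def)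
  have nle: "real (n a) \<le> t a" "t a - real (n a) \<le> 1" if "a \<in> R" for a
    using that t(1)[of a] by (auto simp: n_def) linarith+
  have sumn: "(\<Sum>a\<in>D. n a *s a) = (\<Sum>a\<in>R. n a *s a)"
    by (rule sum.mono_neutral_right) (use finD R in \<open>auto simp: n_def vec_eq_iff\<close>)
  have le: "(\<Sum>a\<in>R. n a *s a) $ i \<le> k $ i" for i
  proof -
    have "real ((\<Sum>a\<in>R. n a *s a) $ i) \<le> real (k $ i)"
      unfolding ki using nle by (auto simp: intro!: sum_mono mult_right_mono)
    then show ?thesis by (simp only: of_nat_le_iff)
  qed
  define k0 where "k0 = k - (\<Sum>a\<in>R. n a *s a)"
  have keq: "k = k0 + (\<Sum>a\<in>R. n a *s a)"
    using le by (simp add: k0_def vec_eq_iff)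
  have k0i: "real (k0 $ i) = (\<Sum>a\<in>R. (t a - real (n a)) * real (a $ i))" for i
  proof -
    have "real (k0 $ i) = real (k $ i) - real ((\<Sum>a\<in>R. n a *s a) $ i)"
      using le[of i] by (simp add: k0_def of_nat_diff)
    then show ?thesis
      unfolding ki by (simp add: sum_subtractf left_diff_distrib)
  qed
  have bound: "k0 $ i \<le> (\<Sum>a\<in>D. a $ i)" for i
  proof -
    have "real (k0 $ i) \<le> (\<Sum>a\<in>R. 1 * real (a $ i))"
      unfolding k0i using nle by (intro sum_mono mult_right_mono) auto
    also have "\<dots> \<le> (\<Sum>a\<in>D. real (a $ i))"
      using sum_mono2[OF finD R(1), of "\<lambda>a. real (a $ i)"] by simp
    finally show ?thesis
      by (metis of_nat_le_iff of_nat_sum)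
  qed
  have "rvec k0 = (\<Sum>a\<in>R. (t a - real (n a)) *\<^sub>R rvec a)"
    using k0i by (simp add: vec_eq_iff rvec_def)
  moreover have "(\<Sum>a\<in>R. (t a - real (n a)) *\<^sub>R rvec a) \<in> dcone (ncons (supp A) \<omega>)"
    unfolding dcone_def
  proof safe
    fix x assume "x \<in> ncons (supp A) \<omega>"
    then have "0 \<le> rvec a \<bullet> x" if "a \<in> R" for a
      using that by (auto simp: R_def prim_rays_def ext_rays_def dcone_def)
    then show "0 \<le> (\<Sum>a\<in>R. (t a - real (n a)) *\<^sub>R rvec a) \<bullet> x"
      using nle by (auto simp: inner_sum_left intro!: sum_nonneg)
  qed
  ultimately have "dot k0 \<omega> = mn (supp A) k0"
    using rvec_in_dcone[OF fin w(1), of k0] by (simp only:)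
  then show ?thesis
    using keq sumn bound R Rdot unfolding D_def[symmetric]
    by (intro exI[of _ k0] exI[of _ n]) (auto simp: n_def)
qed

section \<open>Truncation of exponents\<close>

text \<open>Products of prime powers, one prime per element of \<open>X\<close>. Through unique
  factorization the order of the naturals becomes a total order on exponent vectors over
  \<open>X\<close> that is compatible with addition.\<close>

lemma ex_multiplicative_code:
  assumes "finite X"
  shows "\<exists>code :: ('x \<Rightarrow> nat) \<Rightarrow> nat. (\<forall>m m'. code m = code m' \<longrightarrow> (\<forall>x\<in>X. m x = m' x)) \<and>
    (\<forall>m m'. code (\<lambda>x. m x + m' x) = code m * code m') \<and> (\<forall>m. 0 < code m)"
proof -
  obtain f :: "nat \<Rightarrow> nat" where f: "inj f" "range f \<subseteq> {p. prime p}"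
    using infinite_countable_subset[OF primes_infinite] by blast
  define pr where "pr = (\<lambda>x. f (to_nat_on X x))"
  have inj: "inj_on pr X"
    using inj_on_to_nat_on[of X] countable_finite[OF assms] f(1)
    unfolding pr_def inj_on_def inj_def by blast
  have prime: "prime (pr x)" for x
    using f(2) by (auto simp: pr_def)
  define code where "code = (\<lambda>m. \<Prod>x\<in>X. pr x ^ m x)"
  have mult: "multiplicity (pr x) (code m) = m x" if x: "x \<in> X" for x m
  proof -
    have "code m = (\<Prod>p\<in>pr ` X. p ^ m (the_inv_into X pr p))"
      unfolding code_def prod.reindex[OF inj] by (rule prod.cong) (auto simp: the_inv_into_f_f[OF inj])
    then have "multiplicity (pr x) (code m) = (if pr x \<in> pr ` X then m (the_inv_into X pr (pr x)) else 0)"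
      using assms prime by (simp only:) (rule multiplicity_prod_prime_powers; auto)
    then show ?thesis
      using x by (simp add: the_inv_into_f_f[OF inj])
  qed
  have "code (\<lambda>x. m x + m' x) = code m * code m'" for m m'
    by (simp add: code_def power_add prod.distrib)
  moreover have "0 < code m" for m
    unfolding code_def using prime by (intro prod_pos) (auto simp: prime_gt_0_nat)
  ultimately show ?thesis
    using mult by (intro exI[of _ code]) metis
qed

text \<open>Dickson's lemma for down-closed sets.\<close>
lemma antitone_truncation:
  fixes P :: "('a \<Rightarrow> nat) \<Rightarrow> bool"
  assumes "finite D" "\<And>m n. (\<And>a. m a \<le> n a) \<Longrightarrow> P n \<Longrightarrow> P m"
  shows "\<exists>N. \<forall>n. (\<forall>a. a \<notin> D \<longrightarrow> n a = 0) \<longrightarrow> P (\<lambda>a. min (n a) N) \<longrightarrow> P n"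
  using assms
proof (induction D arbitrary: P rule: finite_induct)
  case empty
  have "(\<lambda>a. min (n a) 0) = n" if "\<forall>a. a \<notin> {} \<longrightarrow> n a = 0" for n :: "'a \<Rightarrow> nat"
    using that by auto
  then show ?case by metis
next
  case (insert b D)
  note anti = insert.prems
  have anti_i: "P (m(b := i))" if "\<And>a. m a \<le> n a" "i \<le> j" "P (n(b := j))" for m n i j
    by (rule anti[OF _ that(3)]) (use that in auto)
  have "\<exists>N. \<forall>n. (\<forall>a. a \<notin> D \<longrightarrow> n a = 0) \<longrightarrow> P ((\<lambda>a. min (n a) N)(b := i)) \<longrightarrow> P (n(b := i))" for i
    by (rule insert.IH) (use anti_i in blast)
  then obtain N where N: "\<And>i n. (\<And>a. a \<notin> D \<Longrightarrow> n a = 0) \<Longrightarrow> P ((\<lambda>a. min (n a) (N i))(b := i)) \<Longrightarrow> P (n(b := i))"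
    by metis
  \<comment> \<open>The bounds \<open>N i\<close> of the single slices may grow with
    \<open>i\<close>. Applying the hypothesis also to the intersection of all slices yields a height
    \<open>I\<close> from which on the slices no longer change.\<close>
  have "\<exists>N. \<forall>n. (\<forall>a. a \<notin> D \<longrightarrow> n a = 0) \<longrightarrow> (\<forall>i. P ((\<lambda>a. min (n a) N)(b := i))) \<longrightarrow> (\<forall>i. P (n(b := i)))"
    by (rule insert.IH) (use anti_i in blast)
  then obtain N' where N': "\<And>n i. (\<And>a. a \<notin> D \<Longrightarrow> n a = 0) \<Longrightarrow> (\<And>i. P ((\<lambda>a. min (n a) N')(b := i))) \<Longrightarrow> P (n(b := i))"
    by metis
  define Box where "Box = {n :: 'a \<Rightarrow> nat. (\<forall>a. a \<notin> D \<longrightarrow> n a = 0) \<and> (\<forall>a. n a \<le> N')}"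
  have finBox: "finite Box"
  proof (rule finite_subset)
    show "Box \<subseteq> {n. \<forall>a. (a \<in> D \<longrightarrow> n a \<in> {..N'}) \<and> (a \<notin> D \<longrightarrow> n a = 0)}"
      by (auto simp: Box_def)
    show "finite {n :: 'a \<Rightarrow> nat. \<forall>a. (a \<in> D \<longrightarrow> n a \<in> {..N'}) \<and> (a \<notin> D \<longrightarrow> n a = 0)}"
      by (rule finite_set_of_finite_funs[OF insert.hyps(1)]) simp
  qed
  have "\<forall>n. \<exists>i. (\<exists>j. \<not> P (n(b := j))) \<longrightarrow> \<not> P (n(b := i))"
    by blast
  from choice[OF this] obtain wit where wit: "\<And>n j. \<not> P (n(b := j)) \<Longrightarrow> \<not> P (n(b := wit n))"
    by blast
  \<comment> \<open>A point of the finite box that is missing from some slice is already missing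
    from one of height at most \<open>I\<close>.\<close>
  define I where "I = Max (insert 0 (wit ` Box))"
  have I: "wit n \<le> I" if "n \<in> Box" for n
    unfolding I_def using finBox that by (intro Max_ge) auto
  have stable: "P (n(b := j))" if n: "\<And>a. a \<notin> D \<Longrightarrow> n a = 0" and PI: "P (n(b := I))" for n j
  proof (rule N')
    fix i
    show "P ((\<lambda>a. min (n a) N')(b := i))"
    proof (rule ccontr)
      assume "\<not> P ((\<lambda>a. min (n a) N')(b := i))"
      then have "\<not> P ((\<lambda>a. min (n a) N')(b := wit (\<lambda>a. min (n a) N')))"
        by (rule wit)
      moreover have "(\<lambda>a. min (n a) N') \<in> Box"
        using n by (auto simp: Box_def)
      ultimately show False
        using anti_i[of "\<lambda>a. min (n a) N'" n "wit (\<lambda>a. min (n a) N')" I] I PI by auto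
    qed
  qed (use n in auto)
  define NN where "NN = Max (insert I (N ` {..I}))"
  have NN: "I \<le> NN" "\<And>i. i \<le> I \<Longrightarrow> N i \<le> NN"
    unfolding NN_def by (auto simp del: Max_insert intro!: Max_ge)
  have "P n" if n: "\<forall>a. a \<notin> insert b D \<longrightarrow> n a = 0" and PN: "P (\<lambda>a. min (n a) NN)" for n
  proof -
    define n' where "n' = n(b := 0)"
    have n': "n' a = 0" if "a \<notin> D" for a
      using n that by (auto simp: n'_def)
    have nn: "n = n'(b := n b)"
      by (auto simp: n'_def)
    have tr: "(\<lambda>a. min (n a) NN) = (\<lambda>a. min (n' a) NN)(b := min (n b) NN)"
      by (auto simp: n'_def)
    show ?thesis
    proof (cases "n b \<le> I")
      case True
      then have "P ((\<lambda>a. min (n' a) (N (n b)))(b := n b))"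
        using PN NN True unfolding tr
        by (intro anti_i[of _ "\<lambda>a. min (n' a) NN" "n b" "min (n b) NN"] min.mono) auto
      then show ?thesis
        by (subst nn) (rule N[OF n'])
    next
      case False
      have "P ((\<lambda>a. min (n' a) NN)(b := I))"
        using PN NN False unfolding tr by (intro anti_i[of _ "\<lambda>a. min (n' a) NN" I "min (n b) NN"]) auto
      then have big: "P ((\<lambda>a. min (n' a) NN)(b := i))" for i
        by (rule stable[rotated]) (simp add: n')
      have "P ((\<lambda>a. min (n' a) (N I))(b := I))"
        by (rule anti_i[OF _ order_refl big]) (rule min.mono[OF order_refl NN(2)[OF order_refl]])
      then have "P (n'(b := I))"
        using N[of n' I] n' by blast
      then have "P (n'(b := n b))"
        using stable[of n' "n b"] n' by blast
      then show ?thesis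
        using nn by simp
    qed
  qed
  then show ?case by blast
qed

section \<open>Weighted series over exponent vectors\<close>

definition exponents :: "'a set \<Rightarrow> ('a \<Rightarrow> nat) set" where
  "exponents D = {n. \<forall>a. a \<notin> D \<longrightarrow> n a = 0}"

lemma summable_geometric_exponents:
  fixes \<alpha> :: "'a \<Rightarrow> real"
  assumes "finite D" "\<And>a. a \<in> D \<Longrightarrow> 0 \<le> \<alpha> a \<and> \<alpha> a < 1"
  shows "(\<lambda>n. \<Prod>a\<in>D. \<alpha> a ^ n a) summable_on exponents D"
  using assms
proof (induction D rule: finite_induct)
  case empty
  have "exponents {} = {\<lambda>_ :: 'a. 0 :: nat}"
    by (auto simp: exponents_def)
  then show ?case by simp
next
  case (insert b D)
  define j where "j = (\<lambda>(i, n :: 'a \<Rightarrow> nat). n(b := i))"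
  have bij: "bij_betw j (UNIV \<times> exponents D) (exponents (insert b D))"
  proof (rule bij_betwI[where g = "\<lambda>n. (n b, n(b := 0))"])
    show "j \<in> UNIV \<times> exponents D \<rightarrow> exponents (insert b D)"
      using insert.hyps by (auto simp: j_def exponents_def)
  qed (use insert.hyps in \<open>auto simp: j_def exponents_def fun_eq_iff\<close>)
  have pr: "(\<Prod>a\<in>insert b D. \<alpha> a ^ j (i, n) a) = \<alpha> b ^ i * (\<Prod>a\<in>D. \<alpha> a ^ n a)" for i n
  proof -
    have "(\<Prod>a\<in>D. \<alpha> a ^ j (i, n) a) = (\<Prod>a\<in>D. \<alpha> a ^ n a)"
      by (rule prod.cong) (use insert.hyps in \<open>auto simp: j_def\<close>)
    then show ?thesis
      using insert.hyps by (simp add: j_def)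
  qed
  have nonneg: "0 \<le> (\<Prod>a\<in>D. \<alpha> a ^ n a)" for n
    using insert.prems by (intro prod_nonneg) auto
  have "(\<lambda>(i, n). \<alpha> b ^ i * (\<Prod>a\<in>D. \<alpha> a ^ n a)) summable_on (UNIV \<times> exponents D)"
  proof (rule summable_on_SigmaI[where g = "\<lambda>i. \<alpha> b ^ i * infsum (\<lambda>n. \<Prod>a\<in>D. \<alpha> a ^ n a) (exponents D)"])
    show "((\<lambda>n. case (i, n) of (i, n) \<Rightarrow> \<alpha> b ^ i * (\<Prod>a\<in>D. \<alpha> a ^ n a)) has_sum
        \<alpha> b ^ i * infsum (\<lambda>n. \<Prod>a\<in>D. \<alpha> a ^ n a) (exponents D)) (exponents D)" for i
      using insert.IH insert.prems by (simp add: has_sum_cmult_right)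
    have "summable (\<lambda>i. \<alpha> b ^ i)"
      using insert.prems by (intro summable_geometric) auto
    then have "(\<lambda>i. \<alpha> b ^ i) summable_on UNIV"
      using insert.prems by (subst summable_on_UNIV_nonneg_real_iff) auto
    then show "(\<lambda>i. \<alpha> b ^ i * infsum (\<lambda>n. \<Prod>a\<in>D. \<alpha> a ^ n a) (exponents D)) summable_on UNIV"
      by (rule summable_on_cmult_left)
  qed (use insert.prems nonneg in auto)
  then have "(\<lambda>p. \<Prod>a\<in>insert b D. \<alpha> a ^ j p a) summable_on (UNIV \<times> exponents D)"
    by (rule summable_on_cong[THEN iffD1, rotated]) (auto simp: pr)
  then show ?case
    using summable_on_reindex_bij_betw[OF bij, of "\<lambda>n. \<Prod>a\<in>insert b D. \<alpha> a ^ n a"] by simp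
qed

lemma has_sum_group:
  fixes f :: "'a \<Rightarrow> 'b::banach"
  assumes "f summable_on X"
  shows "((\<lambda>i. infsum f {x\<in>X. g x = i}) has_sum infsum f X) UNIV"
proof -
  have inj: "inj_on (\<lambda>x. (g x, x)) X"
    by (auto simp: inj_on_def)
  have "(f has_sum infsum f X) X"
    using assms by simp
  then have "((f \<circ> snd) has_sum infsum f X) ((\<lambda>x. (g x, x)) ` X)"
    by (subst has_sum_reindex[OF inj]) (simp add: o_def)
  also have "(\<lambda>x. (g x, x)) ` X = Sigma UNIV (\<lambda>i. {x\<in>X. g x = i})"
    by auto
  finally show ?thesis
  proof (rule has_sum_SigmaD)
    fix i
    have "f summable_on {x\<in>X. g x = i}"
      by (rule summable_on_subset_banach[OF assms]) auto
    then show "((\<lambda>x. (f \<circ> snd) (i, x)) has_sum infsum f {x\<in>X. g x = i}) {x\<in>X. g x = i}"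
      by simp
  qed
qed

locale power_weights =
  fixes D :: "'a set" and \<alpha> :: "'a \<Rightarrow> real" and \<mu> :: "'a \<Rightarrow> nat"
  assumes finD: "finite D" and \<alpha>: "\<And>a. a \<in> D \<Longrightarrow> \<alpha> a \<in> \<rat> \<and> 0 \<le> \<alpha> a \<and> \<alpha> a < 1"
begin

definition wt :: "('a \<Rightarrow> nat) \<Rightarrow> real" where
  "wt n = (\<Prod>a\<in>D. \<alpha> a ^ n a)"

definition lev :: "('a \<Rightarrow> nat) \<Rightarrow> nat" where
  "lev n = (\<Sum>a\<in>D. n a * \<mu> a)"

text \<open>Coefficients of the generating function
  \<open>\<Sum> \<xi> n * \<Prod> (\<alpha> a * X ^ \<mu> a) ^ n a\<close>, collected by powers of
  \<open>X\<close>. A level can contain infinitely many \<open>n\<close> when some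
  \<open>\<mu> a\<close> is 0, hence the infinite sum.\<close>

definition level_series :: "(('a \<Rightarrow> nat) \<Rightarrow> real) \<Rightarrow> nat \<Rightarrow> real" where
  "level_series \<xi> M = infsum (\<lambda>n. \<xi> n * wt n) {n\<in>exponents D. lev n = M}"

definition nabla :: "'a \<Rightarrow> (('a \<Rightarrow> nat) \<Rightarrow> real) \<Rightarrow> ('a \<Rightarrow> nat) \<Rightarrow> real" where
  "nabla a \<xi> n = \<xi> n - (if 0 < n a then \<xi> (n(a := n a - 1)) else 0)"

lemma wt_nonneg: "0 \<le> wt n"
  unfolding wt_def using \<alpha> by (intro prod_nonneg) auto

lemma summable_wt: "(\<lambda>n. \<xi> n * wt n) summable_on X" if "\<And>n. \<bar>\<xi> n\<bar> \<le> C" "X \<subseteq> exponents D"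
proof -
  have "wt summable_on exponents D"
    unfolding wt_def using finD \<alpha> by (intro summable_geometric_exponents) auto
  then have "(\<lambda>n. C * wt n) summable_on exponents D"
    by (rule summable_on_cmult_right)
  then have "(\<lambda>n. norm (\<xi> n * wt n)) summable_on exponents D"
    by (rule summable_on_comparison_test) (use that(1) wt_nonneg in \<open>auto simp: abs_mult mult_right_mono\<close>)
  then have "(\<lambda>n. \<xi> n * wt n) summable_on exponents D"
    by (rule abs_summable_summable)
  then show ?thesis
    using that(2) summable_on_subset_banach by blast
qed

lemma summable_level_series:
  assumes "\<And>n. \<bar>\<xi> n\<bar> \<le> C"
  shows "level_series \<xi> summable_on UNIV"
proof -
  have "(\<lambda>n. \<xi> n * wt n) summable_on exponents D"
    by (rule summable_wt[OF assms]) auto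
  from has_sum_group[OF this, where g = lev] show ?thesis
    unfolding level_series_def summable_on_def by blast
qed

lemma wt_upd:
  assumes "a \<in> D"
  shows "wt (n(a := Suc (n a))) = \<alpha> a * wt n"
proof -
  have "wt m = \<alpha> a ^ m a * (\<Prod>b\<in>D - {a}. \<alpha> b ^ m b)" for m
    unfolding wt_def using assms finD by (simp add: prod.remove)
  moreover have "(\<Prod>b\<in>D - {a}. \<alpha> b ^ (n(a := Suc (n a))) b) = (\<Prod>b\<in>D - {a}. \<alpha> b ^ n b)"
    by (rule prod.cong) auto
  ultimately show ?thesis by simp
qed

lemma lev_upd:
  assumes "a \<in> D"
  shows "lev (n(a := Suc (n a))) = \<mu> a + lev n"
proof -
  have "lev m = m a * \<mu> a + (\<Sum>b\<in>D - {a}. m b * \<mu> b)" for m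
    unfolding lev_def using assms finD by (simp add: sum.remove)
  moreover have "(\<Sum>b\<in>D - {a}. (n(a := Suc (n a))) b * \<mu> b) = (\<Sum>b\<in>D - {a}. n b * \<mu> b)"
    by (rule sum.cong) auto
  ultimately show ?thesis by simp
qed

text \<open>Raising the exponent of \<open>a\<close> by one multiplies the weight by
  \<open>\<alpha> a\<close> and raises the level by \<open>\<mu> a\<close>; so a difference in
  direction \<open>a\<close> becomes the factor \<open>1 - \<alpha> a * X ^ \<mu> a\<close> of the
  generating function.\<close>

lemma level_series_nabla:
  assumes \<xi>: "\<And>n. \<bar>\<xi> n\<bar> \<le> C" and a: "a \<in> D"
  shows "level_series (nabla a \<xi>) M = level_series \<xi> M - \<alpha> a * delay (\<mu> a) (level_series \<xi>) M"
proof -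
  define G where "G = (\<lambda>M. {n\<in>exponents D. lev n = M})"
  define up where "up = (\<lambda>n :: 'a \<Rightarrow> nat. n(a := Suc (n a)))"
  define \<xi>' where "\<xi>' = (\<lambda>n. if 0 < n a then \<xi> (n(a := n a - 1)) else 0)"
  have \<xi>': "\<bar>\<xi>' n\<bar> \<le> C" for n
    using \<xi>[of n] \<xi>[of "n(a := n a - 1)"] by (auto simp: \<xi>'_def)
  have G: "G M \<subseteq> exponents D" for M
    by (auto simp: G_def)
  have inj: "inj up"
    by (rule injI) (metis up_def fun_upd_same fun_upd_upd fun_upd_triv nat.inject)
  have "infsum (\<lambda>n. \<xi>' n * wt n) (G M) = \<alpha> a * delay (\<mu> a) (level_series \<xi>) M"
  proof (cases "\<mu> a \<le> M")
    case True
    have "infsum (\<lambda>n. \<xi>' n * wt n) (G M) = infsum (\<lambda>n. \<xi>' n * wt n) (up ` G (M - \<mu> a))"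
    proof (rule infsum_cong_neutral)
      fix n assume n: "n \<in> G M - up ` G (M - \<mu> a)"
      have "n a = 0"
      proof (rule ccontr)
        assume "n a \<noteq> 0"
        then have nu: "n = up (n(a := n a - 1))"
          by (auto simp: up_def fun_eq_iff)
        have "lev (n(a := n a - 1)) + \<mu> a = M"
          using n lev_upd[OF a, of "n(a := n a - 1)"] nu by (auto simp: G_def up_def)
        then have "n(a := n a - 1) \<in> G (M - \<mu> a)"
          using n a by (auto simp: G_def exponents_def)
        then show False using n nu by blast
      qed
      then show "\<xi>' n * wt n = 0" by (simp add: \<xi>'_def)
    next
      fix n assume n: "n \<in> up ` G (M - \<mu> a) - G M"
      then obtain n0 where "n = up n0" "n0 \<in> G (M - \<mu> a)" by blast
      then have "n \<in> G M"
        using lev_upd[OF a, of n0] True a by (auto simp: G_def exponents_def up_def)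
      then show "\<xi>' n * wt n = 0" using n by blast
    qed auto
    also have "\<dots> = infsum ((\<lambda>n. \<xi>' n * wt n) \<circ> up) (G (M - \<mu> a))"
      by (rule infsum_reindex) (use inj inj_on_subset in blast)
    also have "\<dots> = infsum (\<lambda>n. \<alpha> a * (\<xi> n * wt n)) (G (M - \<mu> a))"
      by (rule infsum_cong) (simp add: \<xi>'_def up_def wt_upd[OF a])
    also have "\<dots> = \<alpha> a * infsum (\<lambda>n. \<xi> n * wt n) (G (M - \<mu> a))"
      by (rule infsum_cmult_right')
    finally show ?thesis
      using True by (simp add: delay_def level_series_def G_def)
  next
    case False
    have "\<xi>' n * wt n = 0" if "n \<in> G M" for n
    proof -
      have "n a * \<mu> a \<le> lev n"
        unfolding lev_def using finD a member_le_sum[of a D "\<lambda>a. n a * \<mu> a"] by simp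
      then have "n a = 0"
        using that False by (cases "n a") (auto simp: G_def)
      then show ?thesis by (simp add: \<xi>'_def)
    qed
    then have "infsum (\<lambda>n. \<xi>' n * wt n) (G M) = 0"
      using infsum_cong[of "G M" "\<lambda>n. \<xi>' n * wt n" "\<lambda>_. 0"] by simp
    then show ?thesis
      using False by (simp add: delay_def)
  qed
  moreover have "level_series (nabla a \<xi>) M = infsum (\<lambda>n. \<xi> n * wt n + (-1) * (\<xi>' n * wt n)) (G M)"
    unfolding level_series_def G_def by (rule infsum_cong) (simp add: nabla_def \<xi>'_def algebra_simps)
  moreover have "\<dots> = infsum (\<lambda>n. \<xi> n * wt n) (G M) + infsum (\<lambda>n. (-1) * (\<xi>' n * wt n)) (G M)"
    using summable_wt[OF \<xi> G] summable_wt[OF \<xi>' G] by (intro infsum_add summable_on_cmult_right)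
  ultimately show ?thesis
    by (simp add: infsum_cmult_right' level_series_def G_def infsum_uminus)
qed

text \<open>If \<open>\<xi>\<close> no longer changes once the exponent of \<open>a\<close> passes
  \<open>N\<close>, its difference in direction \<open>a\<close> vanishes there. Each element of
  \<open>L\<close> thus moves from the stable to the vanishing coordinates, and at the end the
  support is a finite box.\<close>

lemma level_series_rat_rec:
  assumes "distinct L" "set L \<subseteq> D" "\<And>n. \<xi> n \<in> \<rat>" "\<And>n. \<bar>\<xi> n\<bar> \<le> C"
    and "\<And>n a. n \<in> exponents D \<Longrightarrow> a \<in> set L \<Longrightarrow> N < n a \<Longrightarrow> \<xi> n = \<xi> (n(a := N))"
    and "\<And>n a. n \<in> exponents D \<Longrightarrow> a \<in> D - set L \<Longrightarrow> N < n a \<Longrightarrow> \<xi> n = 0"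
  shows "rat_rec (map (\<lambda>a. (\<alpha> a, \<mu> a)) L) (level_series \<xi>)"
  using assms
proof (induction L arbitrary: \<xi> C)
  case Nil
  define Box where "Box = {n\<in>exponents D. \<forall>a\<in>D. n a \<le> N}"
  have finBox: "finite Box"
  proof (rule finite_subset)
    show "Box \<subseteq> {n. \<forall>a. (a \<in> D \<longrightarrow> n a \<in> {..N}) \<and> (a \<notin> D \<longrightarrow> n a = 0)}"
      by (auto simp: Box_def exponents_def)
    show "finite {n :: 'a \<Rightarrow> nat. \<forall>a. (a \<in> D \<longrightarrow> n a \<in> {..N}) \<and> (a \<notin> D \<longrightarrow> n a = 0)}"
      by (rule finite_set_of_finite_funs[OF finD]) simp
  qed
  have eq: "level_series \<xi> M = (\<Sum>n\<in>{n\<in>Box. lev n = M}. \<xi> n * wt n)" for M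
  proof -
    have "\<xi> n * wt n = 0" if "n \<in> {n\<in>exponents D. lev n = M} - {n\<in>Box. lev n = M}" for n
    proof -
      obtain a where "a \<in> D" "N < n a" "n \<in> exponents D"
        using \<open>n \<in> _\<close> by (auto simp: Box_def not_le)
      then show ?thesis using Nil(6) by simp
    qed
    then have "level_series \<xi> M = infsum (\<lambda>n. \<xi> n * wt n) {n\<in>Box. lev n = M}"
      unfolding level_series_def by (intro infsum_cong_neutral) (auto simp: Box_def)
    then show ?thesis
      using finBox by simp
  qed
  have "{M. level_series \<xi> M \<noteq> 0} \<subseteq> lev ` Box"
  proof
    fix M assume "M \<in> {M. level_series \<xi> M \<noteq> 0}"
    then have "{n\<in>Box. lev n = M} \<noteq> {}"
      unfolding eq by (metis (mono_tags, lifting) mem_Collect_eq sum.empty)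
    then show "M \<in> lev ` Box" by auto
  qed
  then have "finite {M. level_series \<xi> M \<noteq> 0}"
    using finBox finite_surj by blast
  moreover have "level_series \<xi> M \<in> \<rat>" for M
  proof -
    have "wt n \<in> \<rat>" for n
      unfolding wt_def using \<alpha> by (intro Rats_prod Rats_power) auto
    then show ?thesis
      unfolding eq using Nil(3) by (intro Rats_sum Rats_mult)
  qed
  ultimately show ?case by auto
next
  case (Cons a L)
  have a: "a \<in> D" "a \<notin> set L"
    using Cons.prems by auto
  have "rat_rec (map (\<lambda>a. (\<alpha> a, \<mu> a)) L) (level_series (nabla a \<xi>))"
  proof (rule Cons.IH)
    show "distinct L" "set L \<subseteq> D"
      using Cons.prems by auto
    show "nabla a \<xi> n \<in> \<rat>" for n
      using Cons.prems(3) by (auto simp: nabla_def)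
    show "\<bar>nabla a \<xi> n\<bar> \<le> 2 * C" for n
      using Cons.prems(4)[of n] Cons.prems(4)[of "n(a := n a - 1)"] unfolding nabla_def
      by (auto simp del: fun_upd_apply)
    fix n b assume n: "n \<in> exponents D" and nb: "N < n b"
    have dec: "n(a := x) \<in> exponents D" for x
      using n a by (auto simp: exponents_def)
    show "nabla a \<xi> n = nabla a \<xi> (n(b := N))" if b: "b \<in> set L"
    proof -
      have ba: "b \<noteq> a" using a b by auto
      have "\<xi> (n(a := n a - 1)) = \<xi> (n(a := n a - 1, b := N))"
        by (rule Cons.prems(5)[OF dec]) (use nb ba b in auto)
      moreover have "\<xi> n = \<xi> (n(b := N))"
        by (rule Cons.prems(5)[OF n]) (use nb b in auto)
      ultimately show ?thesis
        using ba by (simp add: nabla_def fun_upd_twist)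
    qed
    show "nabla a \<xi> n = 0" if b: "b \<in> D - set L"
    proof (cases "b = a")
      case True
      have 1: "\<xi> n = \<xi> (n(a := N))"
        by (rule Cons.prems(5)[OF n]) (use nb True in auto)
      \<comment> \<open>Stability is assumed strictly above \<open>N\<close>, so the boundary case
        \<open>n a - 1 = N\<close> is separate.\<close>
      have "\<xi> (n(a := n a - 1)) = \<xi> (n(a := N))"
      proof (cases "n a - 1 = N")
        case False
        have "\<xi> (n(a := n a - 1)) = \<xi> (n(a := n a - 1, a := N))"
          by (rule Cons.prems(5)[OF dec]) (use nb True False in auto)
        then show ?thesis by (simp only: fun_upd_upd)
      qed simp
      then show ?thesis
        using 1 nb True by (simp add: nabla_def)
    next
      case False
      then have bD: "b \<in> D - set (a # L)" using b by auto
      have "\<xi> n = 0"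
        by (rule Cons.prems(6)[OF n bD nb])
      moreover have "\<xi> (n(a := n a - 1)) = 0"
        by (rule Cons.prems(6)[OF dec bD]) (use nb False in auto)
      ultimately show ?thesis by (simp add: nabla_def)
    qed
  qed
  moreover have "level_series (nabla a \<xi>) = (\<lambda>M. level_series \<xi> M - \<alpha> a * delay (\<mu> a) (level_series \<xi>) M)"
    by (rule ext) (rule level_series_nabla[of \<xi> C, OF Cons.prems(4) a(1)])
  ultimately show ?case by simp
qed

end

section \<open>Standard representations of weights\<close>

lemma dot_add: "dot (k + k') \<omega> = dot k \<omega> + dot k' \<omega>"
  by (simp add: dot_def add_mult_distrib sum.distrib)

lemma dot_sum_scale: "dot (\<Sum>a\<in>D. n a *s a) \<omega> = (\<Sum>a\<in>D. n a * dot a \<omega>)"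
  unfolding dot_def by (simp add: sum_distrib_left sum_distrib_right mult.assoc) (rule sum.swap)

lemma norm1_eq_dot: "norm1 k = dot k (\<chi> i. 1)"
  by (simp add: norm1_def dot_def)

text \<open>The facts about a support and its facet normals that the counting uses, detached from
  polyhedral geometry; \<open>dec\<close> is the conclusion of
  \<open>weight_decomposition\<close>.\<close>

locale weight_fan =
  fixes S D :: "(nat ^ 'n) set" and q :: nat
  assumes finS: "finite S" and neS: "S \<noteq> {}" and finiteD: "finite D" and nzD: "\<And>a. a \<in> D \<Longrightarrow> a \<noteq> 0"
    and dec: "\<And>k \<omega>. \<omega> \<in> S \<Longrightarrow> dot k \<omega> = mn S k \<Longrightarrow>
      \<exists>k0 n. k = k0 + (\<Sum>a\<in>D. n a *s a) \<and> (\<forall>i. k0 $ i \<le> (\<Sum>a\<in>D. a $ i)) \<and>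
        dot k0 \<omega> = mn S k0 \<and> (\<forall>a. n a \<noteq> 0 \<longrightarrow> a \<in> D \<and> dot a \<omega> = mn S a)"
    and q2: "2 \<le> q"

sublocale weight_fan \<subseteq> power_weights D "\<lambda>a. 1 / real q ^ norm1 a" "mn S"
proof
  show "finite D" by (rule finiteD)
  fix a assume "a \<in> D"
  then obtain i where "a $ i \<noteq> 0"
    using nzD by (auto simp: vec_eq_iff)
  then have "norm1 a \<noteq> 0"
    by (auto simp: norm1_def)
  then have "1 < real q ^ norm1 a"
    using q2 by (intro one_less_power) auto
  then show "1 / real q ^ norm1 a \<in> \<rat> \<and> 0 \<le> 1 / real q ^ norm1 a \<and> 1 / real q ^ norm1 a < 1"
    using q2 by (auto simp: divide_less_eq)
qed

context weight_fan
begin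

definition lin :: "(nat ^ 'n \<Rightarrow> nat) \<Rightarrow> nat ^ 'n" where
  "lin n = (\<Sum>a\<in>D. n a *s a)"

definition small_weights :: "(nat ^ 'n) set" where
  "small_weights = {k. \<forall>i. k $ i \<le> (\<Sum>a\<in>D. a $ i)}"

text \<open>One monomial \<open>\<omega>\<close> is minimal for \<open>k0\<close> and for every
  normal in use: all summands lie in one normal cone, where \<open>mn S\<close> is additive.\<close>

definition valid :: "nat ^ 'n \<Rightarrow> nat ^ 'n \<Rightarrow> (nat ^ 'n \<Rightarrow> nat) \<Rightarrow> bool" where
  "valid \<omega> k0 n \<longleftrightarrow> \<omega> \<in> S \<and> dot k0 \<omega> = mn S k0 \<and> (\<forall>a. n a \<noteq> 0 \<longrightarrow> a \<in> D \<and> dot a \<omega> = mn S a)"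

definition is_rep :: "nat ^ 'n \<Rightarrow> (nat ^ 'n \<Rightarrow> nat) \<Rightarrow> bool" where
  "is_rep k0 n \<longleftrightarrow> k0 \<in> small_weights \<and> (\<exists>\<omega>. valid \<omega> k0 n)"

lemma finite_small_weights: "finite small_weights"
proof -
  define B where "B = (\<Sum>i\<in>UNIV. \<Sum>a\<in>D. a $ i)"
  have "k $ i \<le> B" if "k \<in> small_weights" for k i
  proof -
    have "k $ i \<le> (\<Sum>a\<in>D. a $ i)"
      using that by (simp add: small_weights_def)
    also have "\<dots> \<le> B"
      unfolding B_def by (rule member_le_sum) auto
    finally show ?thesis .
  qed
  then have "small_weights \<subseteq> vec_lambda ` (UNIV \<rightarrow>\<^sub>E {..B})"
    by (auto intro!: image_eqI[of _ vec_lambda "vec_nth _"])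
  then show ?thesis
    by (rule finite_subset) (intro finite_imageI finite_PiE, auto)
qed

lemma dot_lin: "dot (k0 + lin n) \<omega> = dot k0 \<omega> + (\<Sum>a\<in>D. n a * dot a \<omega>)"
  by (simp add: lin_def dot_add dot_sum_scale)

lemma lin_add: "lin (\<lambda>a. n a + m a) = lin n + lin m"
  by (simp add: lin_def vec_eq_iff add_mult_distrib sum.distrib)

lemma weight_lin: "1 / real q ^ norm1 (k0 + lin n) = wt n / real q ^ norm1 k0"
proof -
  have "norm1 (k0 + lin n) = norm1 k0 + (\<Sum>a\<in>D. n a * norm1 a)"
    unfolding norm1_eq_dot by (rule dot_lin)
  moreover have "wt n = 1 / real q ^ (\<Sum>a\<in>D. n a * norm1 a)"
    unfolding wt_def by (simp add: power_one_over power_sum prod_dividef mult.commute flip: power_mult)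
  ultimately show ?thesis
    by (simp add: power_add)
qed

lemma valid_mn:
  assumes "valid \<omega> k0 n"
  shows "mn S (k0 + lin n) = mn S k0 + lev n" "dot (k0 + lin n) \<omega> = mn S (k0 + lin n)"
proof -
  have "n a * dot a \<omega> = n a * mn S a" for a
    using assms by (cases "n a = 0") (auto simp: valid_def)
  then have "(\<Sum>a\<in>D. n a * dot a \<omega>) = lev n"
    unfolding lev_def by (rule sum.cong[OF refl])
  then have eq: "dot (k0 + lin n) \<omega> = mn S k0 + lev n"
    using assms by (simp add: dot_lin valid_def)
  show 1: "mn S (k0 + lin n) = mn S k0 + lev n"
  proof (rule mn_eqI[OF finS _ eq])
    fix \<omega>' assume w: "\<omega>' \<in> S"
    show "mn S k0 + lev n \<le> dot (k0 + lin n) \<omega>'"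
      unfolding dot_lin lev_def using mn_le[OF finS w] by (intro add_mono sum_mono mult_left_mono) auto
  qed (use assms in \<open>auto simp: valid_def\<close>)
  show "dot (k0 + lin n) \<omega> = mn S (k0 + lin n)"
    using eq 1 by simp
qed

lemma valid_excess:
  assumes "valid \<omega> k0 n" "\<omega>' \<in> S"
  shows "excess S (k0 + lin n) \<omega>' = excess S k0 \<omega>' + (\<Sum>a\<in>D. n a * excess S a \<omega>')"
proof -
  have "mn S k0 + lev n + excess S (k0 + lin n) \<omega>' = dot (k0 + lin n) \<omega>'"
    using dot_eq_excess[OF finS assms(2), of "k0 + lin n"] valid_mn[OF assms(1)] by simp
  also have "\<dots> = (mn S k0 + excess S k0 \<omega>') + (\<Sum>a\<in>D. n a * (mn S a + excess S a \<omega>'))"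
    unfolding dot_lin by (simp only: dot_eq_excess[OF finS assms(2)])
  also have "\<dots> = mn S k0 + lev n + (excess S k0 \<omega>' + (\<Sum>a\<in>D. n a * excess S a \<omega>'))"
    by (simp add: lev_def add_mult_distrib2 sum.distrib)
  finally show ?thesis by simp
qed

text \<open>Excesses are nonnegative and add up along a representation, so a minimizer of the sum
  minimizes every summand. The witness can thus be exchanged for any minimizer of the
  weight.\<close>

lemma valid_transfer:
  assumes rep: "is_rep k1 n1" and w: "\<omega> \<in> S" "dot (k1 + lin n1) \<omega> = mn S (k1 + lin n1)"
  shows "valid \<omega> k1 n1"
proof -
  obtain \<omega>1 where v: "valid \<omega>1 k1 n1"
    using rep by (auto simp: is_rep_def)
  have "excess S k1 \<omega> + (\<Sum>a\<in>D. n1 a * excess S a \<omega>) = 0"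
    using valid_excess[OF v w(1)] w(2) by (simp add: excess_def)
  then have 0: "excess S k1 \<omega> = 0" "\<And>a. a \<in> D \<Longrightarrow> n1 a * excess S a \<omega> = 0"
    using finiteD by auto
  have "dot a \<omega> = mn S a" if "n1 a \<noteq> 0" for a
    using 0(2)[of a] that v dot_eq_excess[OF finS w(1), of a] by (auto simp: valid_def)
  then show ?thesis
    using 0(1) v w dot_eq_excess[OF finS w(1), of k1] by (auto simp: valid_def)
qed

definition pairX :: "((nat ^ 'n) + (nat ^ 'n)) set" where
  "pairX = Inl ` small_weights \<union> Inr ` D"

text \<open>A representation as a single exponent vector: the remainder \<open>k0\<close> enters as
  a unit vector, so that the code also separates remainders, and adding to \<open>n\<close> adds to
  the embedded vector.\<close>

definition emb :: "nat ^ 'n \<Rightarrow> (nat ^ 'n \<Rightarrow> nat) \<Rightarrow> (nat ^ 'n) + (nat ^ 'n) \<Rightarrow> nat" where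
  "emb k0 n = case_sum (\<lambda>k. if k = k0 then 1 else 0) n"

definition code :: "((nat ^ 'n) + (nat ^ 'n) \<Rightarrow> nat) \<Rightarrow> nat" where
  "code = (SOME c. (\<forall>m m'. c m = c m' \<longrightarrow> (\<forall>x\<in>pairX. m x = m' x)) \<and>
    (\<forall>m m'. c (\<lambda>x. m x + m' x) = c m * c m') \<and> (\<forall>m. 0 < c m))"

lemma code_inj: "code m = code m' \<Longrightarrow> x \<in> pairX \<Longrightarrow> m x = m' x"
  and code_add: "code (\<lambda>x. m x + m' x) = code m * code m'"
  and code_pos: "0 < code m"
proof -
  have "finite pairX"
    using finite_small_weights finiteD by (simp add: pairX_def)
  from someI_ex[OF ex_multiplicative_code[OF this], folded code_def]
  show "code m = code m' \<Longrightarrow> x \<in> pairX \<Longrightarrow> m x = m' x" "code (\<lambda>x. m x + m' x) = code m * code m'" "0 < code m"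
    by blast+
qed

text \<open>Selecting representations by a multiplicative code makes the selected set closed under
  decreasing the exponents, so that it is described by finitely many truncations.\<close>
definition std_reps :: "((nat ^ 'n) \<times> (nat ^ 'n \<Rightarrow> nat)) set" where
  "std_reps = {(k0, n). is_rep k0 n \<and>
     (\<forall>k1 n1. is_rep k1 n1 \<longrightarrow> k1 + lin n1 = k0 + lin n \<longrightarrow> code (emb k0 n) \<le> code (emb k1 n1))}"

lemma std_reps_rep: "(k0, n) \<in> std_reps \<Longrightarrow> is_rep k0 n"
  by (simp add: std_reps_def)

lemma bij_std_reps: "bij_betw (\<lambda>(k0, n). k0 + lin n) std_reps UNIV"
  unfolding bij_betw_def
proof
  show "inj_on (\<lambda>(k0, n). k0 + lin n) std_reps"
  proof (rule inj_onI, clarify)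
    fix k0 n k1 n1 assume a: "(k0, n) \<in> std_reps" "(k1, n1) \<in> std_reps" "k0 + lin n = k1 + lin n1"
    then have eq: "code (emb k0 n) = code (emb k1 n1)"
      by (auto simp: std_reps_def intro: antisym)
    have K: "k0 \<in> small_weights" "k1 \<in> small_weights"
      using std_reps_rep[OF a(1)] std_reps_rep[OF a(2)] by (auto simp: is_rep_def)
    have sup: "n b = 0 \<and> n1 b = 0" if "b \<notin> D" for b
      using std_reps_rep[OF a(1)] std_reps_rep[OF a(2)] that unfolding is_rep_def valid_def by blast
    have "k0 = k1"
      using code_inj[OF eq, of "Inl k0"] K by (simp add: pairX_def emb_def split: if_splits)
    moreover have "n a = n1 a" for a
      using code_inj[OF eq, of "Inr a"] sup[of a] by (cases "a \<in> D") (auto simp: pairX_def emb_def)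
    ultimately show "k0 = k1 \<and> n = n1" by auto
  qed
  show "(\<lambda>(k0, n). k0 + lin n) ` std_reps = UNIV"
  proof (rule UNIV_eq_I[symmetric])
    fix k
    obtain \<omega> where w: "\<omega> \<in> S" "dot k \<omega> = mn S k"
      using mn_attained[OF finS neS] by blast
    obtain k0 n where "k = k0 + lin n" "is_rep k0 n"
      using dec[OF w] w(1) unfolding is_rep_def valid_def small_weights_def lin_def by blast
    then have "is_rep (fst (k0, n)) (snd (k0, n)) \<and> fst (k0, n) + lin (snd (k0, n)) = k"
      by auto
    from ex_has_least_nat[where P = "\<lambda>p. is_rep (fst p) (snd p) \<and> fst p + lin (snd p) = k"
        and m = "\<lambda>p. code (emb (fst p) (snd p))", OF this]
    obtain p where p: "is_rep (fst p) (snd p)" "fst p + lin (snd p) = k"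
      "\<And>p'. is_rep (fst p') (snd p') \<and> fst p' + lin (snd p') = k \<Longrightarrow> code (emb (fst p) (snd p)) \<le> code (emb (fst p') (snd p'))"
      by blast
    then have "p \<in> std_reps"
      unfolding std_reps_def using p(3)[of "(k1, n1)" for k1 n1] by (auto simp: case_prod_unfold)
    then show "k \<in> (\<lambda>(k0, n). k0 + lin n) ` std_reps"
      using p(2) by (intro image_eqI[of _ _ p]) (auto simp: case_prod_unfold)
  qed
qed

text \<open>If a competitor for the smaller weight had a smaller code, adding back
  \<open>\<delta> = n - n'\<close> would give a competitor for the original weight, and multiplying
  both codes by the same factor keeps the inequality. By \<open>valid_transfer\<close> the
  competitor shares \<open>\<omega>\<close> with the added normals, so the sum is again a
  representation.\<close>

lemma std_reps_down:
  assumes std_reps: "(k0, n) \<in> std_reps" and le: "\<And>a. n' a \<le> n a"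
  shows "(k0, n') \<in> std_reps"
proof -
  define \<delta> where "\<delta> = (\<lambda>a. n a - n' a)"
  have n: "n = (\<lambda>a. n' a + \<delta> a)"
    using le by (simp add: \<delta>_def)
  obtain \<omega> where v: "valid \<omega> k0 n" and K: "k0 \<in> small_weights"
    using std_reps by (auto simp: std_reps_def is_rep_def)
  have v': "valid \<omega> k0 n'"
    using v unfolding n valid_def by auto
  have w: "\<omega> \<in> S"
    using v by (simp add: valid_def)
  have emb_add: "emb k n = (\<lambda>x. emb k n' x + case_sum (\<lambda>_. 0) \<delta> x)" if "n = (\<lambda>a. n' a + \<delta> a)" for k n n'
    using that by (auto simp: emb_def fun_eq_iff split: sum.splits)
  have "code (emb k0 n') \<le> code (emb k1 n1)" if rep: "is_rep k1 n1" and eq: "k1 + lin n1 = k0 + lin n'" for k1 n1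
  proof -
    have "valid \<omega> k1 n1"
      using valid_transfer[OF rep w] valid_mn(2)[OF v'] eq by simp
    moreover have "\<delta> a \<noteq> 0 \<Longrightarrow> a \<in> D \<and> dot a \<omega> = mn S a" for a
      using v unfolding n valid_def by auto
    ultimately have "is_rep k1 (\<lambda>a. n1 a + \<delta> a)"
      using rep unfolding is_rep_def valid_def by (metis add_0)
    moreover have "k1 + lin (\<lambda>a. n1 a + \<delta> a) = k0 + lin n"
      unfolding n lin_add using eq by (metis add.assoc)
    ultimately have "code (emb k0 n) \<le> code (emb k1 (\<lambda>a. n1 a + \<delta> a))"
      using std_reps unfolding std_reps_def by blast
    then have "code (emb k0 n') * code (case_sum (\<lambda>_. 0) \<delta>) \<le> code (emb k1 n1) * code (case_sum (\<lambda>_. 0) \<delta>)"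
      unfolding emb_add[OF n] emb_add[OF refl] code_add .
    then show ?thesis
      using code_pos by simp
  qed
  then show ?thesis
    using v' K unfolding std_reps_def is_rep_def by blast
qed

definition trunc_type :: "nat \<Rightarrow> nat ^ 'n \<Rightarrow> nat ^ 'n \<Rightarrow> nat" where
  "trunc_type N k = (\<lambda>\<omega>. if \<omega> \<in> S then min (excess S k \<omega>) N else 0)"

lemma finite_range_trunc_type: "finite (range (trunc_type N))"
proof (rule finite_subset)
  show "range (trunc_type N) \<subseteq> {f. \<forall>\<omega>. (\<omega> \<in> S \<longrightarrow> f \<omega> \<in> {..N}) \<and> (\<omega> \<notin> S \<longrightarrow> f \<omega> = 0)}"
    by (auto simp: trunc_type_def)
  show "finite {f :: nat ^ 'n \<Rightarrow> nat. \<forall>\<omega>. (\<omega> \<in> S \<longrightarrow> f \<omega> \<in> {..N}) \<and> (\<omega> \<notin> S \<longrightarrow> f \<omega> = 0)}"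
    by (rule finite_set_of_finite_funs[OF finS]) simp
qed

definition std_indicator :: "nat \<Rightarrow> (nat ^ 'n \<Rightarrow> nat) \<Rightarrow> nat ^ 'n \<Rightarrow> (nat ^ 'n \<Rightarrow> nat) \<Rightarrow> real" where
  "std_indicator N \<phi> k0 n = (if (k0, n) \<in> std_reps \<and> trunc_type N (k0 + lin n) = \<phi> then 1 else 0)"

text \<open>Membership is down-closed, hence decided by truncated exponents. As for the type, a
  normal with zero excess at \<open>\<omega>\<close> never affects it, and one with positive excess
  has pushed it to at least \<open>N\<close> once its exponent is \<open>N\<close>.\<close>

lemma std_indicator_stable:
  "\<exists>N'. \<forall>n a. n \<in> exponents D \<longrightarrow> a \<in> D \<longrightarrow> N' < n a \<longrightarrow> std_indicator N \<phi> k0 n = std_indicator N \<phi> k0 (n(a := N'))"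
proof -
  have "\<exists>N1. \<forall>n. (\<forall>a. a \<notin> D \<longrightarrow> n a = 0) \<longrightarrow> (k0, \<lambda>a. min (n a) N1) \<in> std_reps \<longrightarrow> (k0, n) \<in> std_reps"
    by (rule antitone_truncation[OF finiteD]) (rule std_reps_down)
  then obtain N1 where N1: "\<And>n. n \<in> exponents D \<Longrightarrow> (k0, \<lambda>a. min (n a) N1) \<in> std_reps \<Longrightarrow> (k0, n) \<in> std_reps"
    unfolding exponents_def by blast
  define N' where "N' = max N N1"
  have "std_indicator N \<phi> k0 n = std_indicator N \<phi> k0 (n(a := N'))" if n: "n \<in> exponents D" and a: "a \<in> D" and na: "N' < n a" for n a
  proof -
    have le: "(n(a := N')) b \<le> n b" for b
      using na by simp
    have iff: "(k0, n) \<in> std_reps \<longleftrightarrow> (k0, n(a := N')) \<in> std_reps"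
    proof
      assume "(k0, n(a := N')) \<in> std_reps"
      then have "(k0, \<lambda>b. min ((n(a := N')) b) N1) \<in> std_reps"
        by (rule std_reps_down) simp
      moreover have "(\<lambda>b. min ((n(a := N')) b) N1) = (\<lambda>b. min (n b) N1)"
        using na by (auto simp: N'_def fun_eq_iff)
      ultimately show "(k0, n) \<in> std_reps"
        using N1[OF n] by simp
    next
      assume "(k0, n) \<in> std_reps"
      then show "(k0, n(a := N')) \<in> std_reps"
        by (rule std_reps_down) (rule le)
    qed
    have "trunc_type N (k0 + lin n) = trunc_type N (k0 + lin (n(a := N')))" if s: "(k0, n) \<in> std_reps" "(k0, n(a := N')) \<in> std_reps"
    proof -
      obtain \<omega>1 \<omega>2 where v: "valid \<omega>1 k0 n" "valid \<omega>2 k0 (n(a := N'))"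
        using std_reps_rep[OF s(1)] std_reps_rep[OF s(2)] unfolding is_rep_def by blast
      have "min (excess S (k0 + lin n) \<omega>) N = min (excess S (k0 + lin (n(a := N'))) \<omega>) N" if w: "\<omega> \<in> S" for \<omega>
      proof -
        define s where "s = excess S k0 \<omega> + (\<Sum>b\<in>D - {a}. n b * excess S b \<omega>)"
        have "(\<Sum>b\<in>D - {a}. (n(a := N')) b * excess S b \<omega>) = (\<Sum>b\<in>D - {a}. n b * excess S b \<omega>)"
          by (rule sum.cong) auto
        then have 1: "excess S (k0 + lin n) \<omega> = s + n a * excess S a \<omega>"
          "excess S (k0 + lin (n(a := N'))) \<omega> = s + N' * excess S a \<omega>"
          using valid_excess[OF v(1) w] valid_excess[OF v(2) w] a finiteD
          by (simp_all add: sum.remove[of D a] s_def)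
        show ?thesis
        proof (cases "excess S a \<omega> = 0")
          case False
          then have "N' * 1 \<le> N' * excess S a \<omega>" "n a * 1 \<le> n a * excess S a \<omega>"
            by (intro mult_left_mono; simp)+
          moreover have "N \<le> N'"
            by (simp add: N'_def)
          ultimately have "N \<le> excess S (k0 + lin n) \<omega>" "N \<le> excess S (k0 + lin (n(a := N'))) \<omega>"
            using na unfolding 1 by linarith+
          then show ?thesis by simp
        qed (simp add: 1)
      qed
      then show ?thesis
        by (auto simp: trunc_type_def)
    qed
    then show ?thesis
      using iff by (auto simp: std_indicator_def)
  qed
  then show ?thesis by blast
qed

definition weight_series :: "nat \<Rightarrow> (nat ^ 'n \<Rightarrow> nat) \<Rightarrow> nat \<Rightarrow> real" where
  "weight_series N \<phi> M = infsum (\<lambda>k. 1 / real q ^ norm1 k) {k. mn S k = M \<and> trunc_type N k = \<phi>}"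

lemma std_indicator_bound: "\<bar>std_indicator N \<phi> k0 n\<bar> \<le> 1"
  by (simp add: std_indicator_def)

text \<open>Every weight has exactly one standard representation \<open>k0 + lin n\<close>, so the
  sum splits over the finitely many remainders \<open>k0\<close>; level \<open>M\<close> leaves
  \<open>M - mn S k0\<close> for \<open>n\<close>, whence the delays.\<close>

lemma weight_series_eq: "weight_series N \<phi> M = (\<Sum>k0\<in>small_weights. 1 / real q ^ norm1 k0 * delay (mn S k0) (level_series (std_indicator N \<phi> k0)) M)"
proof -
  define B where "B = (\<lambda>k0. {n\<in>exponents D. mn S k0 + lev n = M})"
  define f where "f = (\<lambda>(k0, n). 1 / real q ^ norm1 k0 * (std_indicator N \<phi> k0 n * wt n))"
  define row where "row = (\<lambda>k0. 1 / real q ^ norm1 k0 * delay (mn S k0) (level_series (std_indicator N \<phi> k0)) M)"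
  define Y where "Y = {(k0, n)\<in>std_reps. mn S (k0 + lin n) = M \<and> trunc_type N (k0 + lin n) = \<phi>}"
  have row: "((\<lambda>n. f (k0, n)) has_sum row k0) (B k0)" for k0
  proof -
    have "(\<lambda>n. std_indicator N \<phi> k0 n * wt n) summable_on B k0"
      by (rule summable_wt[OF std_indicator_bound]) (auto simp: B_def)
    moreover have "infsum (\<lambda>n. std_indicator N \<phi> k0 n * wt n) (B k0) = delay (mn S k0) (level_series (std_indicator N \<phi> k0)) M"
    proof (cases "mn S k0 \<le> M")
      case True
      then have "B k0 = {n\<in>exponents D. lev n = M - mn S k0}"
        by (auto simp: B_def)
      then show ?thesis using True by (simp add: delay_def level_series_def)
    next
      case False
      then have "B k0 = {}" by (auto simp: B_def)
      then show ?thesis using False by (simp add: delay_def)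
    qed
    ultimately have "((\<lambda>n. std_indicator N \<phi> k0 n * wt n) has_sum delay (mn S k0) (level_series (std_indicator N \<phi> k0)) M) (B k0)"
      using has_sum_infsum[of "\<lambda>n. std_indicator N \<phi> k0 n * wt n" "B k0"] by simp
    then show ?thesis
      unfolding f_def row_def split by (rule has_sum_cmult_right)
  qed
  have "(row has_sum (\<Sum>k0\<in>small_weights. row k0)) small_weights"
    using finite_small_weights by (rule has_sum_finite)
  moreover have "f summable_on Sigma small_weights B"
    by (rule summable_on_SigmaI[OF row]) (use finite_small_weights wt_nonneg in \<open>auto simp: f_def std_indicator_def\<close>)
  ultimately have "(f has_sum (\<Sum>k0\<in>small_weights. row k0)) (Sigma small_weights B)"
    by (rule has_sum_SigmaI[OF row])
  also have "?this \<longleftrightarrow> ((\<lambda>(k0, n). 1 / real q ^ norm1 (k0 + lin n)) has_sum (\<Sum>k0\<in>small_weights. row k0)) Y"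
  proof (rule has_sum_cong_neutral)
    fix x assume "x \<in> Y - Sigma small_weights B"
    moreover have "x \<in> Sigma small_weights B" if x: "x \<in> Y" for x
    proof -
      obtain k0 n where [simp]: "x = (k0, n)" by force
      obtain \<omega> where "valid \<omega> k0 n" "k0 \<in> small_weights"
        using x by (auto simp: Y_def std_reps_def is_rep_def)
      then show ?thesis
        using valid_mn[of \<omega> k0 n] x by (auto simp: B_def Y_def exponents_def valid_def)
    qed
    ultimately show "(case x of (k0, n) \<Rightarrow> 1 / real q ^ norm1 (k0 + lin n)) = 0" by blast
  next
    fix x assume x: "x \<in> Sigma small_weights B - Y"
    obtain k0 n where [simp]: "x = (k0, n)" by force
    have "std_indicator N \<phi> k0 n = 0"
    proof (rule ccontr)
      assume "std_indicator N \<phi> k0 n \<noteq> 0"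
      then have "(k0, n) \<in> std_reps" "trunc_type N (k0 + lin n) = \<phi>"
        by (auto simp: std_indicator_def split: if_splits)
      moreover from this obtain \<omega> where "valid \<omega> k0 n"
        by (auto simp: std_reps_def is_rep_def)
      ultimately show False
        using x valid_mn(1)[of \<omega> k0 n] by (auto simp: Y_def B_def)
    qed
    then show "f x = 0" by (simp add: f_def)
  next
    fix x assume "x \<in> Sigma small_weights B \<inter> Y"
    then show "f x = (case x of (k0, n) \<Rightarrow> 1 / real q ^ norm1 (k0 + lin n))"
      by (auto simp: f_def Y_def std_indicator_def weight_lin)
  qed
  also have "\<dots> \<longleftrightarrow> ((\<lambda>k. 1 / real q ^ norm1 k) \<circ> (\<lambda>(k0, n). k0 + lin n) has_sum (\<Sum>k0\<in>small_weights. row k0)) Y"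
    by (rule has_sum_cong) auto
  also have "\<dots> \<longleftrightarrow> ((\<lambda>k. 1 / real q ^ norm1 k) has_sum (\<Sum>k0\<in>small_weights. row k0)) ((\<lambda>(k0, n). k0 + lin n) ` Y)"
    by (rule has_sum_reindex[symmetric])
      (rule inj_on_subset[OF bij_betw_imp_inj_on[OF bij_std_reps]], auto simp: Y_def)
  also have "(\<lambda>(k0, n). k0 + lin n) ` Y = {k. mn S k = M \<and> trunc_type N k = \<phi>}"
  proof -
    have "k \<in> (\<lambda>(k0, n). k0 + lin n) ` Y" if "mn S k = M" "trunc_type N k = \<phi>" for k
    proof -
      have "k \<in> (\<lambda>(k0, n). k0 + lin n) ` std_reps"
        unfolding bij_betw_imp_surj_on[OF bij_std_reps] by simp
      then obtain k0 n where "(k0, n) \<in> std_reps" "k = k0 + lin n"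
        by auto
      then show ?thesis
        using that by (intro image_eqI[of _ _ "(k0, n)"]) (auto simp: Y_def)
    qed
    then show ?thesis by (auto simp: Y_def)
  qed
  finally have "((\<lambda>k. 1 / real q ^ norm1 k) has_sum (\<Sum>k0\<in>small_weights. row k0)) {k. mn S k = M \<and> trunc_type N k = \<phi>}" .
  then show ?thesis
    unfolding weight_series_def row_def by (rule infsumI)
qed

lemma weight_series_rat_rec:
  assumes "distinct L" "set L = D"
  shows "rat_rec (map (\<lambda>a. (1 / real q ^ norm1 a, mn S a)) L) (weight_series N \<phi>)"
proof -
  have "rat_rec (map (\<lambda>a. (1 / real q ^ norm1 a, mn S a)) L) (level_series (std_indicator N \<phi> k0))" for k0
  proof -
    obtain N' where N': "\<And>n a. n \<in> exponents D \<Longrightarrow> a \<in> D \<Longrightarrow> N' < n a \<Longrightarrow> std_indicator N \<phi> k0 n = std_indicator N \<phi> k0 (n(a := N'))"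
      using std_indicator_stable by blast
    show ?thesis
    proof (rule level_series_rat_rec)
      show "std_indicator N \<phi> k0 n = std_indicator N \<phi> k0 (n(a := N'))" if "n \<in> exponents D" "a \<in> set L" "N' < n a" for n a
        using N' that assms by blast
    qed (use assms std_indicator_bound in \<open>auto simp: std_indicator_def\<close>)
  qed
  then have "rat_rec (map (\<lambda>a. (1 / real q ^ norm1 a, mn S a)) L)
      (\<lambda>M. \<Sum>k0\<in>small_weights. 1 / real q ^ norm1 k0 * delay (mn S k0) (level_series (std_indicator N \<phi> k0)) M)"
    by (intro rat_rec_sum rat_rec_cmult rat_rec_delay) auto
  then show ?thesis
    unfolding weight_series_eq .
qed

lemma weight_series_summable: "weight_series N \<phi> summable_on UNIV"
  unfolding weight_series_eq
  by (intro summable_on_finite_sum summable_on_cmult_right summable_delay summable_level_series[OF std_indicator_bound])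

lemma weight_summable: "(\<lambda>k :: nat ^ 'n. 1 / real q ^ norm1 k) summable_on UNIV"
proof -
  have "(\<lambda>n :: 'n \<Rightarrow> nat. \<Prod>i\<in>UNIV. (1 / real q) ^ n i) summable_on exponents UNIV"
    by (rule summable_geometric_exponents) (use q2 in auto)
  moreover have "bij_betw vec_nth (UNIV :: (nat ^ 'n) set) (exponents UNIV)"
    by (rule bij_betwI[where g = vec_lambda]) (auto simp: exponents_def vec_nth_inverse)
  ultimately have "(\<lambda>k :: nat ^ 'n. \<Prod>i\<in>UNIV. (1 / real q) ^ (k $ i)) summable_on UNIV"
    using summable_on_reindex_bij_betw by fastforce
  moreover have "(\<Prod>i\<in>UNIV. (1 / real q) ^ (k $ i)) = 1 / real q ^ norm1 k" for k :: "nat ^ 'n"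
    by (simp add: norm1_def power_sum[symmetric] power_one_over prod_dividef)
  ultimately show ?thesis by simp
qed

end

lemma weight_fan_facet_normals:
  assumes "finite (supp A)" "supp A \<noteq> {}" "2 \<le> q"
  shows "weight_fan (supp A) (facet_normals A) q"
proof
  show "finite (facet_normals A)"
    using assms by (intro finite_facet_normals)
  show "a \<noteq> 0" if "a \<in> facet_normals A" for a
    using that by (simp add: facet_normals_def)
  show "\<exists>k0 n. k = k0 + (\<Sum>a\<in>facet_normals A. n a *s a) \<and>
      (\<forall>i. k0 $ i \<le> (\<Sum>a\<in>facet_normals A. a $ i)) \<and> dot k0 \<omega> = mn (supp A) k0 \<and>
      (\<forall>a. n a \<noteq> 0 \<longrightarrow> a \<in> facet_normals A \<and> dot a \<omega> = mn (supp A) a)"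
    if "\<omega> \<in> supp A" "dot k \<omega> = mn (supp A) k" for k \<omega>
    by (rule weight_decomposition[OF assms(1) that])
qed (use assms in auto)

section \<open>The zeta function of a sum in separate variables\<close>

locale igusa_sum = haar v q M for v :: "'k::field_char_0 \<Rightarrow> int" and q
    and M :: "('k ^ ('n::finite + 'm::finite)) measure" +
  fixes A :: "nat ^ 'n \<Rightarrow> 'k" and B :: "nat ^ 'm \<Rightarrow> 'k"
  assumes finA: "finite (supp A)" and finB: "finite (supp B)"
    and intA: "\<And>\<omega>. vge v (A \<omega>) 0" and intB: "\<And>\<omega>. vge v (B \<omega>) 0"
    and neA: "supp A \<noteq> {}" and neB: "supp B \<noteq> {}"
    and ncA: "newton_noncritical A" and ncB: "newton_noncritical B"

sublocale igusa_sum \<subseteq> FA: weight_fan "supp A" "facet_normals A" q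
  by (rule weight_fan_facet_normals[OF finA neA q_ge_2])

sublocale igusa_sum \<subseteq> FB: weight_fan "supp B" "facet_normals B" q
  by (rule weight_fan_facet_normals[OF finB neB q_ge_2])

context igusa_sum
begin

definition lft :: "'k ^ ('n + 'm) \<Rightarrow> 'k ^ 'n" where
  "lft z = (\<chi> i. z $ Inl i)"

definition rgt :: "'k ^ ('n + 'm) \<Rightarrow> 'k ^ 'm" where
  "rgt z = (\<chi> j. z $ Inr j)"

lemma lft_integral: "z \<in> int_points v \<Longrightarrow> lft z \<in> int_points v"
  and rgt_integral: "z \<in> int_points v \<Longrightarrow> rgt z \<in> int_points v"
  by (auto simp: lft_def rgt_def int_points_def)

lemma lft_vcong: "vcong e z w \<Longrightarrow> vcong e (lft z) (lft w)"
  and rgt_vcong: "vcong e z w \<Longrightarrow> vcong e (rgt z) (rgt w)"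
  by (auto simp: lft_def rgt_def vcong_def)

lemma lft_axis: "lft (z + axis (Inl i) t) = lft z + axis i t" "lft (z + axis (Inr j) t) = lft z"
  and rgt_axis: "rgt (z + axis (Inr j) t) = rgt z + axis j t" "rgt (z + axis (Inl i) t) = rgt z"
  by (auto simp: lft_def rgt_def vec_eq_iff axis_def)

text \<open>The function on the units left over from a cell once the smaller of the two powers of
  \<open>unif\<close> is extracted; \<open>d\<close> and \<open>d'\<close> are the surplus powers,
  so in use at least one of them is 0.\<close>

definition twisted_sum :: "nat \<Rightarrow> (nat ^ 'n \<Rightarrow> nat) \<Rightarrow> nat \<Rightarrow> (nat ^ 'm \<Rightarrow> nat) \<Rightarrow> 'k ^ ('n + 'm) \<Rightarrow> 'k" where
  "twisted_sum d \<phi> d' \<psi> z = unif ^ d * psum (supp A) (twist A \<phi>) (lft z) + unif ^ d' * psum (supp B) (twist B \<psi>) (rgt z)"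

definition twisted_deriv :: "nat \<Rightarrow> (nat ^ 'n \<Rightarrow> nat) \<Rightarrow> nat \<Rightarrow> (nat ^ 'm \<Rightarrow> nat) \<Rightarrow> 'n + 'm \<Rightarrow> 'k ^ ('n + 'm) \<Rightarrow> 'k" where
  "twisted_deriv d \<phi> d' \<psi> x z = (case x of Inl i \<Rightarrow> unif ^ d * pder (supp A) (twist A \<phi>) i (lft z)
     | Inr j \<Rightarrow> unif ^ d' * pder (supp B) (twist B \<psi>) j (rgt z))"

lemma unif_integral: "vge v (unif ^ d) 0"
  by (simp add: vge_unif_power)

lemma smooth_twisted_sum: "smooth (twisted_sum d \<phi> d' \<psi>) (twisted_deriv d \<phi> d' \<psi>)"
  unfolding smooth_def
proof (intro ballI conjI allI impI)
  fix z :: "'k ^ ('n + 'm)" assume z: "z \<in> int_points v"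
  note tA = twist_integral[OF intA, where \<phi> = \<phi>] and tB = twist_integral[OF intB, where \<phi> = \<psi>]
  note zl = lft_integral[OF z] and zr = rgt_integral[OF z]
  show "vge v (twisted_sum d \<phi> d' \<psi> z) 0"
    unfolding twisted_sum_def by (intro vge_add vge_mult_left unif_integral psum_integral tA tB zl zr)
  show "vge v (twisted_deriv d \<phi> d' \<psi> x z) 0" for x
    unfolding twisted_deriv_def by (cases x) (auto intro!: vge_mult_left unif_integral psum_integral tA tB zl zr)
  show "vge v (twisted_sum d \<phi> d' \<psi> z - twisted_sum d \<phi> d' \<psi> w) (int e)" if "vcong e z w" for e w
  proof -
    have "twisted_sum d \<phi> d' \<psi> z - twisted_sum d \<phi> d' \<psi> w =
        unif ^ d * (psum (supp A) (twist A \<phi>) (lft z) - psum (supp A) (twist A \<phi>) (lft w)) +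
        unif ^ d' * (psum (supp B) (twist B \<psi>) (rgt z) - psum (supp B) (twist B \<psi>) (rgt w))"
      by (simp add: twisted_sum_def algebra_simps)
    then show ?thesis
      using that by (auto intro!: vge_add vge_mult_left unif_integral psum_cong tA tB zl zr lft_vcong rgt_vcong)
  qed
  show "vge v (twisted_deriv d \<phi> d' \<psi> x z - twisted_deriv d \<phi> d' \<psi> x w) (int e)" if "vcong e z w" for e w x
    using that unfolding twisted_deriv_def
    by (cases x) (auto simp: right_diff_distrib[symmetric]
        intro!: vge_mult_left unif_integral psum_cong tA tB zl zr lft_vcong rgt_vcong)
  show "vge v (twisted_sum d \<phi> d' \<psi> (z + axis x t) - twisted_sum d \<phi> d' \<psi> z - t * twisted_deriv d \<phi> d' \<psi> x z) (2 * int e)"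
    if t: "vge v t (int e)" for x e t
  proof (cases x)
    case (Inl i)
    then have "twisted_sum d \<phi> d' \<psi> (z + axis x t) - twisted_sum d \<phi> d' \<psi> z - t * twisted_deriv d \<phi> d' \<psi> x z =
        unif ^ d * (psum (supp A) (twist A \<phi>) (lft z + axis i t) - psum (supp A) (twist A \<phi>) (lft z) -
          t * pder (supp A) (twist A \<phi>) i (lft z))"
      by (simp add: twisted_sum_def twisted_deriv_def lft_axis rgt_axis algebra_simps)
    then show ?thesis
      using t by (auto intro!: vge_mult_left unif_integral psum_taylor tA zl)
  next
    case (Inr j)
    then have "twisted_sum d \<phi> d' \<psi> (z + axis x t) - twisted_sum d \<phi> d' \<psi> z - t * twisted_deriv d \<phi> d' \<psi> x z =
        unif ^ d' * (psum (supp B) (twist B \<psi>) (rgt z + axis j t) - psum (supp B) (twist B \<psi>) (rgt z) -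
          t * pder (supp B) (twist B \<psi>) j (rgt z))"
      by (simp add: twisted_sum_def twisted_deriv_def lft_axis rgt_axis algebra_simps)
    then show ?thesis
      using t by (auto intro!: vge_mult_left unif_integral psum_taylor tB zr)
  qed
qed

definition sum_fun :: "'k ^ ('n + 'm) \<Rightarrow> 'k" where
  "sum_fun z = peval A (lft z) + peval B (rgt z)"

lemma cong_preserving_sum_fun: "cong_preserving sum_fun"
proof -
  have "sum_fun = twisted_sum 0 (\<lambda>_. 0) 0 (\<lambda>_. 0)"
    by (simp add: sum_fun_def twisted_sum_def peval_eq_psum twist_def fun_eq_iff psum_def)
  then show ?thesis
    using smooth_twisted_sum[of 0 "\<lambda>_. 0" 0 "\<lambda>_. 0"] unfolding smooth_def cong_preserving_def by auto
qed

definition left_weight :: "('n + 'm \<Rightarrow> nat) \<Rightarrow> nat ^ 'n" where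
  "left_weight \<kappa> = (\<chi> i. \<kappa> (Inl i))"

definition right_weight :: "('n + 'm \<Rightarrow> nat) \<Rightarrow> nat ^ 'm" where
  "right_weight \<kappa> = (\<chi> j. \<kappa> (Inr j))"

definition dA :: "nat ^ 'n \<Rightarrow> nat ^ 'm \<Rightarrow> nat" where
  "dA k l = mn (supp A) k - min (mn (supp A) k) (mn (supp B) l)"

definition dB :: "nat ^ 'n \<Rightarrow> nat ^ 'm \<Rightarrow> nat" where
  "dB k l = mn (supp B) l - min (mn (supp A) k) (mn (supp B) l)"

definition cell_fun :: "nat ^ 'n \<Rightarrow> nat ^ 'm \<Rightarrow> 'k ^ ('n + 'm) \<Rightarrow> 'k" where
  "cell_fun k l = twisted_sum (dA k l) (excess (supp A) k) (dB k l) (excess (supp B) l)"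

lemma sum_fun_cell:
  assumes "z \<in> cell \<kappa>"
  shows "sum_fun z = unif ^ min (mn (supp A) (left_weight \<kappa>)) (mn (supp B) (right_weight \<kappa>)) * cell_fun (left_weight \<kappa>) (right_weight \<kappa>) (\<chi> i. z $ i / unif ^ \<kappa> i)"
proof -
  define u where "u = (\<chi> i. z $ i / unif ^ \<kappa> i)"
  have 1: "lft z = (\<chi> i. unif ^ (left_weight \<kappa> $ i) * lft u $ i)" and 2: "rgt z = (\<chi> i. unif ^ (right_weight \<kappa> $ i) * rgt u $ i)"
    using unif by (auto simp: lft_def rgt_def u_def left_weight_def right_weight_def vec_eq_iff)
  have eq: "unif ^ a * x = unif ^ min a b * (unif ^ (a - min a b) * x)" for a b :: nat and x :: 'k
    by (simp add: mult.assoc[symmetric] power_add[symmetric])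
  have "sum_fun z = unif ^ mn (supp A) (left_weight \<kappa>) * psum (supp A) (twist A (excess (supp A) (left_weight \<kappa>))) (lft u) +
      unif ^ mn (supp B) (right_weight \<kappa>) * psum (supp B) (twist B (excess (supp B) (right_weight \<kappa>))) (rgt u)"
    unfolding sum_fun_def 1 2 by (simp only: peval_scale[OF finA] peval_scale[OF finB])
  also have "\<dots> = unif ^ min (mn (supp A) (left_weight \<kappa>)) (mn (supp B) (right_weight \<kappa>)) * cell_fun (left_weight \<kappa>) (right_weight \<kappa>) u"
    unfolding cell_fun_def twisted_sum_def dA_def dB_def
    by (subst eq[of "mn (supp A) (left_weight \<kappa>)" _ "mn (supp B) (right_weight \<kappa>)"],
        subst eq[of "mn (supp B) (right_weight \<kappa>)" _ "mn (supp A) (left_weight \<kappa>)"])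
      (simp add: min.commute distrib_left)
  finally show ?thesis
    by (simp add: u_def)
qed

definition crit :: nat where
  "crit = (SOME c. \<forall>k l z. z \<in> units \<longrightarrow>
     (\<exists>x. \<not> vge v (twisted_deriv (dA k l) (excess (supp A) k) (dB k l) (excess (supp B) l) x z) (int c + 1)))"

text \<open>The summand with the smaller power of \<open>unif\<close> has surplus exponent 0, so its
  gradient bound from \<open>uniform_noncritical\<close> survives; the other summand cannot
  interfere, since the variables are separate.\<close>

lemma crit:
  assumes "z \<in> units"
  shows "\<exists>x. \<not> vge v (twisted_deriv (dA k l) (excess (supp A) k) (dB k l) (excess (supp B) l) x z) (int crit + 1)"
proof -
  obtain cA where cA: "\<And>k u. (\<And>i. u $ i \<noteq> 0 \<and> v (u $ i) = 0) \<Longrightarrow>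
      \<exists>i. \<not> vge v (pder (supp A) (twist A (excess (supp A) k)) i u) (int cA + 1)"
    using uniform_noncritical[OF finA neA intA ncA] by blast
  obtain cB where cB: "\<And>k u. (\<And>i. u $ i \<noteq> 0 \<and> v (u $ i) = 0) \<Longrightarrow>
      \<exists>i. \<not> vge v (pder (supp B) (twist B (excess (supp B) k)) i u) (int cB + 1)"
    using uniform_noncritical[OF finB neB intB ncB] by blast
  have "\<exists>x. \<not> vge v (twisted_deriv (dA k l) (excess (supp A) k) (dB k l) (excess (supp B) l) x z) (int (max cA cB) + 1)"
    if z: "z \<in> units" for k l z
  proof (cases "mn (supp A) k \<le> mn (supp B) l")
    case True
    have "\<exists>i. \<not> vge v (pder (supp A) (twist A (excess (supp A) k)) i (lft z)) (int cA + 1)"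
      using z by (intro cA) (auto simp: lft_def units_def)
    then obtain i where "\<not> vge v (pder (supp A) (twist A (excess (supp A) k)) i (lft z)) (int (max cA cB) + 1)"
      using vge_mono[of _ "int (max cA cB) + 1" "int cA + 1"] by auto
    moreover have "dA k l = 0"
      using True by (simp add: dA_def)
    ultimately show ?thesis
      by (intro exI[of _ "Inl i"]) (simp add: twisted_deriv_def)
  next
    case False
    have "\<exists>i. \<not> vge v (pder (supp B) (twist B (excess (supp B) l)) i (rgt z)) (int cB + 1)"
      using z by (intro cB) (auto simp: rgt_def units_def)
    then obtain i where "\<not> vge v (pder (supp B) (twist B (excess (supp B) l)) i (rgt z)) (int (max cA cB) + 1)"
      using vge_mono[of _ "int (max cA cB) + 1" "int cB + 1"] by auto
    moreover have "dB k l = 0"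
      using False by (simp add: dB_def)
    ultimately show ?thesis
      by (intro exI[of _ "Inr i"]) (simp add: twisted_deriv_def)
  qed
  then have "\<exists>c. \<forall>k l z. z \<in> units \<longrightarrow>
     (\<exists>x. \<not> vge v (twisted_deriv (dA k l) (excess (supp A) k) (dB k l) (excess (supp B) l) x z) (int c + 1))"
    by blast
  from someI_ex[OF this] show ?thesis
    using assms unfolding crit_def by blast
qed

text \<open>The threshold of \<open>density\<close>, from which on the measures decay geometrically.
  Only divisibility by \<open>unif ^ e\<close> with \<open>e \<le> prec\<close> has to be known, so
  exponents may be truncated there.\<close>

definition prec :: nat where
  "prec = 2 * crit + 1"

definition clamp :: "int \<Rightarrow> int" where
  "clamp \<delta> = max (- int prec) (min (int prec) \<delta>)"

text \<open>\<open>nat \<delta>\<close> and \<open>nat (- \<delta>)\<close> recover the two surplus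
  exponents from the signed difference of the minima.\<close>

definition cell_poly :: "(nat ^ 'n \<Rightarrow> nat) \<Rightarrow> (nat ^ 'm \<Rightarrow> nat) \<Rightarrow> int \<Rightarrow> complex \<Rightarrow> complex" where
  "cell_poly \<phi> \<psi> \<delta> = cell_num prec (\<lambda>e. measure M {u\<in>units. vge v (twisted_sum (nat \<delta>) \<phi> (nat (- \<delta>)) \<psi> u) (int e)})"

lemma rat_poly_fun_cell_poly: "rat_poly_fun (cell_poly \<phi> \<psi> \<delta>)"
proof -
  define w where "w = (\<lambda>e. measure M {u\<in>units. vge v (twisted_sum (nat \<delta>) \<phi> (nat (- \<delta>)) \<psi> u) (int e)})"
  have rat: "complex_of_real (w e) \<in> \<rat>" for e
    unfolding w_def by (rule Rats_of_real[OF measure_cyl_Rats[OF cyl_units_vge[OF smooth_twisted_sum]]])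
  have "(\<lambda>T. T / of_nat q) = (\<lambda>T :: complex. 1 / of_nat q * T)"
    by auto
  then have "rat_poly_fun (\<lambda>T. T / of_nat q)"
    using rat_poly_fun_cmult[of "1 / of_nat q", OF _ rat_poly_fun_ident] by simp
  then show ?thesis
    unfolding cell_poly_def w_def[symmetric] cell_num_def of_real_diff using rat
    by (intro rat_poly_fun_add rat_poly_fun_mult rat_poly_fun_diff rat_poly_fun_sum rat_poly_fun_power rat_poly_fun_ident rat_poly_fun_const) (auto intro!: Rats_diff)
qed

text \<open>Only the minimum and the truncated difference of \<open>a\<close> and \<open>b\<close>
  enter; hence homogeneity under simultaneous delay and eventual constancy in each variable
  alone.\<close>

definition kern :: "(nat ^ 'n \<Rightarrow> nat) \<Rightarrow> (nat ^ 'm \<Rightarrow> nat) \<Rightarrow> nat \<Rightarrow> nat \<Rightarrow> complex \<Rightarrow> complex" where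
  "kern \<phi> \<psi> a b T = T ^ min a b * cell_poly \<phi> \<psi> (clamp (int a - int b)) T"

lemma cell_num_cong: "(\<And>e. e \<le> N \<Longrightarrow> w e = w' e) \<Longrightarrow> cell_num N w = cell_num N w'"
  by (auto simp: cell_num_def fun_eq_iff intro!: sum.cong)

text \<open>Truncating every exponent at \<open>prec\<close> alters the function only modulo
  \<open>unif ^ prec\<close>, and \<open>cell_num\<close> reads the measures only up to index
  \<open>prec\<close>.\<close>

lemma cell_num_type:
  "cell_num prec (\<lambda>e. measure M {u\<in>units. vge v (cell_fun k l u) (int e)}) =
    cell_poly (FA.trunc_type prec k) (FB.trunc_type prec l) (clamp (int (mn (supp A) k) - int (mn (supp B) l)))"
  unfolding cell_poly_def
proof (rule cell_num_cong)
  fix e assume e: "e \<le> prec"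
  define \<delta> where "\<delta> = clamp (int (mn (supp A) k) - int (mn (supp B) l))"
  have d: "nat \<delta> = min (dA k l) prec" "nat (- \<delta>) = min (dB k l) prec"
    unfolding \<delta>_def clamp_def dA_def dB_def by (auto simp: min_def max_def)
  have "vge v (cell_fun k l u) (int e) \<longleftrightarrow> vge v (twisted_sum (nat \<delta>) (FA.trunc_type prec k) (nat (- \<delta>)) (FB.trunc_type prec l) u) (int e)"
    if u: "u \<in> units" for u
  proof (rule vge_cong_iff)
    have uO: "u \<in> int_points v"
      using u by (auto simp: units_iff)
    have "vge v (twist A (excess (supp A) k) \<omega> - twist A (FA.trunc_type prec k) \<omega>) (int prec)" if "\<omega> \<in> supp A" for \<omega>
      using that vge_unif_power_min[of "excess (supp A) k \<omega>" prec]
      by (auto simp: twist_def FA.trunc_type_def right_diff_distrib[symmetric] intro!: vge_mult_left intA)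
    then have 1: "vge v (psum (supp A) (twist A (excess (supp A) k)) (lft u) -
        psum (supp A) (twist A (FA.trunc_type prec k)) (lft u)) (int prec)"
      by (intro psum_coeff_cong lft_integral[OF uO])
    have "vge v (twist B (excess (supp B) l) \<omega> - twist B (FB.trunc_type prec l) \<omega>) (int prec)" if "\<omega> \<in> supp B" for \<omega>
      using that vge_unif_power_min[of "excess (supp B) l \<omega>" prec]
      by (auto simp: twist_def FB.trunc_type_def right_diff_distrib[symmetric] intro!: vge_mult_left intB)
    then have 2: "vge v (psum (supp B) (twist B (excess (supp B) l)) (rgt u) -
        psum (supp B) (twist B (FB.trunc_type prec l)) (rgt u)) (int prec)"
      by (intro psum_coeff_cong rgt_integral[OF uO])
    have "vge v (cell_fun k l u - twisted_sum (nat \<delta>) (FA.trunc_type prec k) (nat (- \<delta>)) (FB.trunc_type prec l) u) (int prec)"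
      unfolding cell_fun_def twisted_sum_def d add_diff_add
      by (rule vge_add; rule vge_mult_cong)
        (use 1 2 vge_unif_power_min in \<open>auto intro!: unif_integral psum_integral twist_integral intA intB lft_integral rgt_integral uO\<close>)
    then show "vge v (cell_fun k l u - twisted_sum (nat \<delta>) (FA.trunc_type prec k) (nat (- \<delta>)) (FB.trunc_type prec l) u) (int e)"
      using e vge_mono by auto
  qed
  then have "{u\<in>units. vge v (cell_fun k l u) (int e)} =
      {u\<in>units. vge v (twisted_sum (nat \<delta>) (FA.trunc_type prec k) (nat (- \<delta>)) (FB.trunc_type prec l) u) (int e)}"
    by blast
  then show "measure M {u\<in>units. vge v (cell_fun k l u) (int e)} =
      measure M {u\<in>units. vge v (twisted_sum (nat (clamp (int (mn (supp A) k) - int (mn (supp B) l)))) (FA.trunc_type prec k)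
        (nat (- clamp (int (mn (supp A) k) - int (mn (supp B) l)))) (FB.trunc_type prec l) u) (int e)}"
    by (simp add: \<delta>_def)
qed

lemma sum_split: "sum \<kappa> UNIV = norm1 (left_weight \<kappa>) + norm1 (right_weight \<kappa>)"
  unfolding UNIV_Plus_UNIV[symmetric] by (subst sum.Plus) (auto simp: norm1_def left_weight_def right_weight_def)

definition pair_term :: "complex \<Rightarrow> nat ^ 'n \<Rightarrow> nat ^ 'm \<Rightarrow> complex" where
  "pair_term T k l = of_real (1 / real q ^ norm1 k * (1 / real q ^ norm1 l)) *
     kern (FA.trunc_type prec k) (FB.trunc_type prec l) (mn (supp A) k) (mn (supp B) l) T"

lemma zeta_has_sum_pairs:
  assumes s: "0 < Re s"
  shows "((\<lambda>(k, l). pair_term (T_of s) k l) has_sum igusa_zeta v q M sum_fun s * (1 - T_of s / of_nat q)) (UNIV \<times> UNIV)"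
proof -
  define T where "T = T_of s"
  have "norm (T / of_nat q) < 1"
    using norm_T_of[OF s] q_pos by (simp add: T_def norm_divide divide_simps)
  then have nz: "1 - T / of_nat q \<noteq> 0" by auto
  have "((\<lambda>\<kappa>. T_of s ^ min (mn (supp A) (left_weight \<kappa>)) (mn (supp B) (right_weight \<kappa>)) / of_nat q ^ sum \<kappa> UNIV *
      (cell_num (2 * crit + 1) (\<lambda>e. measure M {u\<in>units. vge v (cell_fun (left_weight \<kappa>) (right_weight \<kappa>) u) (int e)}) (T_of s) / (1 - T_of s / of_nat q)))
      has_sum igusa_zeta v q M sum_fun s) UNIV"
    by (rule zeta_has_sum_cells[OF cong_preserving_sum_fun s sum_fun_cell])
      (auto simp: cell_fun_def intro: smooth_twisted_sum crit)
  then have "((\<lambda>\<kappa>. T ^ min (mn (supp A) (left_weight \<kappa>)) (mn (supp B) (right_weight \<kappa>)) / of_nat q ^ sum \<kappa> UNIV *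
      (cell_num prec (\<lambda>e. measure M {u\<in>units. vge v (cell_fun (left_weight \<kappa>) (right_weight \<kappa>) u) (int e)}) T / (1 - T / of_nat q)) *
      (1 - T / of_nat q)) has_sum igusa_zeta v q M sum_fun s * (1 - T / of_nat q)) UNIV"
    unfolding T_def prec_def by (rule has_sum_cmult_left)
  also have "(\<lambda>\<kappa>. T ^ min (mn (supp A) (left_weight \<kappa>)) (mn (supp B) (right_weight \<kappa>)) / of_nat q ^ sum \<kappa> UNIV *
      (cell_num prec (\<lambda>e. measure M {u\<in>units. vge v (cell_fun (left_weight \<kappa>) (right_weight \<kappa>) u) (int e)}) T / (1 - T / of_nat q)) *
      (1 - T / of_nat q)) = (\<lambda>\<kappa>. pair_term T (left_weight \<kappa>) (right_weight \<kappa>))"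
    using nz unfolding cell_num_type pair_term_def kern_def sum_split by (simp add: power_add fun_eq_iff)
  finally have *: "((\<lambda>\<kappa>. pair_term T (left_weight \<kappa>) (right_weight \<kappa>)) has_sum igusa_zeta v q M sum_fun s * (1 - T / of_nat q)) UNIV" .
  define j :: "(nat ^ 'n) \<times> (nat ^ 'm) \<Rightarrow> 'n + 'm \<Rightarrow> nat" where "j = (\<lambda>(k, l). case_sum (vec_nth k) (vec_nth l))"
  have j: "left_weight (j (k, l)) = k" "right_weight (j (k, l)) = l" for k l
    by (auto simp: j_def left_weight_def right_weight_def vec_eq_iff)
  have "bij_betw j (UNIV \<times> UNIV) UNIV"
    by (rule bij_betwI[where g = "\<lambda>\<kappa>. (left_weight \<kappa>, right_weight \<kappa>)"])
      (auto simp: j, auto simp: j_def left_weight_def right_weight_def fun_eq_iff split: sum.splits)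
  from has_sum_reindex_bij_betw[OF this, of "\<lambda>\<kappa>. pair_term T (left_weight \<kappa>) (right_weight \<kappa>)"] *
  have "((\<lambda>p. pair_term T (left_weight (j p)) (right_weight (j p))) has_sum igusa_zeta v q M sum_fun s * (1 - T / of_nat q)) (UNIV \<times> UNIV)"
    by blast
  also have "(\<lambda>p. pair_term T (left_weight (j p)) (right_weight (j p))) = (\<lambda>(k, l). pair_term T k l)"
    using j by (auto simp: fun_eq_iff)
  finally show ?thesis
    by (simp add: T_def)
qed

text \<open>The truncated difference takes finitely many values, and the power of \<open>T\<close>
  has norm at most 1.\<close>

lemma bounded_kern: "bounded_kernel (kern \<phi> \<psi>)"
  unfolding bounded_kernel_def
proof (intro allI impI)
  fix T :: complex assume T: "norm T < 1"
  have "norm (kern \<phi> \<psi> a b T) \<le> (\<Sum>\<delta>\<in>{- int prec..int prec}. norm (cell_poly \<phi> \<psi> \<delta> T))" for a b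
  proof -
    have "norm (kern \<phi> \<psi> a b T) \<le> 1 * norm (cell_poly \<phi> \<psi> (clamp (int a - int b)) T)"
      unfolding kern_def norm_mult norm_power using T by (intro mult_right_mono power_le_one) auto
    also have "\<dots> \<le> (\<Sum>\<delta>\<in>{- int prec..int prec}. norm (cell_poly \<phi> \<psi> \<delta> T))"
      unfolding mult_1 by (rule member_le_sum) (auto simp: clamp_def)
    finally show ?thesis .
  qed
  then show "\<exists>C. \<forall>a b. norm (kern \<phi> \<psi> a b T) \<le> C" by blast
qed

lemma pairing_kern_rational:
  assumes "distinct LA" "set LA = facet_normals A" "distinct LB" "set LB = facet_normals B"
  shows "rat_poly_fun (\<lambda>T. pairing (kern \<phi> \<psi>) (FA.weight_series prec \<phi>) (FB.weight_series prec \<psi>) T *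
    pole_product (map (\<lambda>a. (1 / real q ^ norm1 a, mn (supp A) a)) LA) (map (\<lambda>b. (1 / real q ^ norm1 b, mn (supp B) b)) LB) T)"
proof (rule pairing_rational)
  show "bounded_kernel (kern \<phi> \<psi>)" by (rule bounded_kern)
  show "rat_poly_fun (kern \<phi> \<psi> a b)" for a b
    unfolding kern_def by (intro rat_poly_fun_mult rat_poly_fun_power rat_poly_fun_ident rat_poly_fun_cell_poly)
  show "\<exists>N g. rat_poly_fun g \<and> (\<forall>b\<ge>N. \<forall>T. kern \<phi> \<psi> a b T = g T)" for a
  proof -
    have "kern \<phi> \<psi> a b T = T ^ a * cell_poly \<phi> \<psi> (- int prec) T" if "a + prec \<le> b" for b T
    proof -
      have "clamp (int a - int b) = - int prec" "min a b = a"
        using that by (auto simp: clamp_def min_def max_def)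
      then show ?thesis by (simp add: kern_def)
    qed
    moreover have "rat_poly_fun (\<lambda>T. T ^ a * cell_poly \<phi> \<psi> (- int prec) T)"
      by (intro rat_poly_fun_mult rat_poly_fun_power rat_poly_fun_ident rat_poly_fun_cell_poly)
    ultimately show ?thesis by blast
  qed
  show "\<exists>N g. rat_poly_fun g \<and> (\<forall>a\<ge>N. \<forall>T. kern \<phi> \<psi> a b T = g T)" for b
  proof -
    have "kern \<phi> \<psi> a b T = T ^ b * cell_poly \<phi> \<psi> (int prec) T" if "b + prec \<le> a" for a T
    proof -
      have "clamp (int a - int b) = int prec" "min a b = b"
        using that by (auto simp: clamp_def min_def max_def)
      then show ?thesis by (simp add: kern_def)
    qed
    moreover have "rat_poly_fun (\<lambda>T. T ^ b * cell_poly \<phi> \<psi> (int prec) T)"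
      by (intro rat_poly_fun_mult rat_poly_fun_power rat_poly_fun_ident rat_poly_fun_cell_poly)
    ultimately show ?thesis by blast
  qed
  show "kern \<phi> \<psi> (a + l) (b + l) T = T ^ l * kern \<phi> \<psi> a b T" for a b l T
  proof -
    have "min (a + l) (b + l) = l + min a b"
      by (simp add: min_def)
    then show ?thesis by (simp add: kern_def power_add)
  qed
qed (use assms FA.weight_series_rat_rec FB.weight_series_rat_rec FA.weight_series_summable FB.weight_series_summable FA.\<alpha> FB.\<alpha> in \<open>auto simp: admissible_def\<close>)

text \<open>Pairs of weights are grouped by truncated types and minima. On a group the kernel is
  constant and the sum factors into the two weight series; only finitely many types occur, so the
  outer sum is finite.\<close>

lemma zeta_eq_sum_pairing:
  assumes s: "0 < Re s"
  shows "igusa_zeta v q M sum_fun s * (1 - T_of s / of_nat q) =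
    (\<Sum>(\<phi>, \<psi>)\<in>range (FA.trunc_type prec) \<times> range (FB.trunc_type prec). pairing (kern \<phi> \<psi>) (FA.weight_series prec \<phi>) (FB.weight_series prec \<psi>) (T_of s))"
proof -
  define T where "T = T_of s"
  define Z where "Z = igusa_zeta v q M sum_fun s * (1 - T_of s / of_nat q)"
  have T: "norm T < 1"
    unfolding T_def by (rule norm_T_of[OF s])
  define f where "f = (\<lambda>(k, l). pair_term T k l)"
  define g where "g = (\<lambda>(k, l). ((FA.trunc_type prec k, FB.trunc_type prec l), (mn (supp A) k, mn (supp B) l)))"
  have f: "(f has_sum Z) UNIV"
    using zeta_has_sum_pairs[OF s] by (simp add: f_def T_def Z_def)
  have grouped: "((\<lambda>i. infsum f {x\<in>UNIV. g x = i}) has_sum Z) UNIV"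
    using has_sum_group[OF has_sum_imp_summable[OF f], where g = g] infsumI[OF f] by simp
  have fib: "infsum f {x\<in>UNIV. g x = ((\<phi>, \<psi>), (a, b))} =
      of_real (FA.weight_series prec \<phi> a) * of_real (FB.weight_series prec \<psi> b) * kern \<phi> \<psi> a b T" for \<phi> \<psi> a b
  proof -
    define X where "X = {k. mn (supp A) k = a \<and> FA.trunc_type prec k = \<phi>}"
    define Y where "Y = {l. mn (supp B) l = b \<and> FB.trunc_type prec l = \<psi>}"
    have XY: "{x\<in>UNIV. g x = ((\<phi>, \<psi>), (a, b))} = X \<times> Y"
      by (auto simp: g_def X_def Y_def)
    have hX: "((\<lambda>k. 1 / real q ^ norm1 k) has_sum FA.weight_series prec \<phi> a) X"
      unfolding FA.weight_series_def X_def by (intro has_sum_infsum summable_on_subset_banach[OF FA.weight_summable]) auto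
    have hY: "((\<lambda>k. 1 / real q ^ norm1 k) has_sum FB.weight_series prec \<psi> b) Y"
      unfolding FB.weight_series_def Y_def by (intro has_sum_infsum summable_on_subset_banach[OF FB.weight_summable]) auto
    have rows: "((\<lambda>l. case (k, l) of (k, l) \<Rightarrow> 1 / real q ^ norm1 k * (1 / real q ^ norm1 l)) has_sum
        1 / real q ^ norm1 k * FB.weight_series prec \<psi> b) Y" for k :: "nat ^ 'n"
      unfolding prod.case by (rule has_sum_cmult_right[OF hY])
    have tot: "((\<lambda>k. 1 / real q ^ norm1 k * FB.weight_series prec \<psi> b) has_sum FA.weight_series prec \<phi> a * FB.weight_series prec \<psi> b) X"
      by (rule has_sum_cmult_left[OF hX])
    have "(\<lambda>(k, l). 1 / real q ^ norm1 k * (1 / real q ^ norm1 l)) summable_on X \<times> Y"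
      by (rule summable_on_SigmaI[OF rows has_sum_imp_summable[OF tot]]) auto
    then have "((\<lambda>(k, l). 1 / real q ^ norm1 k * (1 / real q ^ norm1 l)) has_sum FA.weight_series prec \<phi> a * FB.weight_series prec \<psi> b) (X \<times> Y)"
      by (rule has_sum_SigmaI[OF rows tot])
    then have "((\<lambda>p. complex_of_real (case p of (k, l) \<Rightarrow> 1 / real q ^ norm1 k * (1 / real q ^ norm1 l)) * kern \<phi> \<psi> a b T)
        has_sum of_real (FA.weight_series prec \<phi> a * FB.weight_series prec \<psi> b) * kern \<phi> \<psi> a b T) (X \<times> Y)"
      by (intro has_sum_cmult_left has_sum_of_real)
    also have "?this \<longleftrightarrow> (f has_sum of_real (FA.weight_series prec \<phi> a * FB.weight_series prec \<psi> b) * kern \<phi> \<psi> a b T) (X \<times> Y)"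
      by (rule has_sum_cong) (auto simp: f_def pair_term_def X_def Y_def)
    finally show ?thesis
      unfolding XY using infsumI by fastforce
  qed
  have "((\<lambda>i. infsum f {x\<in>UNIV. g x = i}) has_sum Z) (UNIV \<times> UNIV)"
    using grouped by (simp only: UNIV_Times_UNIV)
  then have "((\<lambda>(\<phi>, \<psi>). pairing (kern \<phi> \<psi>) (FA.weight_series prec \<phi>) (FB.weight_series prec \<psi>) T) has_sum Z) UNIV"
  proof (rule has_sum_SigmaD)
    fix p :: "(nat ^ 'n \<Rightarrow> nat) \<times> (nat ^ 'm \<Rightarrow> nat)"
    obtain \<phi> \<psi> where p: "p = (\<phi>, \<psi>)" by force
    have "((\<lambda>(a, b). of_real (FA.weight_series prec \<phi> a) * of_real (FB.weight_series prec \<psi> b) * kern \<phi> \<psi> a b T) has_sum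
        pairing (kern \<phi> \<psi>) (FA.weight_series prec \<phi>) (FB.weight_series prec \<psi>) T) (UNIV \<times> UNIV)"
      unfolding pairing_def by (rule has_sum_infsum[OF pairing_summable[OF bounded_kern FA.weight_series_summable FB.weight_series_summable T]])
    moreover have "(\<lambda>y. infsum f {x\<in>UNIV. g x = (p, y)}) =
        (\<lambda>(a, b). of_real (FA.weight_series prec \<phi> a) * of_real (FB.weight_series prec \<psi> b) * kern \<phi> \<psi> a b T)"
    proof
      fix y :: "nat \<times> nat"
      obtain a b where y: "y = (a, b)" by force
      show "infsum f {x\<in>UNIV. g x = (p, y)} =
          (case y of (a, b) \<Rightarrow> of_real (FA.weight_series prec \<phi> a) * of_real (FB.weight_series prec \<psi> b) * kern \<phi> \<psi> a b T)"
        unfolding p y by (simp only: fib prod.case)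
    qed
    ultimately show "((\<lambda>y. infsum f {x\<in>UNIV. g x = (p, y)}) has_sum
        (case p of (\<phi>, \<psi>) \<Rightarrow> pairing (kern \<phi> \<psi>) (FA.weight_series prec \<phi>) (FB.weight_series prec \<psi>) T)) UNIV"
      by (simp only: p prod.case UNIV_Times_UNIV)
  qed
  moreover have "((\<lambda>(\<phi>, \<psi>). pairing (kern \<phi> \<psi>) (FA.weight_series prec \<phi>) (FB.weight_series prec \<psi>) T) has_sum
      (\<Sum>(\<phi>, \<psi>)\<in>range (FA.trunc_type prec) \<times> range (FB.trunc_type prec). pairing (kern \<phi> \<psi>) (FA.weight_series prec \<phi>) (FB.weight_series prec \<psi>) T)) UNIV"
  proof (rule has_sum_finite_neutralI)
    fix p assume p: "p \<in> UNIV - range (FA.trunc_type prec) \<times> range (FB.trunc_type prec)"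
    obtain \<phi> \<psi> where [simp]: "p = (\<phi>, \<psi>)" by force
    have "FA.weight_series prec \<phi> = (\<lambda>_. 0)" if "\<phi> \<notin> range (FA.trunc_type prec)"
    proof -
      have "{k. mn (supp A) k = a \<and> FA.trunc_type prec k = \<phi>} = {}" for a
        using that by blast
      then show ?thesis unfolding FA.weight_series_def by (simp only: infsum_empty)
    qed
    moreover have "FB.weight_series prec \<psi> = (\<lambda>_. 0)" if "\<psi> \<notin> range (FB.trunc_type prec)"
    proof -
      have "{k. mn (supp B) k = b \<and> FB.trunc_type prec k = \<psi>} = {}" for b
        using that by blast
      then show ?thesis unfolding FB.weight_series_def by (simp only: infsum_empty)
    qed
    moreover have "pairing K (\<lambda>_. 0) W T = 0" "pairing K W (\<lambda>_. 0) T = 0" for K W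
      by (auto simp: pairing_def case_prod_unfold)
    ultimately show "(case p of (\<phi>, \<psi>) \<Rightarrow> pairing (kern \<phi> \<psi>) (FA.weight_series prec \<phi>) (FB.weight_series prec \<psi>) T) = 0"
      using p by auto
  qed (use FA.finite_range_trunc_type FB.finite_range_trunc_type in auto)
  ultimately show ?thesis
    unfolding Z_def T_def using has_sum_unique by blast
qed

lemma powr_eq_T:
  "(of_nat q :: complex) powr (- of_nat l * s - of_nat x - of_nat y) = T_of s ^ l / of_nat q ^ (x + y)"
proof -
  have q: "of_nat q \<noteq> (0 :: complex)"
    using q_pos by auto
  have "(of_nat q :: complex) powr (- of_nat l * s - of_nat x - of_nat y) =
      exp (of_nat l * (- s * Ln (of_nat q)) - of_nat (x + y) * Ln (of_nat q))"
    using q by (simp add: powr_def algebra_simps)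
  also have "\<dots> = exp (- s * Ln (of_nat q)) ^ l / exp (Ln (of_nat q)) ^ (x + y)"
    by (simp only: exp_diff exp_of_nat_mult)
  also have "\<dots> = T_of s ^ l / of_nat q ^ (x + y)"
    by (simp only: exp_Ln[OF q] powr_def q if_False)
  finally show ?thesis .
qed

lemma pole_term_eq_q_pow_c:
  "pole_term (1 / real q ^ norm1 a, mn (supp A) a) (1 / real q ^ norm1 b, mn (supp B) b) (T_of s) = q_pow_c q A B a b s"
proof -
  have m: "nat \<lfloor>m_newton A a\<rfloor> = mn (supp A) a" "nat \<lfloor>m_newton B b\<rfloor> = mn (supp B) b"
    using m_newton_eq[OF finA neA] m_newton_eq[OF finB neB] by simp_all
  show ?thesis
    unfolding q_pow_c_def Let_def m powr_eq_T pole_term_def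
    by (simp add: power_one_over power_mult[symmetric] power_add mult.commute)
qed

text \<open>The factor \<open>T ^ lcm m m'\<close> already has norm below 1. This keeps the
  denominator away from zero for \<open>Re s > 0\<close>, so that one may divide by it.\<close>

lemma norm_pole_term_less:
  assumes "norm T < 1" "0 \<le> \<alpha>" "\<alpha> \<le> 1" "0 \<le> \<beta>" "\<beta> \<le> 1"
  shows "norm (pole_term (\<alpha>, m) (\<beta>, m') T) < 1"
proof (cases "m = 0 \<or> m' = 0")
  case False
  then have "0 < lcm m m'" by (simp add: lcm_pos_nat)
  then have "norm T ^ lcm m m' < 1"
    using assms(1) by (simp add: power_less_one_iff)
  moreover have "\<alpha> ^ x * \<beta> ^ y \<le> 1" "0 \<le> \<alpha> ^ x * \<beta> ^ y" for x y
    using assms by (auto intro!: mult_le_one power_le_one)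
  ultimately have "\<alpha> ^ x * \<beta> ^ y * norm T ^ lcm m m' < 1" for x y
    by (meson mult_left_le_one_le norm_ge_zero order_le_less_trans zero_le_power)
  then show ?thesis
    using False assms by (simp add: pole_term_def norm_mult norm_power)
qed (simp add: pole_term_def)

theorem zeta_rational:
  "\<exists>P :: rat poly. \<forall>s. 0 < Re s \<longrightarrow> igusa_zeta v q M sum_fun s =
     poly (map_poly of_rat P) (T_of s) / ((1 - of_nat q powr (- 1 - s)) *
       (\<Prod>(a, b)\<in>facet_normals A \<times> facet_normals B. 1 - q_pow_c q A B a b s))"
proof -
  obtain LA where LA: "distinct LA" "set LA = facet_normals A"
    using finite_distinct_list[OF FA.finiteD] by blast
  obtain LB where LB: "distinct LB" "set LB = facet_normals B"
    using finite_distinct_list[OF FB.finiteD] by blast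
  define den where "den = pole_product (map (\<lambda>a. (1 / real q ^ norm1 a, mn (supp A) a)) LA)
    (map (\<lambda>b. (1 / real q ^ norm1 b, mn (supp B) b)) LB)"
  have "rat_poly_fun (\<lambda>T. \<Sum>p\<in>range (FA.trunc_type prec) \<times> range (FB.trunc_type prec).
      (case p of (\<phi>, \<psi>) \<Rightarrow> \<lambda>T. pairing (kern \<phi> \<psi>) (FA.weight_series prec \<phi>) (FB.weight_series prec \<psi>) T * den T) T)"
    unfolding den_def by (intro rat_poly_fun_sum) (auto intro!: pairing_kern_rational LA LB)
  then obtain P :: "rat poly" where P: "\<And>T. norm T < 1 \<Longrightarrow>
      (\<Sum>p\<in>range (FA.trunc_type prec) \<times> range (FB.trunc_type prec).
        (case p of (\<phi>, \<psi>) \<Rightarrow> \<lambda>T. pairing (kern \<phi> \<psi>) (FA.weight_series prec \<phi>) (FB.weight_series prec \<psi>) T * den T) T) = poly (map_poly of_rat P) T"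
    using rat_poly_fun_imp_rat_poly by blast
  show ?thesis
  proof (intro exI[of _ P] allI impI)
    fix s :: complex assume s: "0 < Re s"
    define T where "T = T_of s"
    have T: "norm T < 1"
      unfolding T_def by (rule norm_T_of[OF s])
    have "igusa_zeta v q M sum_fun s * (1 - T / of_nat q) * den T =
        (\<Sum>p\<in>range (FA.trunc_type prec) \<times> range (FB.trunc_type prec).
        (case p of (\<phi>, \<psi>) \<Rightarrow> \<lambda>T. pairing (kern \<phi> \<psi>) (FA.weight_series prec \<phi>) (FB.weight_series prec \<psi>) T * den T) T)"
      unfolding T_def zeta_eq_sum_pairing[OF s] sum_distrib_right by (rule sum.cong) auto
    then have num: "igusa_zeta v q M sum_fun s * (1 - T / of_nat q) * den T = poly (map_poly of_rat P) T"
      using P[OF T] by simp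
    have den: "den T = (\<Prod>(a, b)\<in>facet_normals A \<times> facet_normals B. 1 - q_pow_c q A B a b s)"
    proof -
      have "den T = (\<Prod>a\<leftarrow>LA. \<Prod>b\<leftarrow>LB. 1 - q_pow_c q A B a b s)"
        unfolding den_def pole_product_def T_def by (simp add: o_def pole_term_eq_q_pow_c)
      also have "\<dots> = (\<Prod>a\<in>facet_normals A. \<Prod>b\<in>facet_normals B. 1 - q_pow_c q A B a b s)"
        unfolding LA(2)[symmetric] LB(2)[symmetric]
        by (simp only: prod.distinct_set_conv_list[OF LA(1)] prod.distinct_set_conv_list[OF LB(1)])
      finally show ?thesis
        by (simp add: prod.cartesian_product)
    qed
    have "1 - q_pow_c q A B a b s \<noteq> 0" if "a \<in> facet_normals A" "b \<in> facet_normals B" for a b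
    proof -
      have "norm (q_pow_c q A B a b s) < 1"
        unfolding pole_term_eq_q_pow_c[symmetric] T_def[symmetric] using FA.\<alpha>[OF that(1)] FB.\<alpha>[OF that(2)]
        by (intro norm_pole_term_less T) auto
      then show ?thesis by auto
    qed
    then have den_nz: "den T \<noteq> 0"
      unfolding den using FA.finiteD FB.finiteD by (auto simp: prod_zero_iff)
    have "norm (T / of_nat q) < 1"
      using T q_pos by (simp add: norm_divide divide_simps)
    then have nz: "1 - T / of_nat q \<noteq> 0" by auto
    \<comment> \<open>The shape of \<open>powr_eq_T\<close> with \<open>l = 1\<close>: the factor
      \<open>1 - T / q\<close> left by the lifting argument is \<open>1 - q^(-1-s)\<close>.\<close>
    have "- 1 - s = - of_nat 1 * s - of_nat 1 - of_nat 0"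
      by simp
    then have "of_nat q powr (- 1 - s) = T / of_nat q"
      by (simp only: powr_eq_T) (simp add: T_def)
    then show "igusa_zeta v q M sum_fun s = poly (map_poly of_rat P) (T_of s) / ((1 - of_nat q powr (- 1 - s)) *
       (\<Prod>(a, b)\<in>facet_normals A \<times> facet_normals B. 1 - q_pow_c q A B a b s))"
      unfolding den[symmetric] T_def[symmetric] num[symmetric] using nz den_nz by simp
  qed
qed

end

theorem mainTheorem1:
  fixes v :: "'k::field_char_0 \<Rightarrow> int" and q :: nat
    and A :: "nat ^ 'n \<Rightarrow> 'k" and B :: "nat ^ 'm \<Rightarrow> 'k"
    and M :: "('k ^ ('n + 'm)) measure"
  assumes "p_adic_field v q"
    and "haar_normalized v M"
    and "finite (supp A)" and "finite (supp B)"
    and "\<forall>\<omega>. vge v (A \<omega>) 0" and "\<forall>\<omega>. vge v (B \<omega>) 0"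
    and "supp A \<noteq> {}" and "supp B \<noteq> {}"
    and "peval A 0 = 0" and "peval B 0 = 0"
    and "newton_noncritical A" and "newton_noncritical B"
  shows "\<exists>P :: rat poly. \<forall>s::complex. 0 < Re s \<longrightarrow>
     igusa_zeta v q M (\<lambda>z. peval A (\<chi> i. z $ Inl i) + peval B (\<chi> j. z $ Inr j)) s =
       poly (map_poly of_rat P) ((of_nat q :: complex) powr (- s)) /
       ((1 - (of_nat q :: complex) powr (- 1 - s)) *
        (\<Prod>(a, b) \<in> facet_normals A \<times> facet_normals B. 1 - q_pow_c q A B a b s))"
proof -
  interpret igusa_sum v q M A B
    by unfold_locales (use assms in auto)
  have "(\<lambda>z. peval A (\<chi> i. z $ Inl i) + peval B (\<chi> j. z $ Inr j)) = sum_fun"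
    by (simp add: sum_fun_def lft_def rgt_def fun_eq_iff)
  then show ?thesis
    using zeta_rational by simp
qed

end
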